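(* For every $n\in\mathbb{N}$, the pure virtual braid group $PvB_n$ is quadratic: if $I$ denotes the augmentation ideal of the rational group ring $\mathbb{Q}PvB_n$, then the associated graded algebra $\operatorname{gr}_I\mathbb{Q}PvB_n=\bigoplus_{m\ge 0} I^m/I^{m+1}$ is a quadratic algebra.
   Context: $PvB_n$ is the group with generators $R_{ij}$, $1\le i\ne j\le n$, and relations $R_{ij}R_{ik}R_{jk}=R_{jk}R_{ik}R_{ij}$ and $R_{ij}R_{kl}=R_{kl}R_{ij}$ for $i,j,k,l$ distinct. For a group $G$ with rational group ring $\mathbb{Q}G$ and augmentation ideal $I$ (kernel of $g\mapsto 1$), $G$ is called quadratic if $\operatorname{gr}_I\mathbb{Q}G=\bigoplus_m I^m/I^{m+1}$ is quadratic, i.e. it is generated by its degree-1 part $V=I/I^2$ and its ideal of relations (the kernel of the natural surjection $TV\to\operatorname{gr}_I\mathbb{Q}G$ from the tensor algebra) is generated by its degree-2 component; equivalently, the natural surjection from $TV/\langle R\rangle$ onto $\operatorname{gr}_I\mathbb{Q}G$, where $R\subseteq V\otimes V$ is the kernel of multiplication $V\otimes V\to I^2/I^3$, is an isomorphism. *)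

theory Defs
  imports Complex_Main "HOL-Algebra.Group"
begin

text \<open>Rational vector spaces are realised as spaces of functions into rat with
pointwise operations. qspan S is the set of finite rational linear combinations
of elements of S.\<close>

inductive_set qspan :: "('x \<Rightarrow> rat) set \<Rightarrow> ('x \<Rightarrow> rat) set" for S where
  qspan_zero: "(\<lambda>_. 0) \<in> qspan S"
| qspan_add: "x \<in> S \<Longrightarrow> v \<in> qspan S \<Longrightarrow> (\<lambda>z. c * x z + v z) \<in> qspan S"

definition fsupp :: "('x \<Rightarrow> rat) \<Rightarrow> 'x set" where
  "fsupp f = {x. f x \<noteq> 0}"

definition basis_vec :: "'x \<Rightarrow> 'x \<Rightarrow> rat" where
  "basis_vec t = (\<lambda>s. if s = t then 1 else 0)"

definition grp_ring :: "('g, 'm) monoid_scheme \<Rightarrow> ('g \<Rightarrow> rat) set" where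
  "grp_ring G = {f. finite (fsupp f) \<and> fsupp f \<subseteq> carrier G}"

definition conv :: "('g, 'm) monoid_scheme \<Rightarrow> ('g \<Rightarrow> rat) \<Rightarrow> ('g \<Rightarrow> rat) \<Rightarrow> 'g \<Rightarrow> rat" where
  "conv G f h = (\<lambda>z. \<Sum>(x, y) \<in> {(x, y). x \<in> carrier G \<and> y \<in> carrier G \<and> f x \<noteq> 0 \<and> h y \<noteq> 0
                                   \<and> x \<otimes>\<^bsub>G\<^esub> y = z}. f x * h y)"

definition augmentation :: "('g \<Rightarrow> rat) \<Rightarrow> rat" where
  "augmentation f = (\<Sum>x \<in> fsupp f. f x)"

definition aug_ideal :: "('g, 'm) monoid_scheme \<Rightarrow> ('g \<Rightarrow> rat) set" where
  "aug_ideal G = {f \<in> grp_ring G. augmentation f = 0}"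

fun gprod :: "('g, 'm) monoid_scheme \<Rightarrow> ('g \<Rightarrow> rat) list \<Rightarrow> 'g \<Rightarrow> rat" where
  "gprod G [] = basis_vec \<one>\<^bsub>G\<^esub>"
| "gprod G (x # xs) = conv G x (gprod G xs)"

definition aug_pow :: "('g, 'm) monoid_scheme \<Rightarrow> nat \<Rightarrow> ('g \<Rightarrow> rat) set" where
  "aug_pow G m = (if m = 0 then grp_ring G
     else qspan {gprod G xs | xs. length xs = m \<and> set xs \<subseteq> aug_ideal G})"

text \<open>Formal linear combinations of m-tuples of elements of I: this is the free
rational vector space F_m on I^m. The tensor power V^{\<otimes>m} of V = I/I^2 is the
quotient of F_m by the subspace tensor_rel_span G m spanned by the
multilinearity relations and by the tuples having an entry in I^2.\<close>

definition tuples :: "('g, 'm) monoid_scheme \<Rightarrow> nat \<Rightarrow> ('g \<Rightarrow> rat) list set" where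
  "tuples G m = {t. length t = m \<and> set t \<subseteq> aug_ideal G}"

definition free_tuples :: "('g, 'm) monoid_scheme \<Rightarrow> nat \<Rightarrow> (('g \<Rightarrow> rat) list \<Rightarrow> rat) set" where
  "free_tuples G m = qspan (basis_vec ` tuples G m)"

definition tensor_rels :: "('g, 'm) monoid_scheme \<Rightarrow> nat \<Rightarrow> (('g \<Rightarrow> rat) list \<Rightarrow> rat) set" where
  "tensor_rels G m =
     {(\<lambda>s. basis_vec (a @ [(\<lambda>z. x z + y z)] @ b) s - basis_vec (a @ [x] @ b) s
            - basis_vec (a @ [y] @ b) s)
       | a b x y. a @ [x] @ b \<in> tuples G m \<and> y \<in> aug_ideal G}
   \<union> {(\<lambda>s. basis_vec (a @ [(\<lambda>z. c * x z)] @ b) s - c * basis_vec (a @ [x] @ b) s)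
       | a b x c. a @ [x] @ b \<in> tuples G m}
   \<union> {basis_vec (a @ [x] @ b) | a b x. a @ [x] @ b \<in> tuples G m \<and> x \<in> aug_pow G 2}"

definition tensor_rel_span :: "('g, 'm) monoid_scheme \<Rightarrow> nat \<Rightarrow> (('g \<Rightarrow> rat) list \<Rightarrow> rat) set" where
  "tensor_rel_span G m = qspan (tensor_rels G m)"

text \<open>The multiplication map F_m \<rightarrow> QG, t \<mapsto> product of the entries of t. Modulo
I^{m+1} it induces the natural map V^{\<otimes>m} \<rightarrow> I^m/I^{m+1}.\<close>
definition mult_map :: "('g, 'm) monoid_scheme \<Rightarrow> (('g \<Rightarrow> rat) list \<Rightarrow> rat) \<Rightarrow> 'g \<Rightarrow> rat" where
  "mult_map G \<phi> = (\<lambda>z. \<Sum>t \<in> fsupp \<phi>. \<phi> t * gprod G t z)"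

text \<open>Lifts of the quadratic relations R = ker(V\<otimes>V \<rightarrow> I^2/I^3).\<close>
definition quad_rel_lifts :: "('g, 'm) monoid_scheme \<Rightarrow> (('g \<Rightarrow> rat) list \<Rightarrow> rat) set" where
  "quad_rel_lifts G = {\<rho> \<in> free_tuples G 2. mult_map G \<rho> \<in> aug_pow G 3}"

text \<open>u \<otimes> \<rho> \<otimes> w for pure tensors u = a, w = b and \<rho> \<in> F_2.\<close>
definition insert_mid :: "'a list \<Rightarrow> 'a list \<Rightarrow> ('a list \<Rightarrow> rat) \<Rightarrow> 'a list \<Rightarrow> rat" where
  "insert_mid a b \<rho> = (\<lambda>t. if length t = length a + 2 + length b \<and> take (length a) t = a
        \<and> drop (length a + 2) t = b then \<rho> (take 2 (drop (length a) t)) else 0)"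

text \<open>Degree-m component of the two-sided ideal of TV generated by R (lifted to F_m).\<close>
definition quad_ideal_part :: "('g, 'm) monoid_scheme \<Rightarrow> nat \<Rightarrow> (('g \<Rightarrow> rat) list \<Rightarrow> rat) set" where
  "quad_ideal_part G m = {insert_mid a b \<rho> | a b \<rho>.
      length a + 2 + length b = m \<and> set a \<subseteq> aug_ideal G \<and> set b \<subseteq> aug_ideal G
      \<and> \<rho> \<in> quad_rel_lifts G}"

text \<open>G is quadratic: gr_I QG is generated by V = I/I^2 (the map TV \<rightarrow> gr is onto in
every degree m) and the kernel of TV \<rightarrow> gr_I QG is the ideal generated by R
(in every degree m, an element of V^{\<otimes>m} mapping to 0 in I^m/I^{m+1} lies in the
degree-m part of the ideal generated by R).\<close>
definition quadratic_group :: "('g, 'm) monoid_scheme \<Rightarrow> bool" where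
  "quadratic_group G \<longleftrightarrow> group G \<and>
    (\<forall>m. \<forall>y \<in> aug_pow G m. \<exists>\<phi> \<in> free_tuples G m.
        (\<lambda>z. y z - mult_map G \<phi> z) \<in> aug_pow G (Suc m)) \<and>
    (\<forall>m. \<forall>\<phi> \<in> free_tuples G m. mult_map G \<phi> \<in> aug_pow G (Suc m) \<longrightarrow>
        \<phi> \<in> qspan (tensor_rels G m \<union> quad_ideal_part G m))"

text \<open>Letters (i, j, True) = R_ij and (i, j, False) = R_ij^{-1}, 1 \<le> i \<noteq> j \<le> n.\<close>
type_synonym letter = "nat \<times> nat \<times> bool"

definition pvb_letters :: "nat \<Rightarrow> letter set" where
  "pvb_letters n = {(i, j, b). 1 \<le> i \<and> i \<le> n \<and> 1 \<le> j \<and> j \<le> n \<and> i \<noteq> j}"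

fun linv :: "letter \<Rightarrow> letter" where
  "linv (i, j, b) = (i, j, \<not> b)"

inductive pvb_rel :: "nat \<Rightarrow> letter list \<Rightarrow> letter list \<Rightarrow> bool" for n where
  refl: "pvb_rel n w w"
| sym: "pvb_rel n u v \<Longrightarrow> pvb_rel n v u"
| trans: "pvb_rel n u v \<Longrightarrow> pvb_rel n v w \<Longrightarrow> pvb_rel n u w"
| cong: "pvb_rel n u v \<Longrightarrow> pvb_rel n (a @ u @ b) (a @ v @ b)"
| cancel: "x \<in> pvb_letters n \<Longrightarrow> pvb_rel n [x, linv x] []"
| rel3: "\<lbrakk>{i, j, k} \<subseteq> {1..n}; distinct [i, j, k]\<rbrakk> \<Longrightarrow>
     pvb_rel n [(i, j, True), (i, k, True), (j, k, True)] [(j, k, True), (i, k, True), (i, j, True)]"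
| rel4: "\<lbrakk>{i, j, k, l} \<subseteq> {1..n}; distinct [i, j, k, l]\<rbrakk> \<Longrightarrow>
     pvb_rel n [(i, j, True), (k, l, True)] [(k, l, True), (i, j, True)]"

definition pvb_class :: "nat \<Rightarrow> letter list \<Rightarrow> letter list set" where
  "pvb_class n w = {v \<in> lists (pvb_letters n). pvb_rel n w v}"

definition PvB :: "nat \<Rightarrow> letter list set monoid" where
  "PvB n = \<lparr> carrier = pvb_class n ` lists (pvb_letters n),
            mult = (\<lambda>X Y. {w \<in> lists (pvb_letters n). \<exists>u \<in> X. \<exists>v \<in> Y. pvb_rel n (u @ v) w}),
            one = pvb_class n [] \<rparr>"

end

theory Submission
  imports Defs "HOL-Library.Poly_Mapping"
begin

text \<open>Put R_ij = 1 + r_ij. Modulo high powers of the augmentation ideal the group ring becomes the free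
algebra on the r_ij modulo the ideal of the relations, written as polynomials with quadratic leading forms, and
quadraticity says that in each degree the lowest-degree parts of elements of this ideal are generated
by those quadratic forms. After a further choice of weights on the letters, the leading forms of
suitable combinations of the relations become commutators [x, y], for x, y running over the edges of a graph.
So the task is to show that a linear dependency between the a [x, y] b lifts to the relations up
to terms of higher weight. Such a dependency is a cycle in the graph of words under commutation of
adjacent letters. It is filled in by moving a canonically chosen letter to the front, which needs only one
identity of relations per triangle of the commutation graph: Jacobi's, if one of the three letters
is disjoint from the other two, and otherwise a combination of Zamolodchikov's tetrahedron identities on four
strands.\<close>

section \<open>The free associative algebra\<close>

text \<open>The obstacle is cancellation: a combination of multiples a rho b may be heavier than its
  summands. What must be shown is strictness, namely that it can then be rewritten with summands as
  heavy as itself (\<open>relspan_filt\<close>). Cycles never appear explicitly: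
  \<open>potential\<close> is a function on words whose increment along an edge is the relation of
  that edge, up to heavier relations, so its linear extension recovers a combination of relations
  from its lightest words alone and gives 0 once these cancel. One filtration serves both purposes
  of the weights: every letter weighs D plus a bounded amount that breaks ties. For large D a longer
  word is heavier in the degrees concerned, so the cubic terms of the relations and the second-order
  terms of the tetrahedron identity are negligible. How large D must be depends on the degree m, so
  it is chosen only when m is known. On the side of the group, the inverse of R_ij is a power series
  in r_ij. Cutting it off after degree m yields a map that is well defined and multiplicative only
  modulo the ideal and words longer than m, which is enough in degree m.\<close>

datatype 'a fword = FW (letters: "'a list")

instantiation fword :: (type) monoid_add
begin

definition zero_fword :: "'a fword" where "0 = FW []"
definition plus_fword :: "'a fword \<Rightarrow> 'a fword \<Rightarrow> 'a fword" where
  "u + v = FW (letters u @ letters v)"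

instance
  by standard (auto simp: zero_fword_def plus_fword_def)

end

text \<open>Polynomial mappings multiply by convolution over the addition of their keys; with
  concatenation as addition this is the noncommutative product.\<close>

type_synonym 'a falg = "'a fword \<Rightarrow>\<^sub>0 rat"

definition mon :: "rat \<Rightarrow> 'a list \<Rightarrow> 'a falg" where
  "mon c w = Poly_Mapping.single (FW w) c"

abbreviation word :: "'a list \<Rightarrow> 'a falg" where
  "word w \<equiv> mon 1 w"

abbreviation gen :: "'a \<Rightarrow> 'a falg" where
  "gen x \<equiv> mon 1 [x]"

abbreviation coeff :: "'a falg \<Rightarrow> 'a list \<Rightarrow> rat" where
  "coeff p w \<equiv> Poly_Mapping.lookup p (FW w)"

lemma mon_mult [simp]: "mon c u * mon d v = mon (c * d) (u @ v)"
  by (simp add: mon_def mult_single plus_fword_def)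

lemma mon_mult_assoc [simp]: "mon c u * (mon d v * p) = mon (c * d) (u @ v) * p"
  by (metis mon_mult mult.assoc)

lemma mon_add: "mon c w + mon d w = mon (c + d) w"
  by (simp add: mon_def single_add)

lemma mon_zero [simp]: "mon 0 w = 0"
  by (simp add: mon_def)

lemma mon_uminus: "- mon c w = mon (- c) w"
  by (simp add: mon_def single_uminus)

lemma word_Nil: "word [] = 1"
  unfolding mon_def single_one [symmetric] zero_fword_def ..

lemma coeff_mon: "coeff (mon c u) w = (if u = w then c else 0)"
  by (simp add: mon_def lookup_single when_def)

lemma falg_sum_mon: "p = (\<Sum>k\<in>Poly_Mapping.keys p. mon (Poly_Mapping.lookup p k) (letters k))"
proof (rule poly_mapping_eqI)
  fix k
  have "Poly_Mapping.lookup (\<Sum>k\<in>Poly_Mapping.keys p. mon (Poly_Mapping.lookup p k) (letters k)) k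
      = (\<Sum>j\<in>Poly_Mapping.keys p. if j = k then Poly_Mapping.lookup p j else 0)"
    by (simp add: lookup_sum mon_def lookup_single when_def)
  also have "\<dots> = Poly_Mapping.lookup p k"
    by (simp add: sum.delta in_keys_iff)
  finally show "Poly_Mapping.lookup p k = Poly_Mapping.lookup
      (\<Sum>k\<in>Poly_Mapping.keys p. mon (Poly_Mapping.lookup p k) (letters k)) k" ..
qed

text \<open>The premise ties each monomial to a nonzero coefficient of the fixed \<open>q\<close>,
  so a condition on the support of \<open>q\<close> is at hand in every step, although
  \<open>P\<close> is only known for partial sums.\<close>

lemma falg_induct [case_names zero add]:
  assumes "P 0"
    and "\<And>c w p. coeff q w = c \<Longrightarrow> c \<noteq> 0 \<Longrightarrow> P p \<Longrightarrow> P (mon c w + p)"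
  shows "P q"
proof -
  have "P (\<Sum>k\<in>K. mon (Poly_Mapping.lookup q k) (letters k))"
    if "finite K" "K \<subseteq> Poly_Mapping.keys q" for K
    using that
  proof (induction K rule: finite_induct)
    case (insert k K)
    then show ?case using assms(2)[of "letters k"] by (auto simp: in_keys_iff)
  qed (use assms(1) in simp)
  from this[of "Poly_Mapping.keys q"] show ?thesis using falg_sum_mon[of q] by simp
qed

lemma mon_Nil_commute: "mon c [] * p = p * mon c []"
  by (induction p rule: falg_induct) (simp_all add: distrib_left distrib_right mult.commute)

section \<open>Linear extension of functions on words\<close>

definition lin :: "('a list \<Rightarrow> rat) \<Rightarrow> 'a falg \<Rightarrow> rat" where
  "lin f p = (\<Sum>k\<in>Poly_Mapping.keys p. Poly_Mapping.lookup p k * f (letters k))"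

lemma lin_superset:
  assumes "finite K" "Poly_Mapping.keys p \<subseteq> K"
  shows "lin f p = (\<Sum>k\<in>K. Poly_Mapping.lookup p k * f (letters k))"
  unfolding lin_def by (rule sum.mono_neutral_left) (use assms in \<open>auto simp: in_keys_iff\<close>)

lemma lin_add: "lin f (p + q) = lin f p + lin f q"
proof -
  let ?K = "Poly_Mapping.keys p \<union> Poly_Mapping.keys q"
  have fin: "finite ?K" by simp
  have "lin f (p + q) = (\<Sum>k\<in>?K. Poly_Mapping.lookup (p + q) k * f (letters k))"
    by (rule lin_superset[OF fin keys_add])
  also have "\<dots> = lin f p + lin f q"
    using lin_superset[OF fin, of p f] lin_superset[OF fin, of q f]
    by (simp add: lookup_add distrib_right sum.distrib)
  finally show ?thesis .
qed

lemma lin_zero [simp]: "lin f 0 = 0"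
  by (simp add: lin_def)

lemma lin_mon [simp]: "lin f (mon c w) = c * f w"
  by (simp add: lin_def mon_def)

lemma lin_uminus: "lin f (- p) = - lin f p"
  using lin_add[of f p "- p"] by simp

lemma lin_diff: "lin f (p - q) = lin f p - lin f q"
  using lin_add[of f p "- q"] by (simp add: lin_uminus)

definition alin :: "('a list \<Rightarrow> 'b falg) \<Rightarrow> 'a falg \<Rightarrow> 'b falg" where
  "alin f p = (\<Sum>k\<in>Poly_Mapping.keys p. mon (Poly_Mapping.lookup p k) [] * f (letters k))"

lemma alin_superset:
  assumes "finite K" "Poly_Mapping.keys p \<subseteq> K"
  shows "alin f p = (\<Sum>k\<in>K. mon (Poly_Mapping.lookup p k) [] * f (letters k))"
  unfolding alin_def by (rule sum.mono_neutral_left) (use assms in \<open>auto simp: in_keys_iff\<close>)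

lemma alin_add: "alin f (p + q) = alin f p + alin f q"
proof -
  let ?K = "Poly_Mapping.keys p \<union> Poly_Mapping.keys q"
  have fin: "finite ?K" by simp
  have "alin f (p + q) = (\<Sum>k\<in>?K. mon (Poly_Mapping.lookup (p + q) k) [] * f (letters k))"
    by (rule alin_superset[OF fin keys_add])
  also have "\<dots> = alin f p + alin f q"
    using alin_superset[OF fin, of p f] alin_superset[OF fin, of q f]
    by (simp add: lookup_add mon_add [symmetric] distrib_right sum.distrib)
  finally show ?thesis .
qed

lemma alin_zero [simp]: "alin f 0 = 0"
  by (simp add: alin_def)

lemma alin_mon [simp]: "alin f (mon c w) = mon c [] * f w"
  by (simp add: alin_def mon_def)

lemma alin_uminus: "alin f (- p) = - alin f p"
  using alin_add[of f p "- p"] by (simp add: add_eq_0_iff)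

lemma alin_diff: "alin f (p - q) = alin f p - alin f q"
  using alin_add[of f p "- q"] by (simp add: alin_uminus)

section \<open>Weight filtrations and deformed commutators\<close>

abbreviation wt :: "('a \<Rightarrow> nat) \<Rightarrow> 'a list \<Rightarrow> nat" where
  "wt \<delta> w \<equiv> sum_list (map \<delta> w)"

definition filt :: "('a \<Rightarrow> nat) \<Rightarrow> nat \<Rightarrow> 'a falg set" where
  "filt \<delta> k = {p. \<forall>w. coeff p w \<noteq> 0 \<longrightarrow> k \<le> wt \<delta> w}"

lemma filt_zero [simp]: "0 \<in> filt \<delta> k"
  by (simp add: filt_def)

lemma filt_0 [simp]: "p \<in> filt \<delta> 0"
  by (simp add: filt_def)

lemma filt_add: "p \<in> filt \<delta> k \<Longrightarrow> q \<in> filt \<delta> k \<Longrightarrow> p + q \<in> filt \<delta> k"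
  unfolding filt_def by (simp add: lookup_add) (metis add.right_neutral)

lemma filt_uminus: "p \<in> filt \<delta> k \<Longrightarrow> - p \<in> filt \<delta> k"
  by (simp add: filt_def)

lemma filt_diff: "p \<in> filt \<delta> k \<Longrightarrow> q \<in> filt \<delta> k \<Longrightarrow> p - q \<in> filt \<delta> k"
  using filt_add[OF _ filt_uminus, of p \<delta> k q] by simp

lemma filt_mono: "p \<in> filt \<delta> k \<Longrightarrow> l \<le> k \<Longrightarrow> p \<in> filt \<delta> l"
  unfolding filt_def by force

lemma filt_mon: "k \<le> wt \<delta> w \<Longrightarrow> mon c w \<in> filt \<delta> k"
  by (auto simp: filt_def coeff_mon)

lemma filt_induct [consumes 1, case_names zero add]:
  assumes "q \<in> filt \<delta> k" "P 0"
    and "\<And>c w p. k \<le> wt \<delta> w \<Longrightarrow> P p \<Longrightarrow> P (mon c w + p)"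
  shows "P q"
proof (rule falg_induct)
  fix c w p assume "coeff q w = c" "c \<noteq> 0" "P p"
  then show "P (mon c w + p)" using assms(1) by (auto simp: filt_def intro: assms(3))
qed (rule assms(2))

lemma filt_mult:
  assumes "p \<in> filt \<delta> i" "q \<in> filt \<delta> j"
  shows "p * q \<in> filt \<delta> (i + j)"
  using assms(1)
proof (induction p rule: filt_induct)
  case (add c w p)
  from assms(2) have "mon c w * q \<in> filt \<delta> (i + j)"
  proof (induction q rule: filt_induct)
    case (add d v q)
    then show ?case using \<open>i \<le> wt \<delta> w\<close>
      by (auto simp: distrib_left intro!: filt_add filt_mon add_mono)
  qed simp
  with add show ?case by (auto simp: distrib_right intro: filt_add)
qed simp

text \<open>The bound k is on a nominal weight, that of the word a x y b, and not on the weight of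
  the element. Since leading terms of different summands can cancel, an element of
  \<open>relspan\<close> at level 0 all of whose words have weight at least k is not obviously in
  level k; this gap is what the following locale closes.\<close>

inductive_set relspan :: "('a \<Rightarrow> 'a \<Rightarrow> bool) \<Rightarrow> ('a \<Rightarrow> nat) \<Rightarrow> ('a \<Rightarrow> 'a \<Rightarrow> 'a falg) \<Rightarrow> nat \<Rightarrow> 'a falg set"
  for adj \<delta> \<rho> k where
  zero: "0 \<in> relspan adj \<delta> \<rho> k"
| step: "adj x y \<Longrightarrow> k \<le> wt \<delta> (a @ x # y # b) \<Longrightarrow> v \<in> relspan adj \<delta> \<rho> k
    \<Longrightarrow> mon c a * \<rho> x y * word b + v \<in> relspan adj \<delta> \<rho> k"

lemma relspan_add:
  "p \<in> relspan adj \<delta> \<rho> k \<Longrightarrow> q \<in> relspan adj \<delta> \<rho> k \<Longrightarrow> p + q \<in> relspan adj \<delta> \<rho> k"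
proof (induction rule: relspan.induct)
  case (step x y a b v c)
  then show ?case
    using relspan.step[of adj x y k \<delta> a b "v + q"] by (simp add: add.assoc)
qed simp

lemma relspan_gen:
  "adj x y \<Longrightarrow> k \<le> wt \<delta> (a @ x # y # b) \<Longrightarrow> mon c a * \<rho> x y * mon d b \<in> relspan adj \<delta> \<rho> k"
proof -
  have "mon c a * \<rho> x y * mon d b = mon (c * d) a * \<rho> x y * word b"
  proof -
    have "mon d b = mon d [] * word b" by simp
    then have "mon c a * \<rho> x y * mon d b = mon c a * (\<rho> x y * mon d []) * word b"
      by (simp only: mult.assoc)
    also have "\<dots> = mon (c * d) a * \<rho> x y * word b"
      by (simp add: mon_Nil_commute[symmetric] mult.assoc)
    finally show ?thesis .
  qed
  then show "adj x y \<Longrightarrow> k \<le> wt \<delta> (a @ x # y # b) \<Longrightarrow> ?thesis"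
    using relspan.step[OF _ _ relspan.zero, where c = "c * d" and \<rho> = \<rho>] by fastforce
qed

lemma relspan_mono: "p \<in> relspan adj \<delta> \<rho> k \<Longrightarrow> l \<le> k \<Longrightarrow> p \<in> relspan adj \<delta> \<rho> l"
  by (induction rule: relspan.induct) (auto intro: relspan.intros)

lemma relspan_mon_mult_left:
  "p \<in> relspan adj \<delta> \<rho> k \<Longrightarrow> mon d w * p \<in> relspan adj \<delta> \<rho> (wt \<delta> w + k)"
proof (induction rule: relspan.induct)
  case (step x y a b v c)
  then show ?case
    using relspan.step[of adj x y "wt \<delta> w + k" \<delta> "w @ a" b "mon d w * v" \<rho> "d * c"]
    by (simp add: distrib_left mult.assoc)
qed (simp add: relspan.zero)

lemma relspan_mon_mult_right:
  "p \<in> relspan adj \<delta> \<rho> k \<Longrightarrow> p * mon d w \<in> relspan adj \<delta> \<rho> (k + wt \<delta> w)"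
proof (induction rule: relspan.induct)
  case (step x y a b v c)
  have "mon c a * \<rho> x y * mon d (b @ w) \<in> relspan adj \<delta> \<rho> (k + wt \<delta> w)"
    by (rule relspan_gen) (use step in auto)
  then show ?case
    using step.IH relspan_add by (auto simp: distrib_right mult.assoc)
qed (simp add: relspan.zero)

lemma relspan_uminus: "p \<in> relspan adj \<delta> \<rho> k \<Longrightarrow> - p \<in> relspan adj \<delta> \<rho> k"
proof -
  assume p: "p \<in> relspan adj \<delta> \<rho> k"
  have "mon (-1) [] * p = - p"
    by (simp add: mon_uminus[symmetric] word_Nil)
  with relspan_mon_mult_left[OF p, of "-1" "[]"] show ?thesis by simp
qed

lemma relspan_diff:
  "p \<in> relspan adj \<delta> \<rho> k \<Longrightarrow> q \<in> relspan adj \<delta> \<rho> k \<Longrightarrow> p - q \<in> relspan adj \<delta> \<rho> k"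
  using relspan_add[OF _ relspan_uminus, of p adj \<delta> \<rho> k q] by simp

lemma relspan_mult_left:
  assumes "q \<in> filt \<delta> i" "p \<in> relspan adj \<delta> \<rho> k" "l \<le> i + k"
  shows "q * p \<in> relspan adj \<delta> \<rho> l"
  using assms(1)
proof (induction q rule: filt_induct)
  case (add c w r)
  have "mon c w * p \<in> relspan adj \<delta> \<rho> l"
    by (rule relspan_mono[OF relspan_mon_mult_left[OF assms(2)]]) (use add assms(3) in auto)
  with add show ?case by (auto simp: distrib_right intro: relspan_add)
qed (simp add: relspan.zero)

lemma relspan_mult_right:
  assumes "p \<in> relspan adj \<delta> \<rho> k" "q \<in> filt \<delta> i" "l \<le> k + i"
  shows "p * q \<in> relspan adj \<delta> \<rho> l"
  using assms(2)
proof (induction q rule: filt_induct)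
  case (add c w r)
  have "p * mon c w \<in> relspan adj \<delta> \<rho> l"
    by (rule relspan_mono[OF relspan_mon_mult_right[OF assms(1)]]) (use add assms(3) in auto)
  with add show ?case by (auto simp: distrib_left intro: relspan_add)
qed (simp add: relspan.zero)

definition comm :: "'a::ring_1 \<Rightarrow> 'a \<Rightarrow> 'a" where
  "comm x y = x * y - y * x"

text \<open>With each relation replaced by its leading commutator, the sum in \<open>hexagon\<close>
  is 0 by Jacobi's identity. The assumption is that this gain of weight is visible on the relations
  themselves: strictness for the smallest cycle that is not a square, through the six orderings of
  x, y, z.\<close>

locale deformed_commutators =
  fixes adj :: "'x \<Rightarrow> 'x \<Rightarrow> bool" and \<delta> :: "'x \<Rightarrow> nat" and \<rho> :: "'x \<Rightarrow> 'x \<Rightarrow> 'x falg"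
  assumes adj_sym: "adj x y \<Longrightarrow> adj y x"
    and adj_irrefl: "\<not> adj x x"
    and rho_antisym: "adj x y \<Longrightarrow> \<rho> y x = - \<rho> x y"
    and rho_lead: "adj x y \<Longrightarrow> \<rho> x y - comm (gen x) (gen y) \<in> filt \<delta> (\<delta> x + \<delta> y + 1)"
    and hexagon: "adj x y \<Longrightarrow> adj y z \<Longrightarrow> adj x z \<Longrightarrow>
      comm (\<rho> x y) (gen z) + comm (\<rho> y z) (gen x) + comm (\<rho> z x) (gen y)
        \<in> relspan adj \<delta> \<rho> (\<delta> x + \<delta> y + \<delta> z + 1)"
begin

abbreviation E :: "nat \<Rightarrow> 'x falg set" where
  "E k \<equiv> relspan adj \<delta> \<rho> k"

lemma rho_filt: "adj x y \<Longrightarrow> \<rho> x y \<in> filt \<delta> (\<delta> x + \<delta> y)"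
proof -
  assume "adj x y"
  then have "\<rho> x y - comm (gen x) (gen y) \<in> filt \<delta> (\<delta> x + \<delta> y)"
    by (rule filt_mono[OF rho_lead]) simp
  moreover have "comm (gen x) (gen y) \<in> filt \<delta> (\<delta> x + \<delta> y)"
    by (simp add: comm_def filt_diff filt_mon)
  ultimately show ?thesis using filt_add by fastforce
qed

lemma rho_rel: "adj x y \<Longrightarrow> k \<le> \<delta> x + \<delta> y \<Longrightarrow> \<rho> x y \<in> E k"
  using relspan_gen[of adj x y k \<delta> "[]" "[]" 1 \<rho> 1] by (simp add: word_Nil)

text \<open>The combination of relations that rewrites u m to m u modulo terms of higher weight.\<close>
fun shift :: "'x \<Rightarrow> 'x list \<Rightarrow> 'x falg" where
  "shift m [] = 0"
| "shift m (x # u) = gen x * shift m u + \<rho> x m * word u"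

lemma shift_append: "shift m (u @ v) = shift m u * word v + word u * shift m v"
  by (induction u) (simp_all add: word_Nil algebra_simps)

lemma shift_rel: "\<forall>x\<in>set u. adj x m \<Longrightarrow> shift m u \<in> E (\<delta> m + wt \<delta> u)"
proof (induction u)
  case (Cons x u)
  have "gen x * shift m u \<in> E (\<delta> m + wt \<delta> (x # u))"
    by (rule relspan_mult_left[OF _ Cons.IH, of _ "\<delta> x"]) (use Cons.prems in \<open>auto simp: filt_mon\<close>)
  moreover have "\<rho> x m * word u \<in> E (\<delta> m + wt \<delta> (x # u))"
    by (rule relspan_mult_right[OF rho_rel[OF _ order_refl], of _ _ _ "wt \<delta> u"])
      (use Cons.prems in \<open>auto simp: filt_mon\<close>)
  ultimately show ?case by (simp add: relspan_add)
qed (simp add: relspan.zero)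

lemma shift_lead:
  "\<forall>x\<in>set u. adj x m \<Longrightarrow> shift m u - comm (word u) (gen m) \<in> filt \<delta> (\<delta> m + wt \<delta> u + 1)"
proof (induction u)
  case (Cons x u)
  have "gen x * (shift m u - comm (word u) (gen m)) \<in> filt \<delta> (\<delta> x + (\<delta> m + wt \<delta> u + 1))"
    by (rule filt_mult) (use Cons in \<open>auto simp: filt_mon\<close>)
  moreover have "(\<rho> x m - comm (gen x) (gen m)) * word u \<in> filt \<delta> (\<delta> x + \<delta> m + 1 + wt \<delta> u)"
    by (rule filt_mult[OF rho_lead filt_mon[OF order_refl]]) (use Cons.prems in auto)
  moreover have "shift m (x # u) - comm (word (x # u)) (gen m)
      = gen x * (shift m u - comm (word u) (gen m)) + (\<rho> x m - comm (gen x) (gen m)) * word u"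
    by (simp add: comm_def algebra_simps)
  ultimately show ?case by (simp add: filt_add ac_simps)
qed (simp add: comm_def word_Nil)

section \<open>Letters that commute to the front of a word\<close>

definition before :: "'x \<Rightarrow> 'x list \<Rightarrow> 'x list" where
  "before m w = takeWhile (\<lambda>z. z \<noteq> m) w"

definition after :: "'x \<Rightarrow> 'x list \<Rightarrow> 'x list" where
  "after m w = tl (dropWhile (\<lambda>z. z \<noteq> m) w)"

lemma before_after: "m \<notin> set u \<Longrightarrow> before m (u @ m # v) = u" "m \<notin> set u \<Longrightarrow> after m (u @ m # v) = v"
  by (induction u) (auto simp: before_def after_def)

text \<open>Only the first occurrence of m counts: \<open>adj\<close> is irreflexive, so a later
  copy can never pass it.\<close>

definition front :: "'x list \<Rightarrow> 'x set" where
  "front w = {m \<in> set w. \<forall>x\<in>set (before m w). adj x m}"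

definition first :: "'x list \<Rightarrow> 'x" where
  "first w = (SOME m. m \<in> front w)"

lemma front_iff: "m \<in> front w \<longleftrightarrow> (\<exists>u v. w = u @ m # v \<and> m \<notin> set u \<and> (\<forall>x\<in>set u. adj x m))"
proof
  assume "m \<in> front w"
  then have "m \<in> set w" and *: "\<forall>x\<in>set (before m w). adj x m" by (auto simp: front_def)
  then obtain u v where "w = u @ m # v" "m \<notin> set u" by (meson split_list_first)
  with * show "\<exists>u v. w = u @ m # v \<and> m \<notin> set u \<and> (\<forall>x\<in>set u. adj x m)" by (auto simp: before_after)
qed (auto simp: front_def before_after)

lemma first_front: "w \<noteq> [] \<Longrightarrow> first w \<in> front w"
proof -
  assume "w \<noteq> []"
  then have "hd w \<in> front w" by (cases w) (auto simp: front_iff intro: exI[of _ "[]"])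
  then show ?thesis unfolding first_def by (rule someI)
qed

text \<open>A swap alters the set of letters before the first m only if that m is one of the two
  swapped letters, and the letter that then comes before it commutes with it by adjacency.\<close>

lemma front_swap_imp: "adj x y \<Longrightarrow> m \<in> front (a @ x # y # b) \<Longrightarrow> m \<in> front (a @ y # x # b)"
proof -
  assume xy: "adj x y" and "m \<in> front (a @ x # y # b)"
  then obtain u v where uv: "a @ x # y # b = u @ m # v" "m \<notin> set u" "\<forall>x\<in>set u. adj x m"
    by (auto simp: front_iff)
  have ne: "x \<noteq> y" using xy adj_irrefl by auto
  show ?thesis
  proof (cases "m \<in> set a")
    case True
    then obtain u' v' where a: "a = u' @ m # v'" "m \<notin> set u'" by (meson split_list_first)
    then have "u = u'" using uv(1,2) before_after(1)[of m u v] before_after(1)[of m u' "v' @ x # y # b"] by simp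
    with a uv show ?thesis
      by (intro front_iff[THEN iffD2] exI[of _ u'] exI[of _ "v' @ y # x # b"]) auto
  next
    case m: False
    consider "m = x" | "m \<noteq> x" "m = y" | "m \<noteq> x" "m \<noteq> y" by blast
    then show ?thesis
    proof cases
      case 1
      then have "u = a" using uv(1,2) m before_after(1)[of m u v] before_after(1)[of m a "y # b"] by simp
      with 1 uv m ne xy adj_sym show ?thesis
        by (intro front_iff[THEN iffD2] exI[of _ "a @ [y]"] exI[of _ b]) auto
    next
      case 2
      then have "u = a @ [x]"
        using uv(1,2) m before_after(1)[of m u v] before_after(1)[of m "a @ [x]" b] by simp
      with 2 uv m show ?thesis
        by (intro front_iff[THEN iffD2] exI[of _ a] exI[of _ "x # b"]) auto
    next
      case 3
      have "m \<in> set (a @ x # y # b)" using uv(1) by simp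
      with m 3 have "m \<in> set b" by simp
      then obtain u' v' where b: "b = u' @ m # v'" "m \<notin> set u'" by (meson split_list_first)
      then have "u = a @ x # y # u'"
        using 3 m uv(1,2) before_after(1)[of m u v] before_after(1)[of m "a @ x # y # u'" v'] by simp
      with b uv m 3 show ?thesis
        by (intro front_iff[THEN iffD2] exI[of _ "a @ y # x # u'"] exI[of _ v']) auto
    qed
  qed
qed

lemma first_swap: "adj x y \<Longrightarrow> first (a @ x # y # b) = first (a @ y # x # b)"
  using front_swap_imp[of x y] front_swap_imp[of y x] adj_sym[of x y]
  unfolding first_def by meson

lemma length_before_after: "m \<in> set w \<Longrightarrow> Suc (length (before m w @ after m w)) = length w"
  by (metis before_after add_Suc_right length_Cons length_append split_list_first)

text \<open>The set of front letters is invariant under commutations, so the choice of the first letter is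
canonical. The potential accumulates the relations used on the way to a normal form of w.\<close>
function potential :: "'x list \<Rightarrow> 'x falg" where
  "potential w = (if w = [] then 0 else
     let m = first w in shift m (before m w) * word (after m w)
       + gen m * potential (before m w @ after m w))"
  by auto
termination
proof (relation "measure length")
  fix w :: "'x list" and m
  assume "w \<noteq> []" "m = first w"
  then have "m \<in> set w" using first_front[of w] by (simp add: front_def)
  then show "(before m w @ after m w, w) \<in> measure length"
    using length_before_after[of m w] by simp
qed simp

declare potential.simps [simp del]

lemma potential_first:
  assumes "first (u @ m # v) = m" "m \<notin> set u"
  shows "potential (u @ m # v) = shift m u * word v + gen m * potential (u @ v)"
  using assms by (simp add: potential.simps[of "u @ m # v"] before_after Let_def)

text \<open>The same letter m is extracted from both words. If its first occurrence is to the left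
  of the swap, the swap and the extraction act at disjoint places and commute up to heavier terms.
  If m is one of the swapped letters, the swap is itself part of one of the two extractions. If m
  comes from the right, it has to cross x and y in either order, and the triangle x, y, m is closed
  by \<open>hexagon\<close>. In the outer cases the induction hypothesis treats the words without
  m.\<close>

lemma potential_swap:
  assumes "adj x y"
  shows "potential (a @ x # y # b) - potential (a @ y # x # b) - word a * \<rho> x y * word b
    \<in> E (wt \<delta> (a @ x # y # b) + 1)"
proof (induction "length a + length b" arbitrary: a b rule: less_induct)
  case less
  let ?d = "wt \<delta> (a @ x # y # b) + 1"
  define m where "m = first (a @ x # y # b)"
  have m0: "first (a @ x # y # b) = m" unfolding m_def ..
  have m': "first (a @ y # x # b) = m" using first_swap[OF assms] m_def by simp
  have ne: "x \<noteq> y" using assms adj_irrefl by auto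
  have "m \<in> front (a @ x # y # b)" unfolding m_def by (rule first_front) simp
  then obtain u v where uv: "a @ x # y # b = u @ m # v" "m \<notin> set u" "\<forall>x\<in>set u. adj x m"
    by (auto simp: front_iff)
  have yx: "\<rho> y x = - \<rho> x y" using rho_antisym[OF assms] .
  show ?case
  proof (cases "m \<in> set a")
    case True
    then obtain u' v' where a: "a = u' @ m # v'" "m \<notin> set u'" by (meson split_list_first)
    then have "u = u'"
      using uv(1,2) before_after(1)[of m u v] before_after(1)[of m u' "v' @ x # y # b"] by simp
    with a have a: "a = u @ m # v'" by simp
    let ?I = "potential ((u @ v') @ x # y # b) - potential ((u @ v') @ y # x # b)
      - word (u @ v') * \<rho> x y * word b"
    have 1: "?I \<in> E (wt \<delta> ((u @ v') @ x # y # b) + 1)"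
      by (rule less) (simp add: a)
    have 2: "gen m * ?I \<in> E ?d"
      by (rule relspan_mult_left[OF filt_mon[OF order_refl] 1]) (simp add: a)
    \<comment> \<open>Facts 3 and 4 compare two relations applied at disjoint places: exchanging
      which of the two is replaced by its leading commutator costs only a relation times a tail,
      which is heavier.\<close>
    have 3: "shift m u * (word v' * (\<rho> x y - comm (gen x) (gen y)) * word b) \<in> E ?d"
      by (rule relspan_mult_right[OF shift_rel[OF uv(3)]
            filt_mult[OF filt_mult[OF filt_mon[OF order_refl] rho_lead[OF assms]] filt_mon[OF order_refl]]])
        (simp add: a)
    have R: "word v' * \<rho> x y * word b \<in> E (wt \<delta> (v' @ x # y # b))"
      by (rule relspan_gen[of adj x y _ \<delta> _ _ _ \<rho>, OF assms]) simp
    have 4: "(shift m u - comm (word u) (gen m)) * (word v' * \<rho> x y * word b) \<in> E ?d"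
      by (rule relspan_mult_left[OF shift_lead[OF uv(3)] R]) (simp add: a)
    have w: "potential (a @ x # y # b) = shift m u * word (v' @ x # y # b)
        + gen m * potential (u @ v' @ x # y # b)"
      using potential_first[of u m "v' @ x # y # b"] m0 uv(2) by (simp add: a)
    have w': "potential (a @ y # x # b) = shift m u * word (v' @ y # x # b)
        + gen m * potential (u @ v' @ y # x # b)"
      using potential_first[of u m "v' @ y # x # b"] m' uv(2) by (simp add: a)
    have e1: "word (v' @ x # y # b) - word (v' @ y # x # b) = word v' * comm (gen x) (gen y) * word b"
      by (simp add: comm_def algebra_simps)
    have "potential (a @ x # y # b) - potential (a @ y # x # b) - word a * \<rho> x y * word b
        = shift m u * (word (v' @ x # y # b) - word (v' @ y # x # b)) + gen m * ?I
         + gen m * (word u * word v' * \<rho> x y * word b) - word u * gen m * word v' * \<rho> x y * word b"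
      unfolding w w' by (simp add: a algebra_simps)
    also have "\<dots> = gen m * ?I - shift m u * (word v' * (\<rho> x y - comm (gen x) (gen y)) * word b)
       + (shift m u - comm (word u) (gen m)) * (word v' * \<rho> x y * word b)"
      unfolding e1 comm_def[of "word u"] by (simp only: algebra_simps)
    finally show ?thesis using 2 3 4 by (auto intro: relspan_add relspan_diff)
  next
    case m: False
    consider "m = x" | "m \<noteq> x" "m = y" | "m \<noteq> x" "m \<noteq> y" by blast
    then show ?thesis
    proof cases
      case 1
      \<comment> \<open>No error term arises here: extracting x from the second word crosses y last,
        and that contributes exactly the relation of the swap, up to sign.\<close>
      have w: "potential (a @ x # y # b) = shift x a * word (y # b) + gen x * potential (a @ y # b)"
        using potential_first[of a x "y # b"] m0 m 1 by simp
      have w': "potential (a @ y # x # b) = shift x (a @ [y]) * word b + gen x * potential (a @ y # b)"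
        using potential_first[of "a @ [y]" x b] m' m 1 ne by simp
      have "shift x a * word (y # b) = shift x a * gen y * word b" by (simp add: mult.assoc)
      then have "potential (a @ x # y # b) - potential (a @ y # x # b) - word a * \<rho> x y * word b = 0"
        unfolding w w' shift_append by (simp add: yx word_Nil algebra_simps del: mon_mult_assoc)
      then show ?thesis by (simp add: relspan.zero)
    next
      case 2
      have w: "potential (a @ y # x # b) = shift y a * word (x # b) + gen y * potential (a @ x # b)"
        using potential_first[of a y "x # b"] m' m 2 by simp
      have w': "potential (a @ x # y # b) = shift y (a @ [x]) * word b + gen y * potential (a @ x # b)"
        using potential_first[of "a @ [x]" y b] m0 m 2 ne by simp
      have "shift y a * word (x # b) = shift y a * gen x * word b" by (simp add: mult.assoc)
      then have "potential (a @ x # y # b) - potential (a @ y # x # b) - word a * \<rho> x y * word b = 0"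
        unfolding w w' shift_append by (simp add: word_Nil algebra_simps del: mon_mult_assoc)
      then show ?thesis by (simp add: relspan.zero)
    next
      case 3
      have "m \<in> set (a @ x # y # b)" using uv(1) by simp
      with m 3 have "m \<in> set b" by simp
      then obtain b1 b2 where b: "b = b1 @ m # b2" "m \<notin> set b1" by (meson split_list_first)
      then have u: "u = a @ x # y # b1"
        using 3 m uv(1,2) before_after(1)[of m u v] before_after(1)[of m "a @ x # y # b1" b2] by simp
      have adjm: "\<forall>z\<in>set a. adj z m" "adj x m" "adj y m" "\<forall>z\<in>set b1. adj z m"
        using uv(3) u by auto
      let ?I = "potential (a @ x # y # (b1 @ b2)) - potential (a @ y # x # (b1 @ b2))
        - word a * \<rho> x y * word (b1 @ b2)"
      have 1: "?I \<in> E (wt \<delta> (a @ x # y # (b1 @ b2)) + 1)"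
        by (rule less) (simp add: b)
      have 2: "gen m * ?I \<in> E ?d"
        by (rule relspan_mult_left[OF filt_mon[OF order_refl] 1]) (simp add: b)
      \<comment> \<open>Crossing x y and crossing y x with m uses the relations of m with x and with
        y in two contexts each, and the swap is performed to the right or to the left of m; the
        mismatch is exactly \<open>?H\<close>.\<close>
      let ?H = "comm (\<rho> x y) (gen m) + comm (\<rho> y m) (gen x) + comm (\<rho> m x) (gen y)"
      have H: "?H \<in> E (\<delta> x + \<delta> y + \<delta> m + 1)"
        by (rule hexagon) (use adjm assms in auto)
      have 3: "word a * ?H * word (b1 @ b2) \<in> E ?d"
        by (rule relspan_mult_right[OF relspan_mult_left[OF filt_mon[OF order_refl] H order_refl]
              filt_mon[OF order_refl]]) (simp add: b)
      have 4: "shift m a * ((\<rho> x y - comm (gen x) (gen y)) * word (b1 @ b2)) \<in> E ?d"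
        by (rule relspan_mult_right[OF shift_rel[OF adjm(1)]
              filt_mult[OF rho_lead[OF assms] filt_mon[OF order_refl]]]) (simp add: b)
      have 5: "(shift m a - comm (word a) (gen m)) * (\<rho> x y * word (b1 @ b2)) \<in> E ?d"
        by (rule relspan_mult_left[OF shift_lead[OF adjm(1)]
              relspan_mult_right[OF rho_rel[OF assms order_refl] filt_mon[OF order_refl] order_refl]])
          (simp add: b)
      have 6: "word a * (\<rho> x y - comm (gen x) (gen y)) * (shift m b1 * word b2) \<in> E ?d"
        by (rule relspan_mult_left[OF filt_mult[OF filt_mon[OF order_refl] rho_lead[OF assms]]
              relspan_mult_right[OF shift_rel[OF adjm(4)] filt_mon[OF order_refl] order_refl]])
          (simp add: b)
      have 7: "word a * \<rho> x y * ((shift m b1 - comm (word b1) (gen m)) * word b2) \<in> E ?d"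
        by (rule relspan_mult_right[OF relspan_mult_left[OF filt_mon[OF order_refl]
                rho_rel[OF assms order_refl] order_refl]
              filt_mult[OF shift_lead[OF adjm(4)] filt_mon[OF order_refl]]])
          (simp add: b)
      have w: "potential (a @ x # y # b) = shift m (a @ x # y # b1) * word b2
          + gen m * potential (a @ x # y # (b1 @ b2))"
        using potential_first[of "a @ x # y # b1" m b2] m0 m 3 uv(2) u by (simp add: b)
      have w': "potential (a @ y # x # b) = shift m (a @ y # x # b1) * word b2
          + gen m * potential (a @ y # x # (b1 @ b2))"
        using potential_first[of "a @ y # x # b1" m b2] m' m 3 uv(2) u by (simp add: b)
      have b12: "word (b1 @ b2) = word b1 * word b2" by simp
      have mx: "comm (\<rho> m x) (gen y) = gen y * \<rho> x m - \<rho> x m * gen y"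
        using rho_antisym[OF adjm(2)] by (simp add: comm_def)
      have s: "shift m (a @ [x] @ [y] @ b1) = shift m a * gen x * gen y * word b1
          + word a * (gen x * \<rho> y m + \<rho> x m * gen y) * word b1 + word a * gen x * gen y * shift m b1" for x y
        unfolding shift_append by (simp add: word_Nil algebra_simps)
      have "potential (a @ x # y # b) - potential (a @ y # x # b) - word a * \<rho> x y * word b
        = gen m * ?I + (shift m (a @ [x] @ [y] @ b1) - shift m (a @ [y] @ [x] @ b1)) * word b2
          + gen m * word a * \<rho> x y * (word b1 * word b2) - word a * \<rho> x y * (word b1 * gen m * word b2)"
        unfolding w w' by (simp add: b algebra_simps)
      also have "\<dots> = gen m * ?I - word a * ?H * word (b1 @ b2)
          - shift m a * ((\<rho> x y - comm (gen x) (gen y)) * word (b1 @ b2))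
          + (shift m a - comm (word a) (gen m)) * (\<rho> x y * word (b1 @ b2))
          - word a * (\<rho> x y - comm (gen x) (gen y)) * (shift m b1 * word b2)
          + word a * \<rho> x y * ((shift m b1 - comm (word b1) (gen m)) * word b2)"
        unfolding s mx unfolding comm_def b12 by (simp only: algebra_simps)
      finally have eq: "potential (a @ x # y # b) - potential (a @ y # x # b) - word a * \<rho> x y * word b = \<dots>" .
      show ?thesis unfolding eq by (intro relspan_add relspan_diff 2 3 4 5 6 7)
    qed
  qed
qed

text \<open>Let f be the linear extension of \<open>potential\<close> from the words of weight
  exactly k. On a multiple of a relation of nominal weight k it sees only the two leading words and
  returns the multiple itself, modulo \<open>E (k + 1)\<close>; on anything heavier it is 0. So p
  agrees with f p modulo \<open>E (k + 1)\<close>, and f p = 0 because p has no word of weight k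
  left.\<close>

lemma relspan_filt_step:
  assumes "p \<in> E k" "p \<in> filt \<delta> (k + 1)"
  shows "p \<in> E (k + 1)"
proof -
  define f where "f = alin (\<lambda>w. if wt \<delta> w = k then potential w else 0)"
  have f0: "f q = 0" if "q \<in> filt \<delta> (k + 1)" for q
    using that by (induction q rule: filt_induct) (auto simp: f_def alin_add)
  have "p - f p \<in> E (k + 1)"
    using assms(1)
  proof (induction rule: relspan.induct)
    case (step x y a b v c)
    let ?p = "mon c a * \<rho> x y * word b"
    have "?p - f ?p \<in> E (k + 1)"
    proof (cases "wt \<delta> (a @ x # y # b) = k")
      case True
      let ?q = "mon c a * (\<rho> x y - comm (gen x) (gen y)) * word b"
      have "?q \<in> filt \<delta> (k + 1)"
        by (rule filt_mono[OF filt_mult[OF filt_mult[OF filt_mon[OF order_refl] rho_lead[OF step(1)]]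
                filt_mon[OF order_refl]]]) (use True in simp)
      then have q: "f ?q = 0" by (rule f0)
      have xy: "f (mon c (a @ x # y # b)) = mon c [] * potential (a @ x # y # b)"
        and yx: "f (mon c (a @ y # x # b)) = mon c [] * potential (a @ y # x # b)"
        using True by (simp_all add: f_def ac_simps)
      have "?p = ?q + mon c (a @ x # y # b) - mon c (a @ y # x # b)"
        by (simp add: comm_def algebra_simps)
      then have "f ?p = f ?q + f (mon c (a @ x # y # b)) - f (mon c (a @ y # x # b))"
        unfolding f_def alin_add [symmetric] alin_diff [symmetric] by (rule arg_cong)
      then have "f ?p = mon c [] * (potential (a @ x # y # b) - potential (a @ y # x # b))"
        unfolding q xy yx right_diff_distrib[of "mon c []"] by simp
      then have "?p - f ?p = - (mon c [] * (potential (a @ x # y # b) - potential (a @ y # x # b)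
          - word a * \<rho> x y * word b))"
        by (simp add: algebra_simps)
      then show ?thesis
        using relspan_uminus[OF relspan_mon_mult_left[OF potential_swap[OF step(1), of a b], of c "[]"]] True
        by simp
    next
      case False
      then have k: "k + 1 \<le> wt \<delta> (a @ x # y # b)" using step by simp
      have "?p \<in> filt \<delta> (k + 1)"
        by (rule filt_mono[OF filt_mult[OF filt_mult[OF filt_mon[OF order_refl] rho_filt[OF step(1)]]
                filt_mon[OF order_refl]]]) (use k in simp)
      then have "f ?p = 0" by (rule f0)
      moreover have "?p \<in> E (k + 1)" by (rule relspan_gen[of adj x y _ \<delta> _ _ _ \<rho>, OF step(1) k])
      ultimately show ?thesis by simp
    qed
    moreover have "?p + v - f (?p + v) = (?p - f ?p) + (v - f v)"
      by (simp add: f_def alin_add)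
    ultimately show ?case using step.IH relspan_add by metis
  qed (simp add: f_def relspan.zero)
  then show ?thesis using f0[OF assms(2)] by simp
qed

text \<open>Strictness, by raising the level one unit at a time. \<open>E 0\<close> is the whole
  two-sided ideal generated by the relations, so for its elements the true weight can be taken as
  nominal weight.\<close>

theorem relspan_filt:
  assumes "p \<in> E 0" "p \<in> filt \<delta> k"
  shows "p \<in> E k"
  using assms
proof (induction k)
  case (Suc k)
  then have "p \<in> E k" using filt_mono[of p \<delta> "Suc k" k] by simp
  then show ?case using relspan_filt_step[of p k] Suc by simp
qed simp

end

section \<open>Rational spans and linear forms\<close>

lemma qspan_base: "x \<in> S \<Longrightarrow> x \<in> qspan S"
  using qspan_add[OF _ qspan_zero, of x S 1] by simp

lemma qspan_plus: "u \<in> qspan S \<Longrightarrow> v \<in> qspan S \<Longrightarrow> (\<lambda>z. u z + v z) \<in> qspan S"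
proof (induction rule: qspan.induct)
  case (qspan_add x w c)
  then show ?case using qspan.qspan_add[of x S "\<lambda>z. w z + v z" c] by (simp add: add.assoc)
qed simp

lemma qspan_scale: "u \<in> qspan S \<Longrightarrow> (\<lambda>z. c * u z) \<in> qspan S"
proof (induction rule: qspan.induct)
  case (qspan_add x w d)
  then show ?case using qspan.qspan_add[of x S "\<lambda>z. c * w z" "c * d"] by (simp add: algebra_simps)
qed (simp add: qspan_zero)

lemma qspan_sum:
  assumes "\<And>i. i \<in> A \<Longrightarrow> f i \<in> qspan S"
  shows "(\<lambda>z. \<Sum>i\<in>A. c i * f i z) \<in> qspan S"
  using assms
proof (induction A rule: infinite_finite_induct)
  case (insert i A)
  then show ?case using qspan_plus[OF qspan_scale[of "f i" S "c i"]] by simp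
qed (simp_all add: qspan_zero)

lemma qspan_subset: "S \<subseteq> qspan T \<Longrightarrow> qspan S \<subseteq> qspan T"
proof
  fix u assume "S \<subseteq> qspan T" "u \<in> qspan S"
  from this(2,1) show "u \<in> qspan T"
    by (induction rule: qspan.induct) (auto intro: qspan_zero qspan_plus[OF qspan_scale])
qed

lemma qspan_mono: "S \<subseteq> T \<Longrightarrow> qspan S \<subseteq> qspan T"
  using qspan_subset qspan_base by blast

lemma fsupp_comb: "fsupp (\<lambda>z. c * u z + v z) \<subseteq> fsupp u \<union> fsupp v"
  by (auto simp: fsupp_def)

lemma fsupp_basis [simp]: "fsupp (basis_vec t) = {t}"
  by (auto simp: fsupp_def basis_vec_def)

lemma basis_vec_same [simp]: "basis_vec t t = 1"
  by (simp add: basis_vec_def)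

lemma fsupp_zero [simp]: "fsupp (\<lambda>_. 0) = {}"
  by (simp add: fsupp_def)

lemma finite_fsupp_comb:
  "finite (fsupp u) \<Longrightarrow> finite (fsupp v) \<Longrightarrow> finite (fsupp (\<lambda>z. c * u z + v z))"
  by (rule finite_subset[OF fsupp_comb]) simp

lemma finite_fsupp_qspan:
  assumes "\<And>s. s \<in> S \<Longrightarrow> finite (fsupp s)" "u \<in> qspan S"
  shows "finite (fsupp u)"
  using assms(2) by (induction rule: qspan.induct) (simp_all add: assms(1) finite_fsupp_comb)

definition flin :: "('x \<Rightarrow> rat) \<Rightarrow> ('x \<Rightarrow> rat) \<Rightarrow> rat" where
  "flin g \<phi> = (\<Sum>t\<in>fsupp \<phi>. \<phi> t * g t)"

lemma flin_superset: "finite A \<Longrightarrow> fsupp \<phi> \<subseteq> A \<Longrightarrow> flin g \<phi> = (\<Sum>t\<in>A. \<phi> t * g t)"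
  unfolding flin_def by (rule sum.mono_neutral_left) (auto simp: fsupp_def)

lemma flin_comb:
  assumes "finite (fsupp u)" "finite (fsupp v)"
  shows "flin g (\<lambda>z. c * u z + v z) = c * flin g u + flin g v"
proof -
  have fin: "finite (fsupp u \<union> fsupp v)" using assms by simp
  show ?thesis
    using flin_superset[OF fin fsupp_comb, of g c] flin_superset[OF fin, of u g] flin_superset[OF fin, of v g]
    by (simp add: sum.distrib sum_distrib_left algebra_simps)
qed

lemma flin_basis [simp]: "flin g (basis_vec t) = g t"
  by (simp add: flin_def)

lemma flin_zero [simp]: "flin g (\<lambda>_. 0) = 0"
  by (simp add: flin_def)

lemma flin_diff:
  assumes "finite (fsupp u)" "finite (fsupp v)"
  shows "flin g (\<lambda>z. u z - v z) = flin g u - flin g v"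
  using flin_comb[OF assms(2,1), of g "-1"] by simp

lemma flin_qspan:
  assumes "\<And>s. s \<in> S \<Longrightarrow> finite (fsupp s)"
    and "\<And>s. s \<in> S \<Longrightarrow> (\<lambda>z. flin (\<lambda>t. g t z) s) \<in> qspan T"
    and "u \<in> qspan S"
  shows "(\<lambda>z. flin (\<lambda>t. g t z) u) \<in> qspan T"
  using assms(3)
proof (induction rule: qspan.induct)
  case (qspan_add x v c)
  have "flin f (\<lambda>z. c * x z + v z) = c * flin f x + flin f v" for f
    by (rule flin_comb) (use qspan_add assms(1) finite_fsupp_qspan[of S v] in auto)
  with qspan_add assms(2) show ?case
    using qspan_plus[OF qspan_scale] by fastforce
qed (simp add: qspan_zero)

section \<open>Group rings\<close>

lemma augmentation_flin: "augmentation f = flin (\<lambda>_. 1) f"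
  by (simp add: augmentation_def flin_def)

lemma mult_map_flin: "mult_map G \<phi> z = flin (\<lambda>t. gprod G t z) \<phi>"
  by (simp add: mult_map_def flin_def)

lemma mult_map_basis: "mult_map G (basis_vec t) = gprod G t"
  by (simp add: fun_eq_iff mult_map_flin)

lemma grp_ring_comb:
  "f \<in> grp_ring G \<Longrightarrow> h \<in> grp_ring G \<Longrightarrow> (\<lambda>z. c * f z + h z) \<in> grp_ring G"
  using fsupp_comb[of c f h] by (auto simp: grp_ring_def finite_fsupp_comb)

lemma grp_ring_zero: "(\<lambda>_. 0) \<in> grp_ring G"
  by (simp add: grp_ring_def)

lemma grp_ring_basis: "x \<in> carrier G \<Longrightarrow> basis_vec x \<in> grp_ring G"
  by (simp add: grp_ring_def)

lemma basis_expand: "finite A \<Longrightarrow> fsupp f \<subseteq> A \<Longrightarrow> f = (\<lambda>z. \<Sum>x\<in>A. f x * basis_vec x z)"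
  by (rule ext) (auto simp: basis_vec_def fsupp_def if_distrib cong: if_cong)

lemma grp_ring_qspan: "grp_ring G = qspan (basis_vec ` carrier G)"
proof
  show "grp_ring G \<subseteq> qspan (basis_vec ` carrier G)"
  proof
    fix f assume "f \<in> grp_ring G"
    then have fin: "finite (fsupp f)" "fsupp f \<subseteq> carrier G" by (auto simp: grp_ring_def)
    then have "(\<lambda>z. \<Sum>x\<in>fsupp f. f x * basis_vec x z) \<in> qspan (basis_vec ` carrier G)"
      by (intro qspan_sum qspan_base) auto
    then show "f \<in> qspan (basis_vec ` carrier G)"
      by (rule ssubst[OF basis_expand[OF fin(1) order_refl]])
  qed
  show "qspan (basis_vec ` carrier G) \<subseteq> grp_ring G"
  proof
    fix f assume "f \<in> qspan (basis_vec ` carrier G)"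
    then show "f \<in> grp_ring G"
      by (induction rule: qspan.induct) (auto intro: grp_ring_zero grp_ring_comb grp_ring_basis)
  qed
qed

lemma grp_ring_induct [consumes 1, case_names zero comb]:
  assumes "f \<in> grp_ring G" "P (\<lambda>_. 0)"
    and "\<And>c x v. x \<in> carrier G \<Longrightarrow> v \<in> grp_ring G \<Longrightarrow> P v \<Longrightarrow> P (\<lambda>z. c * basis_vec x z + v z)"
  shows "P f"
proof -
  from assms(1) have "f \<in> qspan (basis_vec ` carrier G)" by (simp add: grp_ring_qspan)
  then show ?thesis
    by (induction rule: qspan.induct) (auto intro: assms simp: grp_ring_qspan)
qed

text \<open>Summation over a fixed rectangle, instead of an index set that varies with the supports,
  makes bilinearity a matter of rearranging finite sums.\<close>

lemma conv_superset:
  assumes "finite A" "fsupp f \<subseteq> A" "A \<subseteq> carrier G" "finite B" "fsupp h \<subseteq> B" "B \<subseteq> carrier G"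
  shows "conv G f h z = (\<Sum>x\<in>A. \<Sum>y\<in>B. f x * h y * basis_vec (x \<otimes>\<^bsub>G\<^esub> y) z)"
proof -
  let ?S = "{(x, y). x \<in> carrier G \<and> y \<in> carrier G \<and> f x \<noteq> 0 \<and> h y \<noteq> 0 \<and> x \<otimes>\<^bsub>G\<^esub> y = z}"
  have sub: "?S \<subseteq> A \<times> B" using assms by (auto simp: fsupp_def)
  have "conv G f h z = (\<Sum>(x, y)\<in>?S. f x * h y * basis_vec (x \<otimes>\<^bsub>G\<^esub> y) z)"
    unfolding conv_def by (rule sum.cong) (auto simp: basis_vec_def)
  also have "\<dots> = (\<Sum>(x, y)\<in>A \<times> B. f x * h y * basis_vec (x \<otimes>\<^bsub>G\<^esub> y) z)"
    by (rule sum.mono_neutral_left[OF _ sub]) (use assms in \<open>auto simp: basis_vec_def split: if_splits\<close>)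
  finally show ?thesis by (simp add: sum.cartesian_product)
qed

lemma conv_comb_left:
  assumes "f \<in> grp_ring G" "f' \<in> grp_ring G" "h \<in> grp_ring G"
  shows "conv G (\<lambda>z. c * f z + f' z) h = (\<lambda>z. c * conv G f h z + conv G f' h z)"
proof
  fix z
  let ?A = "fsupp f \<union> fsupp f'" and ?B = "fsupp h"
  have A: "finite ?A" "?A \<subseteq> carrier G" and B: "finite ?B" "?B \<subseteq> carrier G"
    using assms by (auto simp: grp_ring_def)
  have "conv G k h z = (\<Sum>x\<in>?A. \<Sum>y\<in>?B. k x * h y * basis_vec (x \<otimes>\<^bsub>G\<^esub> y) z)"
    if "fsupp k \<subseteq> ?A" for k
    by (rule conv_superset) (use A B that in auto)
  from this[OF fsupp_comb, of c] this[of f] this[of f']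
  show "conv G (\<lambda>z. c * f z + f' z) h z = c * conv G f h z + conv G f' h z"
    by (simp add: sum_distrib_left sum.distrib[symmetric] algebra_simps)
qed

lemma conv_comb_right:
  assumes "f \<in> grp_ring G" "h \<in> grp_ring G" "h' \<in> grp_ring G"
  shows "conv G f (\<lambda>z. c * h z + h' z) = (\<lambda>z. c * conv G f h z + conv G f h' z)"
proof
  fix z
  let ?B = "fsupp h \<union> fsupp h'" and ?A = "fsupp f"
  have A: "finite ?A" "?A \<subseteq> carrier G" and B: "finite ?B" "?B \<subseteq> carrier G"
    using assms by (auto simp: grp_ring_def)
  have "conv G f k z = (\<Sum>x\<in>?A. \<Sum>y\<in>?B. f x * k y * basis_vec (x \<otimes>\<^bsub>G\<^esub> y) z)"
    if "fsupp k \<subseteq> ?B" for k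
    by (rule conv_superset) (use A B that in auto)
  from this[OF fsupp_comb, of c] this[of h] this[of h']
  show "conv G f (\<lambda>z. c * h z + h' z) z = c * conv G f h z + conv G f h' z"
    by (simp add: sum_distrib_left sum.distrib[symmetric] algebra_simps)
qed

lemma conv_zero [simp]: "conv G (\<lambda>_. 0) h = (\<lambda>_. 0)" "conv G f (\<lambda>_. 0) = (\<lambda>_. 0)"
  by (simp_all add: conv_def)

lemma conv_basis:
  "x \<in> carrier G \<Longrightarrow> y \<in> carrier G \<Longrightarrow> conv G (basis_vec x) (basis_vec y) = basis_vec (x \<otimes>\<^bsub>G\<^esub> y)"
  by (rule ext, subst conv_superset[of "{x}" _ _ "{y}"]) auto

definition words_in :: "'a set \<Rightarrow> nat \<Rightarrow> 'a falg set" where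
  "words_in X m = {p. \<forall>w. coeff p w \<noteq> 0 \<longrightarrow> length w = m \<and> set w \<subseteq> X}"

lemma words_in_add: "p \<in> words_in X m \<Longrightarrow> q \<in> words_in X m \<Longrightarrow> p + q \<in> words_in X m"
  unfolding words_in_def by (simp add: lookup_add) (metis add.right_neutral)

lemma words_in_scale: "p \<in> words_in X m \<Longrightarrow> mon c [] * p \<in> words_in X m"
proof -
  assume p: "p \<in> words_in X m"
  show ?thesis
  proof (rule falg_induct[of "\<lambda>r. mon c [] * r \<in> words_in X m" p])
    fix d w q assume "coeff p w = d" "d \<noteq> 0" and IH: "mon c [] * q \<in> words_in X m"
    then have "mon (c * d) w \<in> words_in X m" using p by (auto simp: words_in_def coeff_mon)
    with IH show "mon c [] * (mon d w + q) \<in> words_in X m" by (simp add: distrib_left words_in_add)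
  qed (simp add: words_in_def)
qed

context group
begin

lemma conv_closed: "f \<in> grp_ring G \<Longrightarrow> h \<in> grp_ring G \<Longrightarrow> conv G f h \<in> grp_ring G"
proof (induction f rule: grp_ring_induct)
  case (comb c x v)
  from comb(4) have "conv G (basis_vec x) h \<in> grp_ring G"
  proof (induction h rule: grp_ring_induct)
    case (comb d y w)
    then show ?case using \<open>x \<in> carrier G\<close>
      by (simp add: conv_comb_right conv_basis grp_ring_basis grp_ring_comb)
  qed (simp add: grp_ring_zero)
  with comb show ?case by (simp add: conv_comb_left grp_ring_basis grp_ring_comb)
qed (simp add: grp_ring_zero)

lemma conv_assoc:
  assumes "f \<in> grp_ring G" "h \<in> grp_ring G" "k \<in> grp_ring G"
  shows "conv G (conv G f h) k = conv G f (conv G h k)"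
  using assms(1)
proof (induction f rule: grp_ring_induct)
  case (comb c x v)
  have "conv G (conv G (basis_vec x) h) k = conv G (basis_vec x) (conv G h k)"
    using assms(2)
  proof (induction h rule: grp_ring_induct)
    case (comb d y w)
    have "conv G (conv G (basis_vec x) (basis_vec y)) k = conv G (basis_vec x) (conv G (basis_vec y) k)"
      using assms(3)
    proof (induction k rule: grp_ring_induct)
      case (comb e z u)
      then show ?case using \<open>x \<in> carrier G\<close> \<open>y \<in> carrier G\<close>
        by (simp add: conv_comb_right conv_basis grp_ring_basis conv_closed m_assoc)
    qed simp
    with comb show ?case using \<open>x \<in> carrier G\<close> assms(3)
      by (simp add: conv_comb_right conv_comb_left grp_ring_basis conv_closed)
  qed simp
  with comb show ?case using assms
    by (simp add: conv_comb_left grp_ring_basis conv_closed)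
qed simp

lemma conv_one:
  assumes "f \<in> grp_ring G"
  shows "conv G (basis_vec \<one>) f = f" "conv G f (basis_vec \<one>) = f"
  using assms
  by (induction f rule: grp_ring_induct)
    (simp_all add: conv_comb_left conv_comb_right conv_basis grp_ring_basis)

lemma gprod_closed: "set xs \<subseteq> grp_ring G \<Longrightarrow> gprod G xs \<in> grp_ring G"
  by (induction xs) (auto simp: grp_ring_basis conv_closed)

lemma gprod_append:
  "set xs \<subseteq> grp_ring G \<Longrightarrow> set ys \<subseteq> grp_ring G \<Longrightarrow> gprod G (xs @ ys) = conv G (gprod G xs) (gprod G ys)"
  by (induction xs) (auto simp: conv_one conv_assoc gprod_closed)

lemma gprod_single: "x \<in> grp_ring G \<Longrightarrow> gprod G [x] = x"
  by (simp add: conv_one)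

lemma gprod_mid:
  assumes "set a \<subseteq> grp_ring G" "set b \<subseteq> grp_ring G" "x \<in> grp_ring G"
  shows "gprod G (a @ [x] @ b) = conv G (gprod G a) (conv G x (gprod G b))"
  using gprod_append[OF assms(1), of "[x] @ b"] assms by simp

lemma gprod_comb:
  assumes "set a \<subseteq> grp_ring G" "set b \<subseteq> grp_ring G" "x \<in> grp_ring G" "y \<in> grp_ring G"
  shows "gprod G (a @ [\<lambda>z. c * x z + y z] @ b)
    = (\<lambda>z. c * gprod G (a @ [x] @ b) z + gprod G (a @ [y] @ b) z)"
  using assms
  by (simp only: gprod_mid grp_ring_comb conv_comb_left conv_comb_right gprod_closed conv_closed)

section \<open>Powers of the augmentation ideal\<close>

lemma aug_ideal_grp_ring: "f \<in> aug_ideal G \<Longrightarrow> f \<in> grp_ring G"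
  by (simp add: aug_ideal_def)

lemma augmentation_comb:
  "f \<in> grp_ring G \<Longrightarrow> h \<in> grp_ring G \<Longrightarrow>
    augmentation (\<lambda>z. c * f z + h z) = c * augmentation f + augmentation h"
  by (simp add: augmentation_flin flin_comb grp_ring_def)

lemma augmentation_basis: "augmentation (basis_vec x) = 1"
  by (simp add: augmentation_flin)

lemma augmentation_zero: "augmentation (\<lambda>_. 0) = 0"
  by (simp add: augmentation_flin)

lemma aug_ideal_comb: "f \<in> aug_ideal G \<Longrightarrow> h \<in> aug_ideal G \<Longrightarrow> (\<lambda>z. c * f z + h z) \<in> aug_ideal G"
  by (simp add: aug_ideal_def grp_ring_comb augmentation_comb)

lemma aug_ideal_zero: "(\<lambda>_. 0) \<in> aug_ideal G"
  by (simp add: aug_ideal_def grp_ring_zero augmentation_zero)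

lemma aug_ideal_qspan: "S \<subseteq> aug_ideal G \<Longrightarrow> qspan S \<subseteq> aug_ideal G"
proof
  fix u assume "S \<subseteq> aug_ideal G" "u \<in> qspan S"
  from this(2,1) show "u \<in> aug_ideal G"
    by (induction rule: qspan.induct) (auto intro: aug_ideal_zero aug_ideal_comb)
qed

lemma augmentation_conv:
  assumes "f \<in> grp_ring G" "h \<in> grp_ring G"
  shows "augmentation (conv G f h) = augmentation f * augmentation h"
  using assms(1)
proof (induction f rule: grp_ring_induct)
  case (comb c x v)
  have "augmentation (conv G (basis_vec x) h) = augmentation h"
    using assms(2)
  proof (induction h rule: grp_ring_induct)
    case (comb d y w)
    then show ?case using \<open>x \<in> carrier G\<close>
      by (simp add: conv_comb_right conv_basis grp_ring_basis augmentation_comb conv_closed augmentation_basis)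
  qed (simp add: augmentation_zero)
  with comb show ?case using assms(2)
    by (simp add: conv_comb_left grp_ring_basis augmentation_comb conv_closed augmentation_basis distrib_right)
qed (simp add: augmentation_zero)

lemma aug_ideal_conv: "f \<in> aug_ideal G \<Longrightarrow> h \<in> grp_ring G \<Longrightarrow> conv G f h \<in> aug_ideal G"
  by (simp add: aug_ideal_def conv_closed augmentation_conv)

lemma gprod_aug_ideal: "xs \<noteq> [] \<Longrightarrow> set xs \<subseteq> aug_ideal G \<Longrightarrow> gprod G xs \<in> aug_ideal G"
  by (cases xs) (auto intro!: aug_ideal_conv gprod_closed simp: aug_ideal_grp_ring subset_iff)

lemma aug_pow_gprod: "set xs \<subseteq> aug_ideal G \<Longrightarrow> length xs = m \<Longrightarrow> 0 < m \<Longrightarrow> gprod G xs \<in> aug_pow G m"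
  by (auto simp: aug_pow_def intro!: qspan_base)

lemma aug_pow_comb: "f \<in> aug_pow G m \<Longrightarrow> h \<in> aug_pow G m \<Longrightarrow> (\<lambda>z. c * f z + h z) \<in> aug_pow G m"
  by (auto simp: aug_pow_def intro: grp_ring_comb qspan_plus qspan_scale split: if_splits)

lemma aug_pow_zero: "(\<lambda>_. 0) \<in> aug_pow G m"
  by (auto simp: aug_pow_def grp_ring_zero qspan_zero)

lemma aug_pow_diff: "f \<in> aug_pow G m \<Longrightarrow> h \<in> aug_pow G m \<Longrightarrow> (\<lambda>z. f z - h z) \<in> aug_pow G m"
  using aug_pow_comb[of h m f "-1"] by simp

lemma aug_pow_qspan: "S \<subseteq> aug_pow G m \<Longrightarrow> qspan S \<subseteq> aug_pow G m"
proof
  fix u assume "S \<subseteq> aug_pow G m" "u \<in> qspan S"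
  from this(2,1) show "u \<in> aug_pow G m"
    by (induction rule: qspan.induct) (auto intro: aug_pow_zero aug_pow_comb)
qed

lemma aug_pow_aug_ideal: "0 < m \<Longrightarrow> aug_pow G m \<subseteq> aug_ideal G"
  by (simp add: aug_pow_def, rule aug_ideal_qspan) (auto intro: gprod_aug_ideal)

lemma aug_pow_1: "aug_pow G (Suc 0) = aug_ideal G"
proof
  show "aug_ideal G \<subseteq> aug_pow G (Suc 0)"
  proof
    fix f assume "f \<in> aug_ideal G"
    then show "f \<in> aug_pow G (Suc 0)"
      using aug_pow_gprod[of "[f]" "Suc 0"] gprod_single[of f] by (simp add: aug_ideal_grp_ring)
  qed
qed (simp add: aug_pow_aug_ideal)

text \<open>The tail of a longer product is a single element of the augmentation ideal.\<close>
lemma aug_pow_gprod_le: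
  assumes "set xs \<subseteq> aug_ideal G" "Suc m \<le> length xs"
  shows "gprod G xs \<in> aug_pow G (Suc m)"
proof -
  let ?a = "take m xs" and ?b = "drop m xs"
  have sub: "set ?a \<subseteq> aug_ideal G" "set ?b \<subseteq> aug_ideal G"
    using assms(1) set_take_subset set_drop_subset by fast+
  then have sub': "set ?a \<subseteq> grp_ring G" "set ?b \<subseteq> grp_ring G" by (auto simp: aug_ideal_grp_ring)
  have b: "gprod G ?b \<in> aug_ideal G" using gprod_aug_ideal[OF _ sub(2)] assms(2) by simp
  have "gprod G xs = gprod G (?a @ ?b)" by simp
  also have "\<dots> = conv G (gprod G ?a) (gprod G ?b)" by (rule gprod_append[OF sub'])
  also have "\<dots> = conv G (gprod G ?a) (gprod G [gprod G ?b])"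
    using gprod_single[of "gprod G ?b"] b by (simp add: aug_ideal_grp_ring)
  also have "\<dots> = gprod G (?a @ [gprod G ?b])"
    by (rule gprod_append[symmetric]) (use sub' b aug_ideal_grp_ring in auto)
  finally show ?thesis
    using aug_pow_gprod[of "?a @ [gprod G ?b]" "Suc m"] sub b assms(2) by simp
qed

text \<open>An entry from I^2 is a combination of products of two factors, so each summand of the
  whole product has one factor more than the tuple has entries.\<close>

lemma gprod_mid_aug_pow:
  assumes "set a \<subseteq> aug_ideal G" "set b \<subseteq> aug_ideal G" "x \<in> aug_pow G 2"
  shows "gprod G (a @ [x] @ b) \<in> aug_pow G (length a + 2 + length b)"
proof -
  have ab: "set a \<subseteq> grp_ring G" "set b \<subseteq> grp_ring G" using assms aug_ideal_grp_ring by auto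
  have z: "gprod G (a @ [\<lambda>_. 0] @ b) = (\<lambda>_. 0)"
    using gprod_mid[OF ab grp_ring_zero] by simp
  have "x \<in> qspan {gprod G xs | xs. length xs = 2 \<and> set xs \<subseteq> aug_ideal G}"
    using assms(3) by (simp add: aug_pow_def)
  then have "x \<in> grp_ring G \<and> gprod G (a @ [x] @ b) \<in> aug_pow G (length a + 2 + length b)"
  proof (induction rule: qspan.induct)
    case qspan_zero
    then show ?case by (simp only: z aug_pow_zero grp_ring_zero)
  next
    case (qspan_add y v c)
    then obtain xs where xs: "y = gprod G xs" "length xs = 2" "set xs \<subseteq> aug_ideal G" by blast
    then have xs': "set xs \<subseteq> grp_ring G" using aug_ideal_grp_ring by auto
    have y: "y \<in> grp_ring G" using gprod_closed[OF xs'] xs by simp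
    have "gprod G (a @ [y] @ b) = gprod G (a @ xs @ b)"
      using ab xs' y by (simp only: gprod_mid) (simp add: gprod_append xs(1))
    also have "\<dots> \<in> aug_pow G (length a + 2 + length b)"
      by (rule aug_pow_gprod) (use assms xs in auto)
    finally show ?case
      using qspan_add.IH y by (simp only: gprod_comb[OF ab] aug_pow_comb grp_ring_comb)
  qed
  then show ?thesis ..
qed

section \<open>Tensor powers\<close>

lemma tensor_rels_cases [consumes 1, case_names add scale sq]:
  assumes "r \<in> tensor_rels G m"
  obtains a b x y where "r = (\<lambda>s. basis_vec (a @ [(\<lambda>z. x z + y z)] @ b) s - basis_vec (a @ [x] @ b) s
      - basis_vec (a @ [y] @ b) s)" "a @ [x] @ b \<in> tuples G m" "y \<in> aug_ideal G"
  | a b x c where "r = (\<lambda>s. basis_vec (a @ [(\<lambda>z. c * x z)] @ b) s - c * basis_vec (a @ [x] @ b) s)"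
      "a @ [x] @ b \<in> tuples G m"
  | a b x where "r = basis_vec (a @ [x] @ b)" "a @ [x] @ b \<in> tuples G m" "x \<in> aug_pow G 2"
  using assms unfolding tensor_rels_def by blast

lemma tensor_rels_finite:
  assumes "r \<in> tensor_rels G m"
  shows "finite (fsupp r)"
  using assms
proof (cases rule: tensor_rels_cases)
  case (add a b x y)
  have "fsupp r \<subseteq> {a @ [(\<lambda>z. x z + y z)] @ b, a @ [x] @ b, a @ [y] @ b}"
    unfolding add(1) by (auto simp: fsupp_def basis_vec_def)
  then show ?thesis by (rule finite_subset) simp
next
  case (scale a b x c)
  have "fsupp r \<subseteq> {a @ [(\<lambda>z. c * x z)] @ b, a @ [x] @ b}"
    unfolding scale(1) by (auto simp: fsupp_def basis_vec_def)
  then show ?thesis by (rule finite_subset) simp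
qed simp

text \<open>Multilinearity relations multiply to 0, and a tuple with an entry in I^2 falls one power
  deeper. So multiplication descends from formal combinations to the tensor power of V with values
  modulo I^(m+1).\<close>

lemma tensor_rels_mult_map:
  assumes "r \<in> tensor_rels G m"
  shows "mult_map G r \<in> aug_pow G (Suc m)"
  using assms
proof (cases rule: tensor_rels_cases)
  case (add a b x y)
  then have ab: "set a \<subseteq> grp_ring G" "set b \<subseteq> grp_ring G" "x \<in> grp_ring G" "y \<in> grp_ring G"
    by (auto simp: tuples_def aug_ideal_grp_ring)
  have "mult_map G r z = gprod G (a @ [(\<lambda>z. x z + y z)] @ b) z - gprod G (a @ [x] @ b) z
      - gprod G (a @ [y] @ b) z" for z
  proof -
    let ?b = "\<lambda>t. basis_vec t :: ('a \<Rightarrow> rat) list \<Rightarrow> rat"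
    have "finite (fsupp (\<lambda>s. ?b u s - ?b v s))" for u v
      using finite_fsupp_comb[of "?b v" "?b u" "-1"] by simp
    then show ?thesis unfolding mult_map_flin add(1) by (simp only: flin_diff fsupp_basis finite.intros flin_basis)
  qed
  then have "mult_map G r = (\<lambda>_. 0)"
    using gprod_comb[OF ab, of 1] by (simp add: fun_eq_iff)
  then show ?thesis by (simp add: aug_pow_zero)
next
  case (scale a b x c)
  then have ab: "set a \<subseteq> grp_ring G" "set b \<subseteq> grp_ring G" "x \<in> grp_ring G"
    by (auto simp: tuples_def aug_ideal_grp_ring)
  let ?b = "\<lambda>t. basis_vec t :: ('a \<Rightarrow> rat) list \<Rightarrow> rat"
  have "r = (\<lambda>s. - c * ?b (a @ [x] @ b) s + ?b (a @ [(\<lambda>z. c * x z)] @ b) s)"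
    unfolding scale(1) by (rule ext) simp
  then have "mult_map G r z = - c * gprod G (a @ [x] @ b) z + gprod G (a @ [(\<lambda>z. c * x z)] @ b) z" for z
    unfolding mult_map_flin by (simp only: flin_comb fsupp_basis finite.intros flin_basis)
  moreover have "gprod G (a @ [\<lambda>_. 0] @ b) = (\<lambda>_. 0)"
    using gprod_mid[OF ab(1,2) grp_ring_zero] by simp
  ultimately have "mult_map G r = (\<lambda>_. 0)"
    using gprod_comb[OF ab grp_ring_zero, of c] by (simp add: fun_eq_iff)
  then show ?thesis by (simp add: aug_pow_zero)
next
  case (sq a b x)
  then have "mult_map G r = gprod G (a @ [x] @ b)" by (simp only: mult_map_basis)
  moreover have "set a \<subseteq> aug_ideal G" "set b \<subseteq> aug_ideal G" "length a + 2 + length b = Suc m"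
    using sq(2) by (auto simp: tuples_def)
  ultimately show ?thesis using gprod_mid_aug_pow[of a b x] sq(3) by simp
qed

section \<open>Noncommutative polynomials as tensors and as elements of the group ring\<close>

definition emb :: "('x \<Rightarrow> 'a \<Rightarrow> rat) \<Rightarrow> 'x falg \<Rightarrow> ('a \<Rightarrow> rat) list \<Rightarrow> rat" where
  "emb x p = (\<lambda>s. lin (\<lambda>w. basis_vec (map x w) s) p)"

definition ev :: "('x \<Rightarrow> 'a \<Rightarrow> rat) \<Rightarrow> 'x falg \<Rightarrow> 'a \<Rightarrow> rat" where
  "ev x p = (\<lambda>z. lin (\<lambda>w. gprod G (map x w) z) p)"

lemma emb_add: "emb x (p + q) = (\<lambda>s. emb x p s + emb x q s)"
  by (simp add: emb_def lin_add)

lemma emb_mon: "emb x (mon c w) = (\<lambda>s. c * basis_vec (map x w) s)"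
  by (simp add: emb_def)

lemma emb_zero [simp]: "emb x 0 = (\<lambda>_. 0)"
  by (simp add: emb_def)

lemma ev_add: "ev x (p + q) = (\<lambda>z. ev x p z + ev x q z)"
  by (simp add: ev_def lin_add)

lemma ev_diff: "ev x (p - q) = (\<lambda>z. ev x p z - ev x q z)"
  by (simp add: ev_def lin_diff)

lemma ev_mon: "ev x (mon c w) = (\<lambda>z. c * gprod G (map x w) z)"
  by (simp add: ev_def)

lemma ev_zero [simp]: "ev x 0 = (\<lambda>_. 0)"
  by (simp add: ev_def)

lemma ev_one: "ev x 1 = basis_vec \<one>"
  using ev_mon[of x 1 "[]"] by (simp add: word_Nil)

lemma finite_fsupp_emb: "finite (fsupp (emb x p))"
proof (induction p rule: falg_induct)
  case (add c w p)
  then show ?case by (simp add: emb_add emb_mon finite_fsupp_comb)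
qed simp

lemma mult_map_emb: "mult_map G (emb x p) = ev x p"
proof (induction p rule: falg_induct)
  case (add c w p)
  then show ?case
    by (simp add: emb_add emb_mon ev_add ev_mon mult_map_flin flin_comb finite_fsupp_emb fun_eq_iff)
qed (simp add: fun_eq_iff mult_map_flin)

context
  fixes x :: "'x \<Rightarrow> 'a \<Rightarrow> rat"
  assumes x: "range x \<subseteq> aug_ideal G"
begin

lemma map_x: "set (map x w) \<subseteq> aug_ideal G"
  using x by auto

lemma map_x_grp_ring: "set (map x w) \<subseteq> grp_ring G"
  using map_x aug_ideal_grp_ring by blast

lemma ev_closed: "ev x p \<in> grp_ring G"
proof (induction p rule: falg_induct)
  case (add c w p)
  then show ?case by (simp add: ev_add ev_mon grp_ring_comb gprod_closed[OF map_x_grp_ring])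
qed (simp add: grp_ring_zero)

lemma ev_mult: "ev x (p * q) = conv G (ev x p) (ev x q)"
proof (induction p rule: falg_induct)
  case (add c u p)
  note gc = gprod_closed[OF map_x_grp_ring]
  have "ev x (mon c u * q) = conv G (ev x (mon c u)) (ev x q)"
  proof (induction q rule: falg_induct)
    case (add d v q)
    have "conv G (ev x (mon c u)) (\<lambda>z. d * gprod G (map x v) z + ev x q z)
        = (\<lambda>z. d * conv G (ev x (mon c u)) (gprod G (map x v)) z + conv G (ev x (mon c u)) (ev x q) z)"
      by (rule conv_comb_right) (rule ev_closed gc)+
    moreover have "conv G (ev x (mon c u)) (gprod G (map x v)) = (\<lambda>z. c * gprod G (map x (u @ v)) z)"
      using conv_comb_left[OF gc grp_ring_zero gc, of c u v]
      by (simp add: ev_mon gprod_append[OF map_x_grp_ring map_x_grp_ring])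
    ultimately show ?case using add by (simp add: distrib_left ev_add ev_mon mult.assoc mult.left_commute)
  qed simp
  then show ?case
    using add conv_comb_left[OF ev_closed ev_closed ev_closed, of 1 "mon c u" p q]
    by (simp add: distrib_right ev_add)
qed simp

lemma ev_lfilt: "p \<in> filt (\<lambda>_. Suc 0) (Suc m) \<Longrightarrow> ev x p \<in> aug_pow G (Suc m)"
proof (induction p rule: filt_induct)
  case (add c w p)
  have "wt (\<lambda>_. Suc 0) w = length w" by (induction w) auto
  with add(1) have "gprod G (map x w) \<in> aug_pow G (Suc m)"
    by (intro aug_pow_gprod_le map_x) simp
  with add show ?case by (simp add: ev_add ev_mon aug_pow_comb)
qed (simp add: aug_pow_zero)

lemma emb_scale: "emb x (mon c [] * p) = (\<lambda>s. c * emb x p s)"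
  by (induction p rule: falg_induct) (simp_all add: distrib_left emb_add emb_mon mult.assoc)

definition representable :: "'x set \<Rightarrow> nat \<Rightarrow> (('a \<Rightarrow> rat) list \<Rightarrow> rat) set" where
  "representable X m = {\<phi>. \<exists>p \<in> words_in X m. (\<lambda>s. \<phi> s - emb x p s) \<in> tensor_rel_span G m}"

lemma representable_comb:
  assumes "\<phi> \<in> representable X m" "\<psi> \<in> representable X m"
  shows "(\<lambda>s. c * \<phi> s + \<psi> s) \<in> representable X m"
proof -
  obtain p q where p: "p \<in> words_in X m" "(\<lambda>s. \<phi> s - emb x p s) \<in> tensor_rel_span G m"
    and q: "q \<in> words_in X m" "(\<lambda>s. \<psi> s - emb x q s) \<in> tensor_rel_span G m"
    using assms by (auto simp: representable_def)
  have "(\<lambda>s. c * (\<phi> s - emb x p s) + (\<psi> s - emb x q s)) \<in> tensor_rel_span G m"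
    using p q unfolding tensor_rel_span_def by (intro qspan_plus qspan_scale)
  then have "(\<lambda>s. c * \<phi> s + \<psi> s - emb x (mon c [] * p + q) s) \<in> tensor_rel_span G m"
    by (simp add: emb_add emb_scale algebra_simps)
  then show ?thesis
    unfolding representable_def using words_in_add[OF words_in_scale[OF p(1)] q(1)] by blast
qed

lemma representable_rel: "\<phi> \<in> tensor_rel_span G m \<Longrightarrow> \<phi> \<in> representable X m"
proof -
  assume "\<phi> \<in> tensor_rel_span G m"
  moreover have "0 \<in> words_in X m" by (simp add: words_in_def)
  ultimately show ?thesis unfolding representable_def by (intro CollectI bexI[of _ 0]) simp_all
qed

text \<open>The entries are expanded from left to right: w lists those already replaced by
  generators, t those still to be expanded. A generator is moved from t to w, while an entry in I^2
  makes the whole tuple a tensor relation.\<close>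

lemma representable_tuple:
  assumes gens: "aug_ideal G \<subseteq> qspan (x ` X \<union> aug_pow G 2)"
    and "set w \<subseteq> X" "set t \<subseteq> aug_ideal G"
  shows "basis_vec (map x w @ t) \<in> representable X (length w + length t)"
  using assms(2,3)
proof (induction t arbitrary: w)
  case Nil
  have "word w \<in> words_in X (length w)" using Nil by (auto simp: words_in_def coeff_mon)
  moreover have "(\<lambda>s. basis_vec (map x w) s - emb x (word w) s) \<in> tensor_rel_span G (length w)"
    by (simp add: emb_mon tensor_rel_span_def qspan_zero)
  ultimately show ?case by (auto simp: representable_def)
next
  case (Cons f t)
  let ?m = "length w + Suc (length t)" and ?a = "map x w"
  let ?S = "x ` X \<union> aug_pow G 2"
  have S: "?S \<subseteq> aug_ideal G" using x aug_pow_aug_ideal[of 2] by auto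
  have tup: "?a @ [h] @ t \<in> tuples G ?m" if "h \<in> aug_ideal G" for h
    using map_x[of w] Cons.prems that by (auto simp: tuples_def)
  have scale: "(\<lambda>s. basis_vec (?a @ [\<lambda>z. c * h z] @ t) s - c * basis_vec (?a @ [h] @ t) s)
      \<in> tensor_rel_span G ?m" if "h \<in> aug_ideal G" for c h
    unfolding tensor_rel_span_def
    by (rule qspan_base) (use tup[OF that] in \<open>unfold tensor_rels_def, blast\<close>)
  have plus: "(\<lambda>s. basis_vec (?a @ [\<lambda>z. h z + k z] @ t) s - basis_vec (?a @ [h] @ t) s
      - basis_vec (?a @ [k] @ t) s) \<in> tensor_rel_span G ?m" if "h \<in> aug_ideal G" "k \<in> aug_ideal G" for h k
    unfolding tensor_rel_span_def
    by (rule qspan_base) (use tup[OF that(1)] that(2) in \<open>unfold tensor_rels_def, blast\<close>)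
  have "f \<in> qspan ?S" using gens Cons.prems by auto
  then have "basis_vec (?a @ [f] @ t) \<in> representable X ?m"
  proof (induction rule: qspan.induct)
    case qspan_zero
    \<comment> \<open>The scaling relation with c = 0 says that a tuple with entry 0 vanishes in the
      tensor power.\<close>
    have "(\<lambda>s. basis_vec (?a @ [\<lambda>z. 0 * (\<lambda>_. 0) z] @ t) s - 0 * basis_vec (?a @ [\<lambda>_. 0] @ t) s)
      \<in> tensor_rel_span G ?m" by (rule scale[OF aug_ideal_zero])
    then show ?case by (intro representable_rel) simp
  next
    case (qspan_add y v c)
    have y: "y \<in> aug_ideal G" using qspan_add(1) S by blast
    have v: "v \<in> aug_ideal G" using qspan_add(2) aug_ideal_qspan[OF S] by blast
    have cy: "(\<lambda>z. c * y z) \<in> aug_ideal G" using aug_ideal_comb[OF y aug_ideal_zero, of c] by simp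
    have "basis_vec (?a @ [y] @ t) \<in> representable X ?m"
    proof (cases "y \<in> x ` X")
      case True
      then obtain l where l: "y = x l" "l \<in> X" by auto
      then show ?thesis using Cons.IH[of "w @ [l]"] Cons.prems by simp
    next
      case False
      then have "y \<in> aug_pow G 2" using qspan_add(1) by simp
      with tup[OF y] have "basis_vec (?a @ [y] @ t) \<in> tensor_rels G ?m" unfolding tensor_rels_def by blast
      then show ?thesis by (intro representable_rel) (simp add: tensor_rel_span_def qspan_base)
    qed
    from representable_comb[OF this qspan_add.IH, of c]
    have 1: "(\<lambda>s. c * basis_vec (?a @ [y] @ t) s + basis_vec (?a @ [v] @ t) s) \<in> representable X ?m" .
    \<comment> \<open>The tuple with entry c y + v is reached by an additivity relation, a scaling
      relation for c y, and the combination already represented; the factors 1 only fit the shape of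
      \<open>representable_comb\<close>.\<close>
    have "(\<lambda>s. 1 * (basis_vec (?a @ [\<lambda>z. c * y z + v z] @ t) s - basis_vec (?a @ [\<lambda>z. c * y z] @ t) s
        - basis_vec (?a @ [v] @ t) s) + (1 * (basis_vec (?a @ [\<lambda>z. c * y z] @ t) s - c * basis_vec (?a @ [y] @ t) s)
        + (c * basis_vec (?a @ [y] @ t) s + basis_vec (?a @ [v] @ t) s))) \<in> representable X ?m"
      by (intro representable_comb 1 representable_rel plus scale y v cy)
    then show ?case by (simp add: fun_eq_iff cong: if_cong)
  qed
  then show ?case by simp
qed

lemma free_tuples_representable:
  assumes "aug_ideal G \<subseteq> qspan (x ` X \<union> aug_pow G 2)" "\<phi> \<in> free_tuples G m"
  shows "\<phi> \<in> representable X m"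
proof -
  from assms(2) have "\<phi> \<in> qspan (basis_vec ` tuples G m)" by (simp add: free_tuples_def)
  then show ?thesis
  proof (induction rule: qspan.induct)
    case qspan_zero
    then show ?case by (intro representable_rel) (simp add: tensor_rel_span_def qspan.qspan_zero)
  next
    case (qspan_add y v c)
    then obtain t where t: "y = basis_vec t" "t \<in> tuples G m" by auto
    then have "y \<in> representable X m"
      using representable_tuple[OF assms(1), of "[]" t] by (simp add: tuples_def)
    then show ?case using qspan_add.IH by (rule representable_comb)
  qed
qed

lemma finite_fsupp_free_tuples:
  assumes "\<phi> \<in> free_tuples G m"
  shows "finite (fsupp \<phi>)"
  by (rule finite_fsupp_qspan[of "basis_vec ` tuples G m"]) (use assms in \<open>auto simp: free_tuples_def\<close>)

lemma mult_map_tensor_rel_span: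
  assumes "\<phi> \<in> tensor_rel_span G m"
  shows "mult_map G \<phi> \<in> aug_pow G (Suc m)"
proof -
  have "(\<lambda>z. flin (\<lambda>t. gprod G t z) \<phi>) \<in> qspan (aug_pow G (Suc m))"
  proof (rule flin_qspan)
    show "(\<lambda>z. flin (\<lambda>t. gprod G t z) r) \<in> qspan (aug_pow G (Suc m))" if "r \<in> tensor_rels G m" for r
      using tensor_rels_mult_map[OF that] by (intro qspan_base) (simp add: mult_map_flin[abs_def])
  qed (use assms tensor_rels_finite in \<open>auto simp: tensor_rel_span_def\<close>)
  then show ?thesis
    using aug_pow_qspan[OF order_refl] by (auto simp: mult_map_flin[abs_def])
qed

text \<open>Homogeneity matters: \<open>insert_mid\<close> reads a window of exactly two entries, so
  only words of length 2 in q are placed correctly between a and b.\<close>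

lemma insert_mid_emb:
  assumes "q \<in> words_in UNIV 2"
  shows "emb x (word a * q * word b) = insert_mid (map x a) (map x b) (emb x q)"
proof (rule falg_induct)
  show "emb x (word a * 0 * word b) = insert_mid (map x a) (map x b) (emb x 0)"
    by (simp add: insert_mid_def fun_eq_iff)
next
  fix c w p
  assume w: "coeff q w = c" "c \<noteq> 0" and IH: "emb x (word a * p * word b) = insert_mid (map x a) (map x b) (emb x p)"
  have "length w = 2" using assms w by (auto simp: words_in_def)
  have "basis_vec (map x (a @ w @ b)) s = insert_mid (map x a) (map x b) (basis_vec (map x w)) s" for s
  proof (cases "s = map x (a @ w @ b)")
    case True
    then show ?thesis using \<open>length w = 2\<close> by (simp add: insert_mid_def)
  next
    case False
    have "take 2 (drop (length a) s) \<noteq> map x w"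
      if "take (length a) s = map x a" "drop (length a + 2) s = map x b"
    proof
      assume "take 2 (drop (length a) s) = map x w"
      with that have "s = map x a @ map x w @ map x b"
        by (metis append_take_drop_id drop_drop add.commute)
      with False show False by simp
    qed
    with False show ?thesis by (auto simp: insert_mid_def basis_vec_def)
  qed
  then have basis: "basis_vec (map x a @ map x w @ map x b) = insert_mid (map x a) (map x b) (basis_vec (map x w))"
    by (simp add: fun_eq_iff)
  show "emb x (word a * (mon c w + p) * word b) = insert_mid (map x a) (map x b) (emb x (mon c w + p))"
  proof
    fix s
    have "emb x (word a * (mon c w + p) * word b) s
        = c * insert_mid (map x a) (map x b) (basis_vec (map x w)) s + insert_mid (map x a) (map x b) (emb x p) s"
      unfolding basis[symmetric] IH[symmetric] by (simp add: distrib_left distrib_right emb_add emb_mon)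
    also have "\<dots> = insert_mid (map x a) (map x b) (emb x (mon c w + p)) s"
      by (simp add: insert_mid_def emb_add emb_mon)
    finally show "emb x (word a * (mon c w + p) * word b) s
        = insert_mid (map x a) (map x b) (emb x (mon c w + p)) s" .
  qed
qed

text \<open>Membership in the degree m part of the ideal generated by Q is expressed as membership in every
additive group P that contains its generators.\<close>
theorem quadratic_groupI:
  assumes gens: "aug_ideal G \<subseteq> qspan (x ` X \<union> aug_pow G 2)"
    and Q: "\<And>q. q \<in> Q \<Longrightarrow> q \<in> words_in UNIV 2 \<and> ev x q \<in> aug_pow G 3"
    and inj: "\<And>m p P. p \<in> words_in X m \<Longrightarrow> ev x p \<in> aug_pow G (Suc m) \<Longrightarrow> 0 \<in> P
      \<Longrightarrow> (\<And>p q. p \<in> P \<Longrightarrow> q \<in> P \<Longrightarrow> p + q \<in> P)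
      \<Longrightarrow> (\<And>a b c q. q \<in> Q \<Longrightarrow> length a + 2 + length b = m \<Longrightarrow> mon c a * q * word b \<in> P) \<Longrightarrow> p \<in> P"
  shows "quadratic_group G"
  unfolding quadratic_group_def
proof (intro conjI allI ballI impI)
  show "group G" by (rule group_axioms)
next
  fix m y assume y: "y \<in> aug_pow G m"
  show "\<exists>\<phi>\<in>free_tuples G m. (\<lambda>z. y z - mult_map G \<phi> z) \<in> aug_pow G (Suc m)"
  proof (cases "m = 0")
    case True
    then have "y \<in> grp_ring G" using y by (simp add: aug_pow_def)
    \<comment> \<open>In degree 0 the power is the whole group ring; modulo I an element is its
      augmentation times 1, the product of the empty tuple.\<close>
    let ?\<phi> = "\<lambda>s :: ('a \<Rightarrow> rat) list. augmentation y * basis_vec [] s"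
    have "?\<phi> \<in> free_tuples G m"
      unfolding free_tuples_def by (intro qspan_scale qspan_base) (simp add: tuples_def True)
    moreover have "mult_map G ?\<phi> = (\<lambda>z. augmentation y * basis_vec \<one> z)"
      using flin_comb[of "basis_vec []" "\<lambda>_ :: ('a \<Rightarrow> rat) list. 0" _ "augmentation y"]
      by (simp add: mult_map_flin fun_eq_iff)
    moreover have "(\<lambda>z. - augmentation y * basis_vec \<one> z + y z) \<in> aug_ideal G"
      using \<open>y \<in> grp_ring G\<close> augmentation_comb[of "basis_vec \<one>" y "- augmentation y"]
        grp_ring_comb[of "basis_vec \<one>" G y "- augmentation y"]
      by (simp add: aug_ideal_def grp_ring_basis augmentation_basis)
    ultimately show ?thesis
      by (intro bexI[of _ ?\<phi>]) (simp_all add: True aug_pow_1 algebra_simps)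
  next
    case False
    then have "y \<in> qspan {gprod G xs | xs. length xs = m \<and> set xs \<subseteq> aug_ideal G}"
      using y by (simp add: aug_pow_def)
    then have "\<exists>\<phi>\<in>free_tuples G m. mult_map G \<phi> = y"
    proof (induction rule: qspan.induct)
      case qspan_zero
      show ?case
        by (intro bexI[of _ "\<lambda>_. 0"]) (auto simp: mult_map_flin fun_eq_iff free_tuples_def qspan.qspan_zero)
    next
      case (qspan_add y v c)
      then obtain xs \<phi> where xs: "y = gprod G xs" "xs \<in> tuples G m"
        and \<phi>: "\<phi> \<in> free_tuples G m" "mult_map G \<phi> = v" by (auto simp: tuples_def)
      have "(\<lambda>s. c * basis_vec xs s + \<phi> s) \<in> free_tuples G m"
        using xs \<phi> unfolding free_tuples_def by (intro qspan.qspan_add) auto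
      moreover have "finite (fsupp \<phi>)" by (rule finite_fsupp_free_tuples[OF \<phi>(1)])
      then have "mult_map G (\<lambda>s. c * basis_vec xs s + \<phi> s) = (\<lambda>z. c * y z + v z)"
        using \<phi>(2) by (auto simp: fun_eq_iff mult_map_flin flin_comb xs(1))
      ultimately show ?case by blast
    qed
    then obtain \<phi> where "\<phi> \<in> free_tuples G m" "mult_map G \<phi> = y" by blast
    then show ?thesis by (intro bexI[of _ \<phi>]) (simp_all add: aug_pow_zero)
  qed
next
  fix m \<phi> assume \<phi>: "\<phi> \<in> free_tuples G m" "mult_map G \<phi> \<in> aug_pow G (Suc m)"
  let ?T = "qspan (tensor_rels G m \<union> quad_ideal_part G m)"
  obtain p where p: "p \<in> words_in X m" "(\<lambda>s. \<phi> s - emb x p s) \<in> tensor_rel_span G m"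
    using free_tuples_representable[OF gens \<phi>(1)] by (auto simp: representable_def)
  have fin: "finite (fsupp \<phi>)" by (rule finite_fsupp_free_tuples[OF \<phi>(1)])
  have "(\<lambda>z. mult_map G \<phi> z - ev x p z) \<in> aug_pow G (Suc m)"
    using mult_map_tensor_rel_span[OF p(2)]
    by (simp add: mult_map_flin[abs_def] flin_diff fin finite_fsupp_emb mult_map_emb[symmetric])
  from aug_pow_diff[OF \<phi>(2) this] have ev: "ev x p \<in> aug_pow G (Suc m)" by simp
  \<comment> \<open>The hypothesis is applied with P the additive group of all polynomials whose
    tensor lies in the span to be reached.\<close>
  have "p \<in> {p. emb x p \<in> ?T}"
  proof (rule inj[OF p(1) ev])
    fix a b :: "'x list" and c q
    assume q: "q \<in> Q" and len: "length a + 2 + length b = m"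
    have free: "emb x r \<in> free_tuples G 2" if "r \<in> words_in UNIV 2" for r
    proof (rule falg_induct)
      show "emb x 0 \<in> free_tuples G 2" by (simp add: free_tuples_def qspan_zero)
    next
      fix d w s assume w: "coeff r w = d" "d \<noteq> 0" and IH: "emb x s \<in> free_tuples G 2"
      have "map x w \<in> tuples G 2" using that w map_x[of w] by (auto simp: tuples_def words_in_def)
      with IH show "emb x (mon d w + s) \<in> free_tuples G 2"
        by (auto simp: free_tuples_def emb_add emb_mon intro: qspan_add)
    qed
    have "emb x q \<in> quad_rel_lifts G"
      using Q[OF q] free[of q] by (simp add: quad_rel_lifts_def mult_map_emb)
    then have "insert_mid (map x a) (map x b) (emb x q) \<in> quad_ideal_part G m"
      unfolding quad_ideal_part_def using len map_x[of a] map_x[of b]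
      by (intro CollectI exI[of _ "map x a"] exI[of _ "map x b"] exI[of _ "emb x q"]) simp
    then have "emb x (word a * q * word b) \<in> ?T"
      using insert_mid_emb[of q a b] Q[OF q] by (auto intro!: qspan_base)
    then have "(\<lambda>s. c * emb x (word a * q * word b) s) \<in> ?T" by (rule qspan_scale)
    then have "emb x (mon c [] * (word a * q * word b)) \<in> ?T" by (simp only: emb_scale)
    then show "mon c a * q * word b \<in> {p. emb x p \<in> ?T}" by (simp add: mult.assoc)
  qed (auto simp: emb_add qspan_zero intro: qspan_plus)
  then have "emb x p \<in> ?T" by simp
  moreover have "(\<lambda>s. \<phi> s - emb x p s) \<in> ?T"
    using p(2) qspan_mono[of "tensor_rels G m" "tensor_rels G m \<union> quad_ideal_part G m"]
    by (auto simp: tensor_rel_span_def)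
  ultimately have "(\<lambda>s. (\<phi> s - emb x p s) + emb x p s) \<in> ?T" using qspan_plus by blast
  then show "\<phi> \<in> ?T" by simp
qed

end

end

section \<open>The Yang-Baxter relations\<close>

type_synonym pair = "nat \<times> nat"

abbreviation g :: "nat \<Rightarrow> nat \<Rightarrow> pair falg" where
  "g i j \<equiv> gen (i, j)"

abbreviation R :: "nat \<Rightarrow> nat \<Rightarrow> pair falg" where
  "R i j \<equiv> 1 + g i j"

definition YB :: "nat \<Rightarrow> nat \<Rightarrow> nat \<Rightarrow> pair falg" where
  "YB i j k = R i j * R i k * R j k - R j k * R i k * R i j"

text \<open>Constant and linear terms cancel. The quadratic part is the left side of the classical
  Yang-Baxter equation.\<close>

lemma YB_expand:
  "YB i j k = comm (g i j) (g i k) + comm (g i j) (g j k) + comm (g i k) (g j k)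
     + (g i j * (g i k * g j k) - g j k * (g i k * g i j))"
  by (simp add: YB_def comm_def algebra_simps)

definition mx :: "pair \<Rightarrow> nat" where
  "mx x = (if fst x < snd x then snd x else fst x)"

definition verts :: "pair \<Rightarrow> nat set" where
  "verts x = {fst x, snd x}"

definition pairs :: "nat \<Rightarrow> pair set" where
  "pairs n = {(i, j). 1 \<le> i \<and> i \<le> n \<and> 1 \<le> j \<and> j \<le> n \<and> i \<noteq> j}"

text \<open>A clique is a forest on {1..n} in which every vertex b is the larger end of at most one letter:
of some (b, a) with a < b, or of (a, b) with a < b a root. So k! cliques span a given set of k vertices, one for each of its
linear orders; these also index a basis of the top part of the quadratic dual algebra.\<close>
definition adj :: "nat \<Rightarrow> pair \<Rightarrow> pair \<Rightarrow> bool" where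
  "adj n x y \<longleftrightarrow> x \<in> pairs n \<and> y \<in> pairs n \<and> mx x \<noteq> mx y
     \<and> (fst x < snd x \<longrightarrow> mx y \<noteq> fst x) \<and> (fst y < snd y \<longrightarrow> mx x \<noteq> fst y)"

text \<open>On three points a < b < c there are six edges (x, y) with \<open>mx x < mx y\<close> and
  six Yang-Baxter relations; this is the invertible change of basis that gives each edge a relation
  with leading term [x, y]. Two relations are added when y = (c, b), because each alone contains a
  lighter commutator, of x with (a, c) or with (c, a), and these cancel. For adjacent letters the
  last branch of either half is the case of disjoint letters.\<close>

fun rel_lt :: "pair \<Rightarrow> pair \<Rightarrow> pair falg" where
  "rel_lt (i, j) (k, l) =
    (if i < j then
       (if k = i then YB i j l else if l = j then YB i j k + YB i k j
        else if l = i then - YB k i j else comm (g i j) (g k l))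
     else
       (if k = j then YB i j l else if l = i then - (YB k i j + YB i k j)
        else if l = j then YB i k j else comm (g i j) (g k l)))"

definition rel :: "pair \<Rightarrow> pair \<Rightarrow> pair falg" where
  "rel x y = (if mx x < mx y then rel_lt x y else - rel_lt y x)"

text \<open>For a < b < c the weights of (a, b), (a, c), (b, c) increase, and (b, a) is lighter than (a, b).\<close>
definition dg :: "nat \<Rightarrow> nat \<Rightarrow> pair \<Rightarrow> nat" where
  "dg n D x = D + (if x \<in> pairs n then 2 * (fst x + snd x) + (if fst x < snd x then 1 else 0) else 0)"

lemma dg_ge: "D \<le> dg n D x"
  by (simp add: dg_def)

lemma dg_le: "dg n D x \<le> D + (4 * n + 1)"
  by (auto simp: dg_def pairs_def)

lemma adj_sym: "adj n x y \<Longrightarrow> adj n y x"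
  by (auto simp: adj_def)

lemma rel_antisym: "adj n x y \<Longrightarrow> rel y x = - rel x y"
  by (auto simp: adj_def rel_def)

lemma adj_disjoint:
  "x \<in> pairs n \<Longrightarrow> y \<in> pairs n \<Longrightarrow> verts x \<inter> verts y = {} \<Longrightarrow> adj n x y"
  by (auto simp: adj_def verts_def mx_def)

lemma rel_disjoint:
  "verts x \<inter> verts y = {} \<Longrightarrow> rel x y = comm (gen x) (gen y)"
  by (cases x; cases y) (auto simp: rel_def verts_def comm_def)

text \<open>Of the four letters that join c to a or b only (b, c) is missing: an ascending letter
  has to start at a root, and b is already the larger end of x.\<close>

lemma adj_lt_cases:
  assumes "adj n x y" "mx x < mx y"
  obtains "verts x \<inter> verts y = {}"
  | a b c where "1 \<le> a" "a < b" "b < c" "c \<le> n" "x \<in> {(a, b), (b, a)}" "y \<in> {(a, c), (c, a), (c, b)}"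
proof -
  obtain i j k l where xy: "x = (i, j)" "y = (k, l)" by (cases x; cases y) blast
  define a b c d where "a = min i j" and "b = max i j" and "c = max k l" and "d = min k l"
  have x: "x \<in> {(a, b), (b, a)}" and y: "y \<in> {(d, c), (c, d)}"
    using xy by (auto simp: a_def b_def c_def d_def)
  have ord: "1 \<le> a" "a < b" "b < c" "c \<le> n" "d < c"
    using assms xy by (auto simp: a_def b_def c_def d_def adj_def pairs_def mx_def split: if_splits)
  consider "d = a" | "d = b" | "d \<noteq> a" "d \<noteq> b" by blast
  then show thesis
  proof cases
    case 2
    then have "y \<noteq> (d, c)" using assms x ord by (auto simp: adj_def mx_def)
    then show ?thesis using that(2)[OF ord(1-4) x] y 2 by auto
  next
    case 3
    then show ?thesis using that(1) x y ord by (auto simp: verts_def)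
  qed (use that(2)[OF ord(1-4) x] y in auto)
qed

section \<open>Leading terms\<close>

text \<open>The filtration C is abstract since the estimate is used both for the weight filtration and for the
polynomials whose commutator with a distant letter is a relation.\<close>
lemma rel_lt_lead:
  fixes C :: "nat \<Rightarrow> pair falg set"
  assumes D: "8 * n + 2 < D" and xy: "adj n x y" "mx x < mx y"
    and zero: "\<And>k. 0 \<in> C k"
    and add: "\<And>k p q. p \<in> C k \<Longrightarrow> q \<in> C k \<Longrightarrow> p + q \<in> C k"
    and uminus: "\<And>k p. p \<in> C k \<Longrightarrow> - p \<in> C k"
    and mult: "\<And>i j p q. p \<in> C i \<Longrightarrow> q \<in> C j \<Longrightarrow> p * q \<in> C (i + j)"
    and mono: "\<And>i j p. p \<in> C j \<Longrightarrow> i \<le> j \<Longrightarrow> p \<in> C i"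
    and gens: "\<And>z. z \<in> pairs n \<Longrightarrow> verts z \<subseteq> verts x \<union> verts y \<Longrightarrow> gen z \<in> C (dg n D z)"
  shows "rel x y - comm (gen x) (gen y) \<in> C (dg n D x + dg n D y + 1)"
  using xy
proof (cases rule: adj_lt_cases)
  case 1
  then show ?thesis by (simp add: rel_disjoint zero)
next
  case (2 a b c)
  let ?k = "dg n D x + dg n D y + 1"
  have ac: "a < c" using 2 by simp
  note ord = 2(1-4) ac
  have diff: "p - q \<in> C k" if "p \<in> C k" "q \<in> C k" for p q k
    using add[OF that(1) uminus[OF that(2)]] by simp
  have verts: "verts x \<union> verts y = {a, b, c}" using 2 by (auto simp: verts_def)
  have gen: "g i j \<in> C (dg n D (i, j))" if "i \<in> {a, b, c}" "j \<in> {a, b, c}" "i \<noteq> j" for i j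
  proof (rule gens)
    show "(i, j) \<in> pairs n" using that ord by (auto simp: pairs_def)
    show "verts (i, j) \<subseteq> verts x \<union> verts y" unfolding verts using that by (auto simp: verts_def)
  qed
  have com: "comm (g i j) (g k l) \<in> C ?k"
    if "i \<in> {a, b, c}" "j \<in> {a, b, c}" "i \<noteq> j" "k \<in> {a, b, c}" "l \<in> {a, b, c}" "k \<noteq> l"
      "?k \<le> dg n D (i, j) + dg n D (k, l)" for i j k l
    unfolding comm_def using mult[OF gen gen, of i j k l] mult[OF gen gen, of k l i j] that
    by (auto intro!: diff elim!: mono)
  \<comment> \<open>Three letters weigh at least 3 D and two letters at most 2 D + 8 n + 2, which
    accounts for the lower bound on D.\<close>
  have cubic: "g i j * (g i k * g j k) - g j k * (g i k * g i j) \<in> C ?k"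
    if "i \<in> {a, b, c}" "j \<in> {a, b, c}" "k \<in> {a, b, c}" "distinct [i, j, k]" for i j k
  proof (intro diff)
    have "?k \<le> dg n D (i, j) + (dg n D (i, k) + dg n D (j, k))"
      "?k \<le> dg n D (j, k) + (dg n D (i, k) + dg n D (i, j))"
      using D dg_le[of n D x] dg_le[of n D y] dg_ge[of D n "(i, j)"] dg_ge[of D n "(i, k)"]
        dg_ge[of D n "(j, k)"] by linarith+
    then show "g i j * (g i k * g j k) \<in> C ?k" "g j k * (g i k * g i j) \<in> C ?k"
      using that by (intro mono[OF mult[OF gen mult[OF gen gen]]]; simp)+
  qed
  have "(x, y) \<in> {((a, b), (a, c)), ((a, b), (c, a)), ((a, b), (c, b)),
      ((b, a), (a, c)), ((b, a), (c, a)), ((b, a), (c, b))}" using 2(5,6) by auto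
  then consider "x = (a, b)" "y = (a, c)" | "x = (a, b)" "y = (c, a)" | "x = (a, b)" "y = (c, b)"
    | "x = (b, a)" "y = (a, c)" | "x = (b, a)" "y = (c, a)" | "x = (b, a)" "y = (c, b)" by blast
  then show ?thesis
  proof cases
    case 1
    have "rel x y - comm (gen x) (gen y) = comm (g a b) (g b c) + comm (g a c) (g b c)
        + (g a b * (g a c * g b c) - g b c * (g a c * g a b))"
      using ord by (simp add: 1 rel_def mx_def YB_expand)
    then show ?thesis
      by (simp only:) (intro add com cubic; use ord 1 in \<open>auto simp: dg_def pairs_def\<close>)
  next
    case 2
    have "rel x y - comm (gen x) (gen y) = - (comm (g c a) (g c b) + comm (g c b) (g a b)
        + (g c a * (g c b * g a b) - g a b * (g c b * g c a)))"
      using ord by (simp add: 2 rel_def mx_def YB_expand comm_def)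
    then show ?thesis
      by (simp only:) (intro add uminus com cubic; use ord 2 in \<open>auto simp: dg_def pairs_def\<close>)
  next
    case 3
    have "rel x y - comm (gen x) (gen y) = comm (g a b) (g b c) + comm (g a c) (g b c) + comm (g a c) (g c b)
        + (g a b * (g a c * g b c) - g b c * (g a c * g a b))
        + (g a c * (g a b * g c b) - g c b * (g a b * g a c))"
      using ord by (simp add: 3 rel_def mx_def YB_expand comm_def)
    then show ?thesis
      by (simp only:) (intro add com cubic; use ord 3 in \<open>auto simp: dg_def pairs_def\<close>)
  next
    case 4
    have "rel x y - comm (gen x) (gen y) = comm (g b a) (g b c) + comm (g b c) (g a c)
        + (g b a * (g b c * g a c) - g a c * (g b c * g b a))"
      using ord by (simp add: 4 rel_def mx_def YB_expand)
    then show ?thesis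
      by (simp only:) (intro add com cubic; use ord 4 in \<open>auto simp: dg_def pairs_def\<close>)
  next
    case 5
    have "rel x y - comm (gen x) (gen y) = comm (g b c) (g b a) + comm (g b c) (g c a)
        + (g b c * (g b a * g c a) - g c a * (g b a * g b c))"
      using ord by (simp add: 5 rel_def mx_def YB_expand)
    then show ?thesis
      by (simp only:) (intro add com cubic; use ord 5 in \<open>auto simp: dg_def pairs_def\<close>)
  next
    case 6
    have "rel x y - comm (gen x) (gen y) = - (comm (g c b) (g c a) + comm (g b c) (g b a) + comm (g b c) (g c a)
        + (g c b * (g c a * g b a) - g b a * (g c a * g c b))
        + (g b c * (g b a * g c a) - g c a * (g b a * g b c)))"
      using ord by (simp add: 6 rel_def mx_def YB_expand comm_def)
    then show ?thesis
      by (simp only:) (intro add uminus com cubic; use ord 6 in \<open>auto simp: dg_def pairs_def\<close>)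
  qed
qed

lemma rel_lead:
  assumes "8 * n + 2 < D" "adj n x y"
  shows "rel x y - comm (gen x) (gen y) \<in> filt (dg n D) (dg n D x + dg n D y + 1)"
proof -
  have lt: "rel x y - comm (gen x) (gen y) \<in> filt (dg n D) (dg n D x + dg n D y + 1)"
    if "adj n x y" "mx x < mx y" for x y
    by (rule rel_lt_lead[OF assms(1) that]) (auto intro: filt_add filt_uminus filt_mult filt_mono filt_mon)
  show ?thesis
  proof (cases "mx x < mx y")
    case False
    then have "mx y < mx x" using assms(2) by (auto simp: adj_def)
    from lt[OF adj_sym[OF assms(2)] this]
    have "- (rel y x - comm (gen y) (gen x)) \<in> filt (dg n D) (dg n D x + dg n D y + 1)"
      by (intro filt_uminus) (simp add: add.commute)
    then show ?thesis using rel_antisym[OF assms(2)] by (simp add: comm_def algebra_simps)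
  qed (use lt assms(2) in simp)
qed

section \<open>The Zamolodchikov identity\<close>

text \<open>Three letters weigh at most 3 D + 12 n + 3. With this bound on D that is less than 4 D,
  so everything in \<open>J (4 * D)\<close> is negligible in a hexagon identity.\<close>

locale yang_baxter =
  fixes n D :: nat
  assumes D: "12 * n + 3 < D"
begin

abbreviation J :: "nat \<Rightarrow> pair falg set" where
  "J k \<equiv> relspan (adj n) (dg n D) rel k"

lemma rel_in: "adj n x y \<Longrightarrow> k \<le> dg n D x + dg n D y \<Longrightarrow> rel x y \<in> J k"
  using relspan_gen[of "adj n" x y k "dg n D" "[]" "[]" 1 rel 1] by (simp add: word_Nil)

lemma gen_filt: "k \<le> dg n D x \<Longrightarrow> gen x \<in> filt (dg n D) k"
  by (simp add: filt_mon)

lemma comm_rel_in: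
  assumes "adj n x y" "k \<le> dg n D x + dg n D y + dg n D z"
  shows "comm (rel x y) (gen z) \<in> J k"
  unfolding comm_def
  by (intro relspan_diff relspan_mult_right[OF rel_in[OF assms(1) order_refl] gen_filt[OF order_refl]]
      relspan_mult_left[OF gen_filt[OF order_refl] rel_in[OF assms(1) order_refl]])
    (use assms(2) in auto)

text \<open>Inverts the change of basis in \<open>rel_lt\<close> for the six orders of three points.
  The nominal weight is rounded down to 2 D, which loses nothing later, because the tetrahedron
  identities are compared only with the level 4 D.\<close>

lemma YB_in:
  assumes "{i, j, k} \<subseteq> {1..n}" "distinct [i, j, k]"
  shows "YB i j k \<in> J (2 * D)"
proof -
  have rel: "rel x y \<in> J (2 * D)" if "adj n x y" for x y
    by (rule rel_in[OF that]) (simp add: dg_def)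
  have *: "YB a b c \<in> J (2 * D) \<and> YB b a c \<in> J (2 * D) \<and> YB a c b \<in> J (2 * D) \<and> YB c a b \<in> J (2 * D)
      \<and> YB b c a \<in> J (2 * D) \<and> YB c b a \<in> J (2 * D)" if "1 \<le> a" "a < b" "b < c" "c \<le> n" for a b c
  proof -
    have "adj n (a, b) (a, c)" "adj n (b, a) (a, c)" "adj n (a, b) (c, b)" "adj n (a, b) (c, a)"
      "adj n (b, a) (c, a)" "adj n (b, a) (c, b)"
      using that by (simp_all add: adj_def mx_def pairs_def)
    note r = this[THEN rel]
    have "YB a b c = rel (a, b) (a, c)" "YB b a c = rel (b, a) (a, c)"
      "YB a c b = rel (a, b) (c, b) - rel (a, b) (a, c)" "YB c a b = - rel (a, b) (c, a)"
      "YB b c a = rel (b, a) (c, a)" "YB c b a = - rel (b, a) (c, b) - rel (b, a) (c, a)"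
      using that by (simp_all add: rel_def mx_def)
    then show ?thesis using r by (simp only: relspan_diff relspan_uminus simp_thms)
  qed
  have "(i < j \<and> j < k) \<or> (j < i \<and> i < k) \<or> (i < k \<and> k < j) \<or> (j < k \<and> k < i) \<or> (k < i \<and> i < j)
      \<or> (k < j \<and> j < i)"
    using assms(2) by (simp; presburger)
  then show ?thesis
    using assms(1) *[of i j k] *[of j i k] *[of i k j] *[of j k i] *[of k i j] *[of k j i]
    by (elim disjE) simp_all
qed

lemma comm_disjoint_in:
  assumes "{i, j, k, l} \<subseteq> {1..n}" "distinct [i, j, k, l]"
  shows "comm (g i j) (g k l) \<in> J (2 * D)"
proof -
  have "verts (i, j) \<inter> verts (k, l) = {}" using assms(2) by (auto simp: verts_def)
  moreover have "(i, j) \<in> pairs n" "(k, l) \<in> pairs n" using assms by (auto simp: pairs_def)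
  ultimately show ?thesis
    using rel_in[OF adj_disjoint, of "(i, j)" "(k, l)" "2 * D"] by (simp add: rel_disjoint dg_def)
qed

section \<open>Products of the group generators to first order\<close>

definition Rs :: "pair list \<Rightarrow> pair falg" where
  "Rs xs = foldr (\<lambda>x p. (1 + gen x) * p) xs 1"

definition gs :: "pair list \<Rightarrow> pair falg" where
  "gs xs = foldr (\<lambda>x p. gen x + p) xs 0"

lemma Rs_simps: "Rs [] = 1" "Rs (x # xs) = (1 + gen x) * Rs xs"
  and gs_simps: "gs [] = 0" "gs (x # xs) = gen x + gs xs"
  by (simp_all add: Rs_def gs_def)

lemma Rs_expand: "Rs xs - 1 \<in> filt (dg n D) D \<and> Rs xs - 1 - gs xs \<in> filt (dg n D) (2 * D)"
proof (induction xs)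
  case (Cons x xs)
  have x: "gen x \<in> filt (dg n D) D" by (simp add: gen_filt dg_ge)
  have *: "gen x * (Rs xs - 1) \<in> filt (dg n D) (D + D)"
    by (rule filt_mult[OF x]) (use Cons in auto)
  have "gen x * (Rs xs - 1) + gen x + (Rs xs - 1) \<in> filt (dg n D) D"
    by (intro filt_add filt_mono[OF *] x) (use Cons in auto)
  moreover have "gen x * (Rs xs - 1) + (Rs xs - 1 - gs xs) \<in> filt (dg n D) (2 * D)"
    by (intro filt_add filt_mono[OF *]) (use Cons in auto)
  ultimately show ?case by (simp add: Rs_def gs_def algebra_simps)
qed (simp add: Rs_def gs_def)

text \<open>Each additional letter adds at least D to the nominal weight 2 D of p, so modulo 4 D
  only the terms with at most one letter from the outer factors survive.\<close>

lemma conj_rel: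
  assumes "p \<in> J (2 * D)"
  shows "Rs xs * p * Rs ys - (p + gs xs * p + p * gs ys) \<in> J (4 * D)"
proof -
  have "(Rs xs - 1 - gs xs) * p \<in> J (4 * D)"
    by (rule relspan_mult_left[OF conjunct2[OF Rs_expand] assms]) simp
  moreover have "p * (Rs ys - 1 - gs ys) \<in> J (4 * D)"
    by (rule relspan_mult_right[OF assms conjunct2[OF Rs_expand]]) simp
  moreover have "(Rs xs - 1) * (p * (Rs ys - 1)) \<in> J (4 * D)"
    by (rule relspan_mult_left[OF conjunct1[OF Rs_expand]
          relspan_mult_right[OF assms conjunct1[OF Rs_expand] order_refl]]) simp
  moreover have "Rs xs * p * Rs ys - (p + gs xs * p + p * gs ys)
      = (Rs xs - 1 - gs xs) * p + p * (Rs ys - 1 - gs ys) + (Rs xs - 1) * (p * (Rs ys - 1))"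
    by (simp add: algebra_simps)
  ultimately show ?thesis by (simp add: relspan_add)
qed

text \<open>Each of the four Yang-Baxter and three commutation relations occurs once on either of
  the two paths that reverse the product of six generators, with the remaining generators on
  opposite sides. The first-order terms therefore combine to its commutator with a signed sum of
  letters: plus for a generator to the right on the first path, minus for one to the left.\<close>

definition Zam :: "nat \<Rightarrow> nat \<Rightarrow> nat \<Rightarrow> nat \<Rightarrow> pair falg" where
  "Zam i j k l = comm (YB i j k) (g i l + g j l + g k l) + comm (YB i j l) (g k l - g i k - g j k)
     + comm (YB i k l) (g i j - g j k - g j l) + comm (YB j k l) (g i j + g i k + g i l)
     - comm (comm (g i j) (g k l)) (g i l + g i k + g j l + g j k)
     + comm (comm (g i k) (g j l)) (g i l + g k l + g i j - g j k)
     + comm (comm (g j k) (g i l)) (g i k + g i j - g j l - g k l)"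

text \<open>Two ways of reversing the product of all six generators on four strands; the leading terms of
the resulting syzygy between the relations form the commutators in Zam.\<close>
lemma Zam_in:
  assumes "{i, j, k, l} \<subseteq> {1..n}" "distinct [i, j, k, l]"
  shows "Zam i j k l \<in> J (4 * D)"
proof -
  define e where "e p xs ys = Rs xs * p * Rs ys - (p + gs xs * p + p * gs ys)" for p xs ys
  let ?ij = "(i, j)" and ?ik = "(i, k)" and ?il = "(i, l)" and ?jk = "(j, k)" and ?jl = "(j, l)" and ?kl = "(k, l)"
  let ?x = "comm (g i j) (g k l)" and ?y = "comm (g i k) (g j l)" and ?z = "comm (g j k) (g i l)"
  let ?S = "\<lambda>f. f (YB i j k) [] [?il, ?jl, ?kl] + f (YB i j l) [?jk, ?ik] [?kl] + f ?x [?jk, ?ik, ?jl, ?il] []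
      + f ?y [?jk] [?il, ?kl, ?ij] + f (YB i k l) [?jk, ?jl] [?ij] + f (YB j k l) [] [?il, ?ik, ?ij]
      + f ?z [?kl, ?jl] [?ik, ?ij] - f ?z [?ij, ?ik] [?jl, ?kl] - f (YB j k l) [?ij, ?ik, ?il] []
      - f (YB i k l) [?ij] [?jl, ?jk] - f ?x [] [?il, ?ik, ?jl, ?jk] - f ?y [?kl, ?ij, ?il] [?jk]
      - f (YB i j l) [?kl] [?ik, ?jk] - f (YB i j k) [?kl, ?jl, ?il] []"
  \<comment> \<open>The first seven summands of \<open>?S\<close> follow one path, the last seven
    the other, backwards. With full outer factors the sum telescopes to 0; in the truncated version
    the bare relations cancel in pairs and \<open>Zam\<close> remains.\<close>
  have eq: "?S e = - Zam i j k l"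
  proof -
    have c: "comm (g p q) (g r s) = R p q * R r s - R r s * R p q" for p q r s
      by (simp add: comm_def algebra_simps)
    \<comment> \<open>Makes the R opaque: the telescoping is an identity of words in six
      noncommuting symbols and would only be obscured by expanding 1 + g.\<close>
    define r where "r p q = R p q" for p q
    have "?S (\<lambda>p xs ys. Rs xs * p * Rs ys) = 0"
      unfolding YB_def c Rs_simps r_def[symmetric] mult_1_left mult_1_right
      by (simp only: algebra_simps) simp
    moreover have "?S (\<lambda>p xs ys. p + gs xs * p + p * gs ys) = Zam i j k l"
      unfolding Zam_def comm_def[of "YB _ _ _"] comm_def[of "comm _ _"] gs_simps
        add_0_right mult_zero_left mult_zero_right
      by (simp only: algebra_simps)
    moreover have "?S e = ?S (\<lambda>p xs ys. Rs xs * p * Rs ys) - ?S (\<lambda>p xs ys. p + gs xs * p + p * gs ys)"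
      unfolding e_def by (simp only: diff_conv_add_uminus minus_add_distrib minus_minus ac_simps)
    ultimately show ?thesis by simp
  qed
  have y: "YB p q r \<in> J (2 * D)" if "{p, q, r} \<subseteq> {i, j, k, l}" "distinct [p, q, r]" for p q r
    by (rule YB_in) (use that assms in auto)
  have c: "comm (g p q) (g r s) \<in> J (2 * D)" if "{p, q, r, s} \<subseteq> {i, j, k, l}" "distinct [p, q, r, s]" for p q r s
    by (rule comm_disjoint_in) (use that assms in auto)
  have e: "e p xs ys \<in> J (4 * D)" if "p \<in> J (2 * D)" for p xs ys
    unfolding e_def by (rule conj_rel[OF that])
  have "?S e \<in> J (4 * D)"
    by (intro relspan_add relspan_diff e y c) (use assms(2) in auto)
  then have "- Zam i j k l \<in> J (4 * D)" unfolding eq .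
  then show ?thesis using relspan_uminus by fastforce
qed

end

context yang_baxter
begin

section \<open>The hexagon identities\<close>

definition hex :: "pair \<Rightarrow> pair \<Rightarrow> pair \<Rightarrow> pair falg" where
  "hex x y z = comm (rel x y) (gen z) + comm (rel y z) (gen x) + comm (rel z x) (gen y)"

text \<open>The lists L below come from solving linear systems: subtracting the right combination of
tetrahedron identities from the hexagon leaves only commutators of higher weight.\<close>
definition crel :: "(pair \<times> pair \<times> pair) list \<Rightarrow> pair falg" where
  "crel L = (\<Sum>(x, y, z)\<leftarrow>L. comm (rel x y) (gen z))"

lemma crel_in:
  "\<forall>(x, y, z)\<in>set L. adj n x y \<and> k \<le> dg n D x + dg n D y + dg n D z \<Longrightarrow> crel L \<in> J k"
  by (induction L) (auto simp: crel_def relspan.zero intro!: relspan_add comm_rel_in)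

text \<open>Z stands for the tetrahedron identities. By the bound on D the level 4 D already exceeds
  the weight of the three letters, so weights are compared only for the entries of L.\<close>

lemma hex_in:
  assumes "hex x y z = Z + crel L" "Z \<in> J (4 * D)"
    and "\<forall>(u, v, w)\<in>set L. adj n u v \<and> dg n D x + dg n D y + dg n D z < dg n D u + dg n D v + dg n D w"
  shows "hex x y z \<in> J (dg n D x + dg n D y + dg n D z + 1)"
proof -
  have "dg n D x + dg n D y + dg n D z + 1 \<le> 4 * D"
    using dg_le[of n D x] dg_le[of n D y] dg_le[of n D z] D by linarith
  then have "Z \<in> J (dg n D x + dg n D y + dg n D z + 1)" using relspan_mono[OF assms(2)] by blast
  moreover have "crel L \<in> J (dg n D x + dg n D y + dg n D z + 1)"
    by (rule crel_in) (use assms(3) in auto)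
  ultimately show ?thesis unfolding assms(1) by (rule relspan_add)
qed

lemma four_points:
  assumes "a < b" "b < c" "c < (d::nat)"
  shows "a < c" "a < d" "b < d" "a \<noteq> b" "a \<noteq> c" "a \<noteq> d" "b \<noteq> c" "b \<noteq> d" "c \<noteq> d"
    "b \<noteq> a" "c \<noteq> a" "d \<noteq> a" "c \<noteq> b" "d \<noteq> b" "d \<noteq> c"
    "\<not> b < a" "\<not> c < a" "\<not> d < a" "\<not> c < b" "\<not> d < b" "\<not> d < c"
  using assms by auto

context
  fixes a b c d :: nat
  assumes ord: "1 \<le> a" "a < b" "b < c" "c < d" "d \<le> n"
begin

lemma bounds: "Suc 0 \<le> a" "Suc 0 \<le> b" "Suc 0 \<le> c" "Suc 0 \<le> d" "a \<le> n" "b \<le> n" "c \<le> n"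
  using ord by auto

lemmas ords = ord bounds four_points[OF ord(2-4)]

lemmas hex_simps = hex_def rel_def mx_def Zam_def comm_def crel_def algebra_simps ords

lemma Zam_abcd:
  assumes "{i, j, k, l} \<subseteq> {a, b, c, d}" "distinct [i, j, k, l]"
  shows "Zam i j k l \<in> J (4 * D)"
proof -
  have "{a, b, c, d} \<subseteq> {1..n}" using ords by simp
  from Zam_in[OF order_trans[OF assms(1) this] assms(2)] show ?thesis .
qed

lemmas Zam_sum = relspan_add relspan_diff relspan_uminus Zam_abcd

text \<open>This and the following lemmas treat the 24 = 2 * 3 * 4 triangles that connect four
  points a < b < c < d: two letters on {a, b}, then three that attach c and four that attach d. Once
  the signs of the tetrahedron identities and the list are given, each equation is an expansion in
  the free algebra and each weight comparison follows from the order of the points.\<close>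

lemma hex_1: "hex (a, b) (a, c) (a, d) \<in> J (dg n D (a, b) + dg n D (a, c) + dg n D (a, d) + 1)"
  by (rule hex_in[of _ _ _ "Zam a b c d"
      "[((a, c), (a, b), (b, d)), ((a, c), (a, b), (c, d)), ((a, b), (a, d), (b, c)),
       ((a, d), (a, b), (c, d)), ((a, b), (c, d), (a, c)), ((a, b), (c, d), (a, d)),
       ((a, b), (c, d), (b, c)), ((a, b), (c, d), (b, d)), ((a, c), (a, d), (b, c)),
       ((a, c), (a, d), (b, d)), ((b, d), (a, c), (a, b)), ((b, d), (a, c), (a, d)),
       ((a, c), (b, d), (b, c)), ((b, d), (a, c), (c, d)), ((a, d), (b, c), (a, b)),
       ((a, d), (b, c), (a, c)), ((b, c), (a, d), (b, d)), ((b, c), (a, d), (c, d)),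
       ((b, d), (b, c), (a, b)), ((b, d), (b, c), (a, c)), ((b, d), (b, c), (a, d))]"])
    (simp add: hex_simps, (intro Zam_sum; simp add: ords),
      simp add: adj_def mx_def pairs_def dg_def ords, use ord in auto)

lemma hex_2: "hex (a, b) (a, c) (d, a) \<in> J (dg n D (a, b) + dg n D (a, c) + dg n D (d, a) + 1)"
  by (rule hex_in[of _ _ _ "Zam d a b c"
      "[((a, c), (a, b), (d, b)), ((a, c), (a, b), (d, c)), ((a, b), (d, a), (b, c)),
       ((a, b), (d, a), (d, c)), ((a, b), (d, c), (a, c)), ((a, b), (d, c), (b, c)),
       ((d, c), (a, b), (d, a)), ((d, c), (a, b), (d, b)), ((a, c), (d, a), (b, c)),
       ((d, a), (a, c), (d, b)), ((d, b), (a, c), (a, b)), ((a, c), (d, b), (b, c)),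
       ((a, c), (d, b), (d, a)), ((a, c), (d, b), (d, c)), ((d, a), (b, c), (a, b)),
       ((d, a), (b, c), (a, c)), ((d, a), (b, c), (d, b)), ((d, a), (b, c), (d, c)),
       ((d, b), (b, c), (a, b)), ((d, b), (b, c), (a, c)), ((b, c), (d, b), (d, a))]"])
    (simp add: hex_simps, (intro Zam_sum; simp add: ords),
      simp add: adj_def mx_def pairs_def dg_def ords, use ord in auto)

lemma hex_3: "hex (a, b) (a, c) (d, b) \<in> J (dg n D (a, b) + dg n D (a, c) + dg n D (d, b) + 1)"
  by (rule hex_in[of _ _ _ "- Zam a c b d - Zam a c d b"
      "[((a, c), (a, b), (b, d)), ((a, b), (c, b), (b, d)), ((a, b), (c, b), (d, b)),
       ((a, b), (c, d), (b, d)), ((a, b), (c, d), (d, b)), ((d, b), (a, b), (c, b)),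
       ((d, b), (a, b), (c, d)), ((a, c), (a, d), (b, d)), ((a, c), (a, d), (d, b)),
       ((b, d), (a, c), (a, b)), ((b, d), (a, c), (a, d)), ((b, d), (a, c), (c, b)),
       ((b, d), (a, c), (c, d)), ((d, b), (a, c), (a, d)), ((d, b), (a, c), (c, b)),
       ((d, b), (a, c), (c, d)), ((a, d), (c, b), (b, d)), ((a, d), (c, b), (d, b)),
       ((c, b), (b, d), (a, b)), ((c, b), (b, d), (a, c)), ((c, b), (b, d), (a, d)),
       ((c, b), (d, b), (a, b)), ((c, b), (d, b), (a, c)), ((c, b), (d, b), (a, d))]"])
    (simp add: hex_simps, (intro Zam_sum; simp add: ords),
      simp add: adj_def mx_def pairs_def dg_def ords, use ord in auto)

lemma hex_4: "hex (a, b) (a, c) (d, c) \<in> J (dg n D (a, b) + dg n D (a, c) + dg n D (d, c) + 1)"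
  by (rule hex_in[of _ _ _ "Zam a b c d + Zam a b d c"
      "[((a, c), (a, b), (c, d)), ((a, d), (a, b), (c, d)), ((a, d), (a, b), (d, c)),
       ((a, b), (c, d), (a, c)), ((a, b), (c, d), (a, d)), ((a, b), (c, d), (b, c)),
       ((a, b), (c, d), (b, d)), ((a, b), (d, c), (a, d)), ((a, b), (d, c), (b, c)),
       ((a, b), (d, c), (b, d)), ((b, d), (a, c), (c, d)), ((b, d), (a, c), (d, c)),
       ((a, c), (d, c), (b, c)), ((a, c), (d, c), (b, d)), ((b, c), (a, d), (c, d)),
       ((b, c), (a, d), (d, c)), ((d, c), (b, c), (a, b)), ((d, c), (b, c), (a, c)),
       ((d, c), (b, c), (a, d))]"])
    (simp add: hex_simps, (intro Zam_sum; simp add: ords),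
      simp add: adj_def mx_def pairs_def dg_def ords, use ord in auto)

lemma hex_5: "hex (a, b) (c, a) (a, d) \<in> J (dg n D (a, b) + dg n D (c, a) + dg n D (a, d) + 1)"
  by (rule hex_in[of _ _ _ "- Zam c a b d"
      "[((a, b), (a, d), (c, b)), ((a, b), (a, d), (c, d)), ((c, a), (a, b), (b, d)),
       ((c, a), (a, b), (c, d)), ((c, d), (a, b), (a, d)), ((c, d), (a, b), (b, d)),
       ((a, b), (c, d), (c, a)), ((a, b), (c, d), (c, b)), ((c, a), (a, d), (b, d)),
       ((a, d), (c, a), (c, b)), ((b, d), (c, a), (a, b)), ((b, d), (c, a), (a, d)),
       ((b, d), (c, a), (c, b)), ((b, d), (c, a), (c, d)), ((a, d), (c, b), (a, b)),
       ((c, b), (a, d), (b, d)), ((c, b), (a, d), (c, a)), ((c, b), (a, d), (c, d)),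
       ((b, d), (c, b), (a, b)), ((b, d), (c, b), (a, d)), ((c, b), (b, d), (c, a))]"])
    (simp add: hex_simps, (intro Zam_sum; simp add: ords),
      simp add: adj_def mx_def pairs_def dg_def ords, use ord in auto)

lemma hex_6: "hex (a, b) (c, a) (d, a) \<in> J (dg n D (a, b) + dg n D (c, a) + dg n D (d, a) + 1)"
  by (rule hex_in[of _ _ _ "Zam c d a b"
      "[((a, b), (c, a), (c, d)), ((c, a), (a, b), (d, b)), ((c, d), (a, b), (c, a)),
       ((c, d), (a, b), (c, b)), ((c, d), (a, b), (d, a)), ((c, d), (a, b), (d, b)),
       ((a, b), (d, a), (c, b)), ((a, b), (d, a), (c, d)), ((d, a), (c, a), (c, b)),
       ((d, a), (c, a), (d, b)), ((d, b), (c, a), (a, b)), ((d, b), (c, a), (c, b)),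
       ((d, b), (c, a), (c, d)), ((c, a), (d, b), (d, a)), ((d, a), (c, b), (a, b)),
       ((c, b), (d, a), (c, a)), ((c, b), (d, a), (c, d)), ((d, a), (c, b), (d, b)),
       ((d, b), (c, b), (a, b)), ((c, b), (d, b), (c, a)), ((c, b), (d, b), (d, a))]"])
    (simp add: hex_simps, (intro Zam_sum; simp add: ords),
      simp add: adj_def mx_def pairs_def dg_def ords, use ord in auto)

lemma hex_7: "hex (a, b) (c, a) (d, b) \<in> J (dg n D (a, b) + dg n D (c, a) + dg n D (d, b) + 1)"
  by (rule hex_in[of _ _ _ "- Zam c a b d - Zam c a d b"
      "[((c, a), (a, b), (b, d)), ((c, d), (a, b), (b, d)), ((c, d), (a, b), (d, b)),
       ((a, b), (d, b), (c, b)), ((a, b), (d, b), (c, d)), ((c, a), (a, d), (b, d)),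
       ((c, a), (a, d), (d, b)), ((b, d), (c, a), (a, b)), ((b, d), (c, a), (a, d)),
       ((b, d), (c, a), (c, b)), ((b, d), (c, a), (c, d)), ((d, b), (c, a), (a, d)),
       ((d, b), (c, a), (c, b)), ((d, b), (c, a), (c, d)), ((c, b), (a, d), (b, d)),
       ((c, b), (a, d), (d, b)), ((b, d), (c, b), (a, b)), ((b, d), (c, b), (a, d)),
       ((c, b), (b, d), (c, a)), ((d, b), (c, b), (a, b)), ((d, b), (c, b), (a, d)),
       ((c, b), (d, b), (c, a))]"])
    (simp add: hex_simps, (intro Zam_sum; simp add: ords),
      simp add: adj_def mx_def pairs_def dg_def ords, use ord in auto)

lemma hex_8: "hex (a, b) (c, a) (d, c) \<in> J (dg n D (a, b) + dg n D (c, a) + dg n D (d, c) + 1)"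
  by (rule hex_in[of _ _ _ "- Zam c d a b - Zam d c a b"
      "[((c, a), (a, b), (c, d)), ((a, b), (c, d), (c, a)), ((a, b), (c, d), (c, b)),
       ((a, b), (c, d), (d, a)), ((a, b), (c, d), (d, b)), ((d, a), (a, b), (c, d)),
       ((d, a), (a, b), (d, c)), ((a, b), (d, c), (c, b)), ((a, b), (d, c), (d, a)),
       ((a, b), (d, c), (d, b)), ((c, a), (d, b), (c, d)), ((c, a), (d, b), (d, c)),
       ((d, c), (c, a), (c, b)), ((d, c), (c, a), (d, b)), ((d, a), (c, b), (c, d)),
       ((d, a), (c, b), (d, c)), ((d, c), (c, b), (a, b)), ((c, b), (d, c), (c, a)),
       ((c, b), (d, c), (d, a))]"])
    (simp add: hex_simps, (intro Zam_sum; simp add: ords),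
      simp add: adj_def mx_def pairs_def dg_def ords, use ord in auto)

lemma hex_9: "hex (a, b) (c, b) (a, d) \<in> J (dg n D (a, b) + dg n D (c, b) + dg n D (a, d) + 1)"
  by (rule hex_in[of _ _ _ "Zam a b c d + Zam a c b d"
      "[((a, b), (a, d), (b, c)), ((c, b), (a, b), (b, d)), ((c, b), (a, b), (c, d)),
       ((a, b), (c, d), (b, c)), ((a, b), (c, d), (c, b)), ((a, c), (a, d), (b, c)),
       ((a, c), (a, d), (c, b)), ((a, c), (b, d), (b, c)), ((a, c), (b, d), (c, b)),
       ((a, d), (b, c), (a, b)), ((a, d), (b, c), (a, c)), ((b, c), (a, d), (b, d)),
       ((b, c), (a, d), (c, d)), ((b, d), (b, c), (a, b)), ((b, d), (b, c), (a, c)),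
       ((b, d), (b, c), (a, d)), ((a, d), (c, b), (a, c)), ((c, b), (a, d), (b, d)),
       ((c, b), (a, d), (c, d)), ((b, d), (c, b), (a, b)), ((b, d), (c, b), (a, c)),
       ((b, d), (c, b), (a, d))]"])
    (simp add: hex_simps, (intro Zam_sum; simp add: ords),
      simp add: adj_def mx_def pairs_def dg_def ords, use ord in auto)

lemma hex_10: "hex (a, b) (c, b) (d, a) \<in> J (dg n D (a, b) + dg n D (c, b) + dg n D (d, a) + 1)"
  by (rule hex_in[of _ _ _ "Zam d a b c + Zam d a c b"
      "[((c, b), (a, b), (d, b)), ((c, b), (a, b), (d, c)), ((a, b), (d, a), (b, c)),
       ((a, b), (d, c), (b, c)), ((a, b), (d, c), (c, b)), ((a, c), (d, a), (b, c)),
       ((a, c), (d, a), (c, b)), ((a, c), (d, b), (b, c)), ((a, c), (d, b), (c, b)),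
       ((d, a), (b, c), (a, b)), ((d, a), (b, c), (a, c)), ((d, a), (b, c), (d, b)),
       ((d, a), (b, c), (d, c)), ((d, b), (b, c), (a, b)), ((d, b), (b, c), (a, c)),
       ((b, c), (d, b), (d, a)), ((d, a), (c, b), (a, c)), ((d, a), (c, b), (d, b)),
       ((d, a), (c, b), (d, c)), ((d, b), (c, b), (a, b)), ((d, b), (c, b), (a, c)),
       ((c, b), (d, b), (d, a)), ((d, c), (c, b), (a, b)), ((d, c), (c, b), (a, c)),
       ((c, b), (d, c), (d, a))]"])
    (simp add: hex_simps, (intro Zam_sum; simp add: ords),
      simp add: adj_def mx_def pairs_def dg_def ords, use ord in auto)

lemma hex_11: "hex (a, b) (c, b) (d, b) \<in> J (dg n D (a, b) + dg n D (c, b) + dg n D (d, b) + 1)"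
  by (rule hex_in[of _ _ _ "- Zam a b d c + Zam a c b d + Zam a c d b - Zam a d b c"
      "[((c, b), (a, b), (b, d)), ((c, d), (a, b), (b, d)), ((c, d), (a, b), (d, b)),
       ((a, b), (d, b), (b, c)), ((a, b), (d, b), (c, d)), ((a, b), (d, b), (d, c)),
       ((d, c), (a, b), (b, d)), ((d, c), (a, b), (d, b)), ((a, c), (b, d), (b, c)),
       ((a, c), (b, d), (c, b)), ((a, c), (b, d), (c, d)), ((a, c), (b, d), (d, c)),
       ((a, c), (d, b), (b, c)), ((a, c), (d, b), (c, b)), ((a, c), (d, b), (c, d)),
       ((a, c), (d, b), (d, c)), ((d, c), (a, c), (b, d)), ((d, c), (a, c), (d, b)),
       ((b, c), (a, d), (b, d)), ((b, c), (a, d), (d, b)), ((b, d), (b, c), (a, b)),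
       ((b, d), (b, c), (a, c)), ((b, d), (b, c), (a, d)), ((d, b), (b, c), (a, b)),
       ((d, b), (b, c), (a, c)), ((d, b), (b, c), (a, d)), ((b, c), (d, c), (a, b)),
       ((b, c), (d, c), (a, c)), ((b, c), (d, c), (a, d)), ((c, b), (a, d), (b, d)),
       ((c, b), (a, d), (d, b)), ((b, d), (c, b), (a, b)), ((b, d), (c, b), (a, c)),
       ((b, d), (c, b), (a, d)), ((d, b), (c, b), (a, c)), ((d, b), (c, b), (a, d))]"])
    (simp add: hex_simps, (intro Zam_sum; simp add: ords),
      simp add: adj_def mx_def pairs_def dg_def ords, use ord in auto)

lemma hex_12: "hex (a, b) (c, b) (d, c) \<in> J (dg n D (a, b) + dg n D (c, b) + dg n D (d, c) + 1)"
  by (rule hex_in[of _ _ _ "Zam a b c d + Zam a b d c - Zam a c d b - Zam a d c b"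
      "[((c, b), (a, b), (c, d)), ((a, b), (c, d), (b, c)), ((a, b), (c, d), (b, d)),
       ((a, b), (c, d), (c, b)), ((a, b), (c, d), (d, b)), ((d, b), (a, b), (c, d)),
       ((d, b), (a, b), (d, c)), ((a, b), (d, c), (b, c)), ((a, b), (d, c), (b, d)),
       ((a, b), (d, c), (d, b)), ((b, d), (a, c), (c, d)), ((b, d), (a, c), (d, c)),
       ((d, b), (a, c), (c, d)), ((d, b), (a, c), (d, c)), ((a, c), (d, c), (b, c)),
       ((a, c), (d, c), (b, d)), ((a, c), (d, c), (c, b)), ((a, c), (d, c), (d, b)),
       ((b, c), (a, d), (c, d)), ((b, c), (a, d), (d, c)), ((d, c), (b, c), (a, b)),
       ((d, c), (b, c), (a, c)), ((d, c), (b, c), (a, d)), ((c, b), (a, d), (c, d)),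
       ((c, b), (a, d), (d, c)), ((d, c), (c, b), (a, c)), ((d, c), (c, b), (a, d))]"])
    (simp add: hex_simps, (intro Zam_sum; simp add: ords),
      simp add: adj_def mx_def pairs_def dg_def ords, use ord in auto)

lemma hex_13: "hex (b, a) (a, c) (a, d) \<in> J (dg n D (b, a) + dg n D (a, c) + dg n D (a, d) + 1)"
  by (rule hex_in[of _ _ _ "Zam b a c d"
      "[((a, d), (a, c), (b, c)), ((a, d), (a, c), (b, d)), ((a, c), (b, d), (a, d)),
       ((b, d), (a, c), (b, a)), ((b, d), (a, c), (b, c)), ((a, c), (b, d), (c, d)),
       ((a, c), (b, a), (b, d)), ((a, c), (b, a), (c, d)), ((b, a), (a, d), (b, c)),
       ((a, d), (b, a), (c, d)), ((b, a), (c, d), (a, c)), ((b, a), (c, d), (a, d)),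
       ((b, a), (c, d), (b, c)), ((b, a), (c, d), (b, d)), ((b, c), (a, d), (a, c)),
       ((a, d), (b, c), (b, a)), ((a, d), (b, c), (b, d)), ((a, d), (b, c), (c, d)),
       ((b, c), (b, d), (a, c)), ((b, c), (b, d), (a, d)), ((b, d), (b, c), (b, a))]"])
    (simp add: hex_simps, (intro Zam_sum; simp add: ords),
      simp add: adj_def mx_def pairs_def dg_def ords, use ord in auto)

lemma hex_14: "hex (b, a) (a, c) (d, a) \<in> J (dg n D (b, a) + dg n D (a, c) + dg n D (d, a) + 1)"
  by (rule hex_in[of _ _ _ "- Zam b d a c"
      "[((a, c), (b, d), (b, a)), ((a, c), (b, d), (b, c)), ((a, c), (b, d), (d, a)),
       ((a, c), (b, d), (d, c)), ((d, a), (a, c), (b, c)), ((d, a), (a, c), (b, d)),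
       ((b, a), (a, c), (b, d)), ((a, c), (b, a), (d, c)), ((b, a), (d, a), (b, c)),
       ((b, a), (d, a), (d, c)), ((b, a), (d, c), (a, c)), ((b, a), (d, c), (b, c)),
       ((b, a), (d, c), (b, d)), ((d, c), (b, a), (d, a)), ((b, d), (b, c), (a, c)),
       ((b, c), (b, d), (b, a)), ((b, c), (b, d), (d, a)), ((b, c), (d, a), (a, c)),
       ((d, a), (b, c), (b, a)), ((d, a), (b, c), (b, d)), ((b, c), (d, a), (d, c)),
       ((b, c), (d, c), (a, c)), ((d, c), (b, c), (b, a)), ((d, c), (b, c), (d, a))]"])
    (simp add: hex_simps, (intro Zam_sum; simp add: ords),
      simp add: adj_def mx_def pairs_def dg_def ords, use ord in auto)

lemma hex_15: "hex (b, a) (a, c) (d, b) \<in> J (dg n D (b, a) + dg n D (a, c) + dg n D (d, b) + 1)"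
  by (rule hex_in[of _ _ _ "Zam b d a c + Zam d b a c"
      "[((b, d), (a, c), (b, a)), ((b, d), (a, c), (b, c)), ((b, d), (a, c), (d, a)),
       ((b, d), (a, c), (d, c)), ((a, c), (d, a), (b, d)), ((a, c), (d, a), (d, b)),
       ((d, b), (a, c), (b, c)), ((d, b), (a, c), (d, a)), ((d, b), (a, c), (d, c)),
       ((a, c), (b, a), (b, d)), ((b, a), (d, b), (b, c)), ((b, a), (d, b), (d, c)),
       ((d, c), (b, a), (b, d)), ((d, c), (b, a), (d, b)), ((b, c), (b, d), (a, c)),
       ((b, d), (b, c), (b, a)), ((b, d), (b, c), (d, a)), ((b, c), (d, a), (b, d)),
       ((b, c), (d, a), (d, b)), ((b, c), (d, b), (a, c)), ((d, b), (b, c), (b, a)),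
       ((d, b), (b, c), (d, a)), ((d, c), (b, c), (a, c)), ((b, c), (d, c), (b, a)),
       ((b, c), (d, c), (d, a))]"])
    (simp add: hex_simps, (intro Zam_sum; simp add: ords),
      simp add: adj_def mx_def pairs_def dg_def ords, use ord in auto)

lemma hex_16: "hex (b, a) (a, c) (d, c) \<in> J (dg n D (b, a) + dg n D (a, c) + dg n D (d, c) + 1)"
  by (rule hex_in[of _ _ _ "Zam b a c d + Zam b a d c"
      "[((a, c), (b, d), (c, d)), ((a, c), (b, d), (d, c)), ((d, c), (a, c), (b, c)),
       ((d, c), (a, c), (b, d)), ((a, c), (b, a), (c, d)), ((a, d), (b, a), (c, d)),
       ((a, d), (b, a), (d, c)), ((b, a), (c, d), (a, c)), ((b, a), (c, d), (a, d)),
       ((b, a), (c, d), (b, c)), ((b, a), (c, d), (b, d)), ((b, a), (d, c), (a, d)),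
       ((b, a), (d, c), (b, c)), ((b, a), (d, c), (b, d)), ((a, d), (b, c), (c, d)),
       ((a, d), (b, c), (d, c)), ((b, c), (d, c), (a, c)), ((b, c), (d, c), (a, d)),
       ((d, c), (b, c), (b, a))]"])
    (simp add: hex_simps, (intro Zam_sum; simp add: ords),
      simp add: adj_def mx_def pairs_def dg_def ords, use ord in auto)

lemma hex_17: "hex (b, a) (c, a) (a, d) \<in> J (dg n D (b, a) + dg n D (c, a) + dg n D (a, d) + 1)"
  by (rule hex_in[of _ _ _ "Zam b c a d"
      "[((a, d), (b, a), (b, c)), ((b, a), (a, d), (c, d)), ((c, a), (b, a), (b, d)),
       ((c, a), (b, a), (c, d)), ((c, d), (b, a), (a, d)), ((c, d), (b, a), (b, c)),
       ((c, d), (b, a), (b, d)), ((b, a), (c, d), (c, a)), ((b, c), (a, d), (b, a)),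
       ((b, c), (a, d), (b, d)), ((b, c), (a, d), (c, a)), ((b, c), (a, d), (c, d)),
       ((b, d), (b, c), (a, d)), ((b, c), (b, d), (b, a)), ((b, c), (b, d), (c, a)),
       ((a, d), (c, a), (b, c)), ((a, d), (c, a), (b, d)), ((c, a), (b, d), (a, d)),
       ((b, d), (c, a), (b, a)), ((b, d), (c, a), (b, c)), ((c, a), (b, d), (c, d))]"])
    (simp add: hex_simps, (intro Zam_sum; simp add: ords),
      simp add: adj_def mx_def pairs_def dg_def ords, use ord in auto)

lemma hex_18: "hex (b, a) (c, a) (d, a) \<in> J (dg n D (b, a) + dg n D (c, a) + dg n D (d, a) + 1)"
  by (rule hex_in[of _ _ _ "Zam b c d a"
      "[((b, a), (c, a), (b, d)), ((b, a), (c, a), (c, d)), ((b, a), (c, d), (b, c)),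
       ((b, a), (c, d), (b, d)), ((c, d), (b, a), (c, a)), ((c, d), (b, a), (d, a)),
       ((d, a), (b, a), (b, c)), ((b, a), (d, a), (c, d)), ((b, d), (b, c), (b, a)),
       ((b, d), (b, c), (c, a)), ((b, d), (b, c), (d, a)), ((b, c), (d, a), (b, a)),
       ((b, c), (d, a), (b, d)), ((b, c), (d, a), (c, a)), ((b, c), (d, a), (c, d)),
       ((c, a), (b, d), (b, a)), ((c, a), (b, d), (b, c)), ((b, d), (c, a), (c, d)),
       ((c, a), (b, d), (d, a)), ((d, a), (c, a), (b, c)), ((d, a), (c, a), (b, d))]"])
    (simp add: hex_simps, (intro Zam_sum; simp add: ords),
      simp add: adj_def mx_def pairs_def dg_def ords, use ord in auto)

lemma hex_19: "hex (b, a) (c, a) (d, b) \<in> J (dg n D (b, a) + dg n D (c, a) + dg n D (d, b) + 1)"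
  by (rule hex_in[of _ _ _ "Zam c b d a + Zam c d b a"
      "[((c, a), (b, a), (b, d)), ((c, b), (b, a), (b, d)), ((c, b), (b, a), (d, b)),
       ((c, d), (b, a), (b, d)), ((c, d), (b, a), (d, b)), ((b, a), (d, b), (c, b)),
       ((b, a), (d, b), (c, d)), ((b, d), (c, a), (b, a)), ((c, a), (b, d), (c, b)),
       ((c, a), (b, d), (c, d)), ((b, d), (c, a), (d, a)), ((c, a), (d, a), (b, d)),
       ((c, a), (d, a), (d, b)), ((c, a), (d, b), (c, b)), ((c, a), (d, b), (c, d)),
       ((d, b), (c, a), (d, a)), ((b, d), (c, b), (b, a)), ((b, d), (c, b), (c, a)),
       ((b, d), (c, b), (d, a)), ((c, b), (d, a), (b, d)), ((c, b), (d, a), (d, b)),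
       ((d, b), (c, b), (b, a)), ((d, b), (c, b), (c, a)), ((d, b), (c, b), (d, a))]"])
    (simp add: hex_simps, (intro Zam_sum; simp add: ords),
      simp add: adj_def mx_def pairs_def dg_def ords, use ord in auto)

lemma hex_20: "hex (b, a) (c, a) (d, c) \<in> J (dg n D (b, a) + dg n D (c, a) + dg n D (d, c) + 1)"
  by (rule hex_in[of _ _ _ "- Zam b c d a - Zam b d c a"
      "[((c, a), (b, a), (c, d)), ((c, d), (b, a), (b, c)), ((c, d), (b, a), (b, d)),
       ((b, a), (c, d), (c, a)), ((b, a), (c, d), (d, a)), ((d, a), (b, a), (c, d)),
       ((d, a), (b, a), (d, c)), ((d, c), (b, a), (b, c)), ((d, c), (b, a), (b, d)),
       ((b, a), (d, c), (d, a)), ((d, a), (b, c), (c, d)), ((d, a), (b, c), (d, c)),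
       ((b, c), (d, c), (b, a)), ((b, c), (d, c), (c, a)), ((b, c), (d, c), (d, a)),
       ((c, a), (b, d), (c, d)), ((c, a), (b, d), (d, c)), ((d, c), (c, a), (b, c)),
       ((d, c), (c, a), (b, d))]"])
    (simp add: hex_simps, (intro Zam_sum; simp add: ords),
      simp add: adj_def mx_def pairs_def dg_def ords, use ord in auto)

lemma hex_21: "hex (b, a) (c, b) (a, d) \<in> J (dg n D (b, a) + dg n D (c, b) + dg n D (a, d) + 1)"
  by (rule hex_in[of _ _ _ "- Zam b c a d - Zam c b a d"
      "[((b, a), (a, d), (b, c)), ((c, b), (b, a), (b, d)), ((c, b), (b, a), (c, d)),
       ((b, a), (c, d), (b, c)), ((b, a), (c, d), (c, b)), ((a, d), (b, c), (b, a)),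
       ((a, d), (b, c), (b, d)), ((a, d), (b, c), (c, a)), ((a, d), (b, c), (c, d)),
       ((b, c), (b, d), (a, d)), ((b, d), (b, c), (b, a)), ((b, d), (b, c), (c, a)),
       ((c, a), (a, d), (b, c)), ((c, a), (a, d), (c, b)), ((c, a), (b, d), (b, c)),
       ((c, a), (b, d), (c, b)), ((a, d), (c, b), (b, d)), ((a, d), (c, b), (c, a)),
       ((a, d), (c, b), (c, d)), ((c, b), (b, d), (a, d)), ((b, d), (c, b), (b, a)),
       ((b, d), (c, b), (c, a))]"])
    (simp add: hex_simps, (intro Zam_sum; simp add: ords),
      simp add: adj_def mx_def pairs_def dg_def ords, use ord in auto)

lemma hex_22: "hex (b, a) (c, b) (d, a) \<in> J (dg n D (b, a) + dg n D (c, b) + dg n D (d, a) + 1)"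
  by (rule hex_in[of _ _ _ "- Zam b c d a - Zam c b d a"
      "[((b, a), (c, b), (b, d)), ((b, a), (c, b), (c, d)), ((c, d), (b, a), (b, c)),
       ((c, d), (b, a), (c, b)), ((b, a), (d, a), (b, c)), ((b, c), (b, d), (b, a)),
       ((b, c), (b, d), (c, a)), ((b, c), (b, d), (d, a)), ((d, a), (b, c), (b, a)),
       ((d, a), (b, c), (b, d)), ((d, a), (b, c), (c, a)), ((d, a), (b, c), (c, d)),
       ((b, d), (c, a), (b, c)), ((b, d), (c, a), (c, b)), ((c, a), (d, a), (b, c)),
       ((c, a), (d, a), (c, b)), ((c, b), (b, d), (b, a)), ((c, b), (b, d), (c, a)),
       ((c, b), (b, d), (d, a)), ((d, a), (c, b), (b, d)), ((d, a), (c, b), (c, a)),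
       ((d, a), (c, b), (c, d))]"])
    (simp add: hex_simps, (intro Zam_sum; simp add: ords),
      simp add: adj_def mx_def pairs_def dg_def ords, use ord in auto)

lemma hex_23: "hex (b, a) (c, b) (d, b) \<in> J (dg n D (b, a) + dg n D (c, b) + dg n D (d, b) + 1)"
  by (rule hex_in[of _ _ _ "- Zam b d c a + Zam c b d a + Zam c d b a - Zam d b c a"
      "[((c, b), (b, a), (b, d)), ((c, d), (b, a), (b, d)), ((c, d), (b, a), (d, b)),
       ((b, a), (d, b), (b, c)), ((b, a), (d, b), (c, d)), ((b, a), (d, b), (d, c)),
       ((d, c), (b, a), (b, d)), ((d, c), (b, a), (d, b)), ((b, d), (b, c), (b, a)),
       ((b, d), (b, c), (c, a)), ((b, d), (b, c), (d, a)), ((b, c), (d, a), (b, d)),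
       ((b, c), (d, a), (d, b)), ((d, b), (b, c), (b, a)), ((d, b), (b, c), (c, a)),
       ((d, b), (b, c), (d, a)), ((b, c), (d, c), (b, a)), ((b, c), (d, c), (c, a)),
       ((b, c), (d, c), (d, a)), ((c, a), (b, d), (b, c)), ((c, a), (b, d), (c, b)),
       ((c, a), (b, d), (c, d)), ((c, a), (b, d), (d, c)), ((c, a), (d, b), (b, c)),
       ((c, a), (d, b), (c, b)), ((c, a), (d, b), (c, d)), ((c, a), (d, b), (d, c)),
       ((d, c), (c, a), (b, d)), ((d, c), (c, a), (d, b)), ((b, d), (c, b), (b, a)),
       ((b, d), (c, b), (c, a)), ((b, d), (c, b), (d, a)), ((c, b), (d, a), (b, d)),
       ((c, b), (d, a), (d, b)), ((d, b), (c, b), (c, a)), ((d, b), (c, b), (d, a))]"])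
    (simp add: hex_simps, (intro Zam_sum; simp add: ords),
      simp add: adj_def mx_def pairs_def dg_def ords, use ord in auto)

lemma hex_24: "hex (b, a) (c, b) (d, c) \<in> J (dg n D (b, a) + dg n D (c, b) + dg n D (d, c) + 1)"
  by (rule hex_in[of _ _ _ "Zam b c d a + Zam b d c a - Zam c d b a - Zam d c b a"
      "[((c, b), (b, a), (c, d)), ((b, a), (c, d), (b, c)), ((b, a), (c, d), (b, d)),
       ((b, a), (c, d), (c, b)), ((b, a), (c, d), (d, b)), ((d, b), (b, a), (c, d)),
       ((d, b), (b, a), (d, c)), ((b, a), (d, c), (b, c)), ((b, a), (d, c), (b, d)),
       ((b, a), (d, c), (d, b)), ((b, c), (d, a), (c, d)), ((b, c), (d, a), (d, c)),
       ((d, c), (b, c), (b, a)), ((d, c), (b, c), (c, a)), ((d, c), (b, c), (d, a)),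
       ((b, d), (c, a), (c, d)), ((b, d), (c, a), (d, c)), ((d, b), (c, a), (c, d)),
       ((d, b), (c, a), (d, c)), ((c, a), (d, c), (b, c)), ((c, a), (d, c), (b, d)),
       ((c, a), (d, c), (c, b)), ((c, a), (d, c), (d, b)), ((c, b), (d, a), (c, d)),
       ((c, b), (d, a), (d, c)), ((d, c), (c, b), (c, a)), ((d, c), (c, b), (d, a))]"])
    (simp add: hex_simps, (intro Zam_sum; simp add: ords),
      simp add: adj_def mx_def pairs_def dg_def ords, use ord in auto)

lemma hex_connected:
  assumes "x \<in> {(a, b), (b, a)}" "y \<in> {(a, c), (c, a), (c, b)}" "z \<in> {(a, d), (d, a), (d, b), (d, c)}"
  shows "hex x y z \<in> J (dg n D x + dg n D y + dg n D z + 1)"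
  using assms
  by (elim insertE emptyE; hypsubst)
    (rule hex_1 hex_2 hex_3 hex_4 hex_5 hex_6 hex_7 hex_8 hex_9 hex_10 hex_11 hex_12 hex_13 hex_14 hex_15 hex_16 hex_17 hex_18 hex_19 hex_20 hex_21 hex_22 hex_23 hex_24)+

end

section \<open>Triangles with a disjoint letter, and reduction to sorted triangles\<close>

lemma hex_rotate: "hex y z x = hex x y z"
  by (simp add: hex_def add.commute add.left_commute)

lemma hex_antisym:
  assumes "adj n x y" "adj n y z" "adj n x z"
  shows "hex y x z = - hex x y z"
  using rel_antisym[OF assms(1)] rel_antisym[OF assms(2)] rel_antisym[OF assms(3)]
  by (simp add: hex_def comm_def algebra_simps)

text \<open>The relations of u with v and w are exact commutators, so by Jacobi's identity only the
  commutator of u with the tail of \<open>rel v w\<close> remains. The tail involves only letters on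
  the vertices of v and w, and Leibniz' rule turns its commutator with u into multiples of the
  commutation relations between u and these letters.\<close>

lemma hex_disjoint:
  assumes vw: "adj n v w" and u: "u \<in> pairs n" and disj: "verts u \<inter> (verts v \<union> verts w) = {}"
  shows "hex v w u \<in> J (dg n D v + dg n D w + dg n D u + 1)"
proof -
  \<comment> \<open>A multiplicative filtration by Leibniz' rule, so that \<open>rel_lt_lead\<close>
    reduces membership of the tail to that of single letters.\<close>
  define C where "C k = {p \<in> filt (dg n D) k. comm p (gen u) \<in> J (k + dg n D u)}" for k
  have D8: "8 * n + 2 < D" using D by simp
  have uminus: "- p \<in> C k" if "p \<in> C k" for p k
  proof -
    have "comm (- p) (gen u) = - comm p (gen u)" by (simp add: comm_def)
    with that show ?thesis by (simp add: C_def filt_uminus relspan_uminus)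
  qed
  have lead_lt: "rel v w - comm (gen v) (gen w) \<in> C (dg n D v + dg n D w + 1)"
    if vw: "adj n v w" "mx v < mx w" and disj: "verts u \<inter> (verts v \<union> verts w) = {}" for v w
  proof (rule rel_lt_lead[OF D8 vw _ _ uminus])
    show "0 \<in> C k" for k by (simp add: C_def comm_def relspan.zero)
  next
    fix k p q assume "p \<in> C k" "q \<in> C k"
    moreover have "comm (p + q) (gen u) = comm p (gen u) + comm q (gen u)"
      by (simp add: comm_def algebra_simps)
    ultimately show "p + q \<in> C k" by (auto simp: C_def intro: filt_add relspan_add)
  next
    fix i j p q assume pq: "p \<in> C i" "q \<in> C j"
    have "comm (p * q) (gen u) = p * comm q (gen u) + comm p (gen u) * q"
      by (simp add: comm_def algebra_simps)
    moreover have "p * comm q (gen u) \<in> J (i + j + dg n D u)"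
      by (rule relspan_mult_left[of _ "dg n D" i _ _ _ "j + dg n D u"]) (use pq in \<open>auto simp: C_def\<close>)
    moreover have "comm p (gen u) * q \<in> J (i + j + dg n D u)"
      by (rule relspan_mult_right[of _ _ "dg n D" _ "i + dg n D u" _ j]) (use pq in \<open>auto simp: C_def\<close>)
    ultimately show "p * q \<in> C (i + j)"
      using pq by (auto simp: C_def intro: filt_mult relspan_add)
  next
    fix i j :: nat and p assume "p \<in> C j" "i \<le> j"
    then show "p \<in> C i" by (auto simp: C_def intro: filt_mono relspan_mono)
  next
    fix z assume z: "z \<in> pairs n" "verts z \<subseteq> verts v \<union> verts w"
    then have "verts z \<inter> verts u = {}" using disj by auto
    then have "comm (gen z) (gen u) = rel z u" "adj n z u"
      using z u by (auto simp: rel_disjoint adj_disjoint)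
    then show "gen z \<in> C (dg n D z)" by (simp add: C_def gen_filt rel_in)
  qed
  have lead: "rel v w - comm (gen v) (gen w) \<in> C (dg n D v + dg n D w + 1)"
  proof (cases "mx v < mx w")
    case False
    then have "mx w < mx v" using vw by (auto simp: adj_def)
    from lead_lt[OF adj_sym[OF vw] this] disj
    have "- (rel w v - comm (gen w) (gen v)) \<in> C (dg n D v + dg n D w + 1)"
      by (intro uminus) (simp add: add.commute Un_commute)
    then show ?thesis using rel_antisym[OF vw] by (simp add: comm_def algebra_simps)
  qed (use lead_lt vw disj in simp)
  have wu: "rel w u = comm (gen w) (gen u)" and uv: "rel u v = comm (gen u) (gen v)"
    using disj by (auto intro!: rel_disjoint)
  have "hex v w u = comm (rel v w - comm (gen v) (gen w)) (gen u)"
    unfolding hex_def wu uv by (simp add: comm_def algebra_simps)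
  with lead show ?thesis by (simp add: C_def add_ac)
qed

text \<open>Either some letter is disjoint from the other two, or the triangle is connected; then x
  and y share a vertex and span a < b < c, and z attaches a new largest point d, which leaves the
  configurations of \<open>hex_connected\<close>.\<close>

lemma hex_sorted:
  assumes adj: "adj n x y" "adj n y z" "adj n x z" and lt: "mx x < mx y" "mx y < mx z"
  shows "hex x y z \<in> J (dg n D x + dg n D y + dg n D z + 1)"
proof -
  have pairs: "x \<in> pairs n" "y \<in> pairs n" "z \<in> pairs n" using adj by (auto simp: adj_def)
  consider "verts z \<inter> (verts x \<union> verts y) = {}" | "verts x \<inter> (verts y \<union> verts z) = {}"
    | "verts y \<inter> (verts z \<union> verts x) = {}"
    | "verts z \<inter> (verts x \<union> verts y) \<noteq> {}" "verts x \<inter> (verts y \<union> verts z) \<noteq> {}"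
      "verts y \<inter> (verts z \<union> verts x) \<noteq> {}" by blast
  then show ?thesis
  proof cases
    case 1
    then show ?thesis using hex_disjoint adj pairs by blast
  next
    case 2
    then show ?thesis
      using hex_disjoint[OF adj(2) pairs(1)] unfolding hex_rotate[of y z x] by (simp add: add_ac)
  next
    case 3
    then show ?thesis
      using hex_disjoint[OF adj_sym[OF adj(3)] pairs(2)] unfolding hex_rotate[of z x y] hex_rotate[of y z x]
      by (simp add: add_ac)
  next
    case 4
    obtain p d where z: "z \<in> {(p, d), (d, p)}" "p < d" "mx z = d"
    proof (cases z)
      case (Pair i j)
      then show ?thesis
        using pairs(3) that[of i j] that[of j i] by (cases "i < j") (auto simp: pairs_def mx_def)
    qed
    have d: "d \<notin> verts x" "d \<notin> verts y"
      using lt z(3) by (auto simp: verts_def mx_def split: if_splits)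
    have p: "p \<in> verts x \<union> verts y" using 4(1) z(1) d by (auto simp: verts_def)
    show ?thesis
      using adj(1) lt(1)
    proof (cases rule: adj_lt_cases)
      case 1
      \<comment> \<open>The vertex d lies beyond x and y, so z could meet both only in p; disjoint x
        and y would then share p.\<close>
      have "p \<in> verts x" "p \<in> verts y" using 4 1 z(1) d unfolding verts_def[of z] by auto
      with 1 show ?thesis by auto
    next
      case (2 a b c)
      have mx: "mx x = b" "mx y = c" using 2 by (auto simp: mx_def)
      have "c < d" "d \<le> n" using mx lt z(3) pairs(3) by (auto simp: pairs_def mx_def split: if_splits)
      moreover have "p \<in> {a, b, c}" using p 2 by (auto simp: verts_def)
      \<comment> \<open>An ascending letter starts at a root, and b and c are larger ends of x and
        y; so (a, d) is the only ascending possibility.\<close>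
      moreover have "z = (p, d) \<Longrightarrow> p \<noteq> b \<and> p \<noteq> c"
        using adj(2,3) mx z(2) by (auto simp: adj_def)
      ultimately show ?thesis using hex_connected[of a b c d] 2 z(1) by auto
    qed
  qed
qed

lemma hexagon:
  assumes "adj n x y" "adj n y z" "adj n x z"
  shows "hex x y z \<in> J (dg n D x + dg n D y + dg n D z + 1)"
proof -
  have swap: "hex x y z \<in> J (dg n D x + dg n D y + dg n D z + 1)"
    if "hex y x z \<in> J (dg n D y + dg n D x + dg n D z + 1)" "adj n x y" "adj n y z" "adj n x z" for x y z
    using relspan_uminus[OF that(1)] hex_antisym[OF that(2-4)] by (simp add: add_ac)
  have rotate: "hex x y z \<in> J (dg n D x + dg n D y + dg n D z + 1)"
    if "hex y z x \<in> J (dg n D y + dg n D z + dg n D x + 1)" for x y z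
    using that unfolding hex_rotate[of y z x] by (simp add: add_ac)
  have lt: "hex x y z \<in> J (dg n D x + dg n D y + dg n D z + 1)"
    if "mx x < mx y" and adj: "adj n x y" "adj n y z" "adj n x z" for x y z
  proof -
    have "mx x \<noteq> mx z" "mx y \<noteq> mx z" using adj by (auto simp: adj_def)
    then consider "mx y < mx z" | "mx x < mx z" "mx z < mx y" | "mx z < mx x" using that(1) by linarith
    then show ?thesis
    proof cases
      case 1
      then show ?thesis using hex_sorted that by blast
    next
      case 2
      have "hex x z y \<in> J (dg n D x + dg n D z + dg n D y + 1)"
        using hex_sorted[of x z y] 2 adj adj_sym by blast
      then have "hex z x y \<in> J (dg n D z + dg n D x + dg n D y + 1)"
        by (rule swap) (use adj adj_sym in blast)+
      then show ?thesis by (rule rotate[OF rotate])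
    next
      case 3
      have "hex z x y \<in> J (dg n D z + dg n D x + dg n D y + 1)"
        using hex_sorted[of z x y] 3 that(1) adj adj_sym by blast
      then show ?thesis by (rule rotate[OF rotate])
    qed
  qed
  show ?thesis
  proof (cases "mx x < mx y")
    case False
    then have "mx y < mx x" using assms(1) by (auto simp: adj_def)
    show ?thesis
      by (rule swap[OF lt]) (use assms adj_sym \<open>mx y < mx x\<close> in auto)
  qed (use lt assms in blast)
qed

sublocale deformed_commutators "adj n" "dg n D" rel
proof
  show "\<not> adj n x x" for x by (simp add: adj_def)
  show "rel x y - comm (gen x) (gen y) \<in> filt (dg n D) (dg n D x + dg n D y + 1)" if "adj n x y" for x y
    by (rule rel_lead) (use that D in auto)
  show "comm (rel x y) (gen z) + comm (rel y z) (gen x) + comm (rel z x) (gen y)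
      \<in> J (dg n D x + dg n D y + dg n D z + 1)" if "adj n x y" "adj n y z" "adj n x z" for x y z
    using hexagon[OF that] by (simp add: hex_def)
qed (use adj_sym rel_antisym in auto)

end

section \<open>Homogeneous components\<close>

definition homc :: "nat \<Rightarrow> 'a falg \<Rightarrow> 'a falg" where
  "homc m = alin (\<lambda>w. if length w = m then word w else 0)"

abbreviation lfilt :: "nat \<Rightarrow> 'a falg set" where
  "lfilt \<equiv> filt (\<lambda>_. Suc 0)"

lemma wt_one: "wt (\<lambda>_. Suc 0) w = length w"
  by (induction w) auto

lemma homc_add: "homc m (p + q) = homc m p + homc m q"
  by (simp add: homc_def alin_add)

lemma homc_diff: "homc m (p - q) = homc m p - homc m q"
  by (simp add: homc_def alin_diff)

lemma homc_zero [simp]: "homc m 0 = 0"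
  by (simp add: homc_def)

lemma homc_mon: "homc m (mon c w) = (if length w = m then mon c w else 0)"
  by (simp add: homc_def)

lemma homc_high: "p \<in> lfilt k \<Longrightarrow> m < k \<Longrightarrow> homc m p = 0"
  by (induction p rule: filt_induct) (auto simp: homc_add homc_mon wt_one)

lemma homc_id:
  fixes p :: "'a falg"
  assumes "\<And>w. coeff p w \<noteq> 0 \<Longrightarrow> length w = m"
  shows "homc m p = p"
proof (rule falg_induct)
  fix c w and q :: "'a falg" assume "coeff p w = c" "c \<noteq> 0" "homc m q = q"
  with assms show "homc m (mon c w + q) = mon c w + q" by (auto simp: homc_add homc_mon)
qed simp

lemma homc_mult: "homc (length a + k + length b) (mon c a * p * mon d b) = mon c a * homc k p * mon d b"
  by (induction p rule: falg_induct)
    (auto simp: homc_add homc_mon distrib_left distrib_right)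

lemma homc_length: "coeff (homc m p) w \<noteq> 0 \<Longrightarrow> length w = m"
proof (induction p rule: falg_induct)
  case (add c u p)
  then show ?case by (auto simp: homc_add homc_mon lookup_add coeff_mon split: if_splits)
qed simp

lemma wt_ge: "(\<And>x. D \<le> \<delta> x) \<Longrightarrow> length w * D \<le> wt \<delta> w"
  by (induction w) (auto simp: add_mono)

lemma wt_le: "(\<And>x. \<delta> x \<le> D) \<Longrightarrow> wt \<delta> w \<le> length w * D"
  by (induction w) (auto simp: add_mono)

lemma YB_lfilt: "YB i j k \<in> lfilt 2"
  unfolding YB_expand comm_def by (intro filt_add filt_diff) (auto simp: filt_mon)

lemma rel_lfilt: "rel x y \<in> lfilt 2"
proof -
  have "rel_lt x y \<in> lfilt 2" for x y
    by (cases x; cases y) (auto simp: comm_def filt_mon intro!: YB_lfilt filt_add filt_diff filt_uminus)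
  then show ?thesis by (auto simp: rel_def filt_uminus)
qed

context yang_baxter
begin

text \<open>The weight of a word of length k lies between k D and k (D + 4 n + 1), so that for large D the
weight filtration refines the filtration by length. The set Q stands for any additive group containing
the degree m part of the ideal generated by the quadratic forms.\<close>
theorem homogeneous_relations:
  assumes m: "m * (4 * n + 1) \<le> D"
    and hom: "\<And>w. coeff p w \<noteq> 0 \<Longrightarrow> length w = m"
    and u: "u \<in> J 0" "p - u \<in> lfilt (m + 1)"
    and Q: "0 \<in> Q" "\<And>p q. p \<in> Q \<Longrightarrow> q \<in> Q \<Longrightarrow> p + q \<in> Q"
      "\<And>a b c x y. adj n x y \<Longrightarrow> length a + 2 + length b = m \<Longrightarrow> mon c a * homc 2 (rel x y) * word b \<in> Q"
  shows "p \<in> Q"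
proof -
  have "p \<in> lfilt m" using hom by (auto simp: filt_def wt_one)
  moreover have "u = p - (p - u)" by simp
  ultimately have "u \<in> lfilt m" using filt_diff filt_mono[OF u(2)] by (metis le_add1)
  have "m * D \<le> wt (dg n D) w" if "coeff u w \<noteq> 0" for w
  proof -
    have "m \<le> length w" using \<open>u \<in> lfilt m\<close> that by (auto simp: filt_def wt_one)
    then have "m * D \<le> length w * D" by simp
    also have "\<dots> \<le> wt (dg n D) w" by (rule wt_ge) (rule dg_ge)
    finally show ?thesis .
  qed
  then have "u \<in> filt (dg n D) (m * D)" by (simp add: filt_def)
  \<comment> \<open>Strictness is used here: u becomes a combination of multiples of nominal weight
    at least m D, so no multiple shorter than m is involved any more.\<close>
  then have "u \<in> J (m * D)" by (rule relspan_filt[OF u(1)])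
  then have "homc m u \<in> Q"
  proof (induction rule: relspan.induct)
    case (step x y a b v c)
    let ?l = "length a + 2 + length b"
    have "m * D \<le> ?l * (D + (4 * n + 1))"
      using step(2) wt_le[of "dg n D" "D + (4 * n + 1)" "a @ x # y # b", OF dg_le] by simp
    \<comment> \<open>A word of length l < m weighs at most l D + l (4 n + 1), which is less than l
      D + m (4 n + 1) and so less than (l + 1) D, at most m D. This is the purpose of the bound that
      relates D and m.\<close>
    moreover have "?l * (D + (4 * n + 1)) < m * D" if "?l < m"
    proof -
      have "?l * (D + (4 * n + 1)) + D \<le> (?l + 1) * D + ?l * (4 * n + 1)" by (simp add: algebra_simps)
      also have "\<dots> \<le> m * D + ?l * (4 * n + 1)" using that by (intro add_right_mono mult_right_mono) auto
      also have "?l * (4 * n + 1) < m * (4 * n + 1)"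
        by (rule mult_strict_right_mono[OF that]) simp
      also have "m * (4 * n + 1) \<le> D" by (rule m)
      finally show ?thesis by simp
    qed
    ultimately have "m \<le> ?l" by (meson leD leI)
    have "homc m (mon c a * rel x y * word b) \<in> Q"
    proof (cases "?l = m")
      case True
      then show ?thesis using Q(3)[OF step(1) True] homc_mult[of a 2 b c "rel x y" 1] by simp
    next
      case False
      have "mon c a * rel x y * word b \<in> lfilt ?l"
        by (rule filt_mono[OF filt_mult[OF filt_mult[OF filt_mon[OF order_refl] rel_lfilt]
                filt_mon[OF order_refl]]]) (simp add: wt_one)
      then have "homc m (mon c a * rel x y * word b) = 0"
        by (rule homc_high) (use False \<open>m \<le> ?l\<close> in simp)
      then show ?thesis using Q(1) by simp
    qed
    with step.IH show ?case by (simp add: homc_add Q(2))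
  qed (simp add: Q(1))
  moreover have "homc m (p - u) = 0" by (rule homc_high[OF u(2)]) simp
  ultimately show ?thesis using homc_id[OF hom] by (simp add: homc_diff)
qed

end

section \<open>The pure virtual braid group\<close>

lemma pvb_rel_append:
  assumes "pvb_rel n u u'" "pvb_rel n v v'"
  shows "pvb_rel n (u @ v) (u' @ v')"
  using pvb_rel.cong[OF assms(1), of "[]" v] pvb_rel.cong[OF assms(2), of u' "[]"] pvb_rel.trans by fastforce

lemma pvb_class_eq_iff:
  "v \<in> lists (pvb_letters n) \<Longrightarrow> pvb_class n u = pvb_class n v \<longleftrightarrow> pvb_rel n u v"
  unfolding pvb_class_def by (blast intro: pvb_rel.refl pvb_rel.sym pvb_rel.trans)

lemma pvb_class_mem: "w \<in> lists (pvb_letters n) \<Longrightarrow> w \<in> pvb_class n w"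
  by (simp add: pvb_class_def pvb_rel.refl)

lemma PvB_mult:
  assumes "u \<in> lists (pvb_letters n)" "v \<in> lists (pvb_letters n)"
  shows "pvb_class n u \<otimes>\<^bsub>PvB n\<^esub> pvb_class n v = pvb_class n (u @ v)"
proof -
  have "(\<exists>u'\<in>pvb_class n u. \<exists>v'\<in>pvb_class n v. pvb_rel n (u' @ v') w) \<longleftrightarrow> pvb_rel n (u @ v) w" for w
  proof
    assume "\<exists>u'\<in>pvb_class n u. \<exists>v'\<in>pvb_class n v. pvb_rel n (u' @ v') w"
    then show "pvb_rel n (u @ v) w"
      unfolding pvb_class_def using pvb_rel_append pvb_rel.trans by blast
  qed (use assms pvb_class_mem in blast)
  then show ?thesis by (auto simp: PvB_def pvb_class_def)
qed

lemma PvB_carrierE: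
  assumes "X \<in> carrier (PvB n)"
  obtains w where "w \<in> lists (pvb_letters n)" "X = pvb_class n w"
  using assms by (auto simp: PvB_def)

lemma PvB_carrier: "w \<in> lists (pvb_letters n) \<Longrightarrow> pvb_class n w \<in> carrier (PvB n)"
  by (simp add: PvB_def)

lemma PvB_one: "\<one>\<^bsub>PvB n\<^esub> = pvb_class n []"
  by (simp add: PvB_def)

lemma linv_letter: "x \<in> pvb_letters n \<Longrightarrow> linv x \<in> pvb_letters n"
  by (cases x) (auto simp: pvb_letters_def)

lemma linv_linv: "linv (linv x) = x"
  by (cases x) auto

lemma pvb_rel_inverse: "w \<in> lists (pvb_letters n) \<Longrightarrow> pvb_rel n (map linv (rev w) @ w) []"
proof (induction w)
  case (Cons x w)
  have "pvb_rel n [linv x, x] []"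
    using pvb_rel.cancel[OF linv_letter, of x n] Cons.prems by (simp add: linv_linv)
  from pvb_rel.cong[OF this, of "map linv (rev w)" w] Cons show ?case
    by (auto intro: pvb_rel.trans)
qed (simp add: pvb_rel.refl)

lemma group_PvB: "group (PvB n)"
proof (rule groupI)
  show "\<one>\<^bsub>PvB n\<^esub> \<in> carrier (PvB n)" by (simp add: PvB_one PvB_carrier)
next
  fix X Y assume "X \<in> carrier (PvB n)" "Y \<in> carrier (PvB n)"
  then show "X \<otimes>\<^bsub>PvB n\<^esub> Y \<in> carrier (PvB n)"
    by (elim PvB_carrierE) (simp add: PvB_mult PvB_carrier)
next
  fix X Y Z assume "X \<in> carrier (PvB n)" "Y \<in> carrier (PvB n)" "Z \<in> carrier (PvB n)"
  then show "X \<otimes>\<^bsub>PvB n\<^esub> Y \<otimes>\<^bsub>PvB n\<^esub> Z = X \<otimes>\<^bsub>PvB n\<^esub> (Y \<otimes>\<^bsub>PvB n\<^esub> Z)"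
    by (elim PvB_carrierE) (simp add: PvB_mult)
next
  fix X assume "X \<in> carrier (PvB n)"
  then show "\<one>\<^bsub>PvB n\<^esub> \<otimes>\<^bsub>PvB n\<^esub> X = X"
    by (elim PvB_carrierE) (simp add: PvB_mult PvB_one)
next
  fix X assume "X \<in> carrier (PvB n)"
  then obtain w where w: "w \<in> lists (pvb_letters n)" "X = pvb_class n w" by (rule PvB_carrierE)
  have inv: "map linv (rev w) \<in> lists (pvb_letters n)" using w(1) linv_letter by auto
  then have "pvb_class n (map linv (rev w)) \<otimes>\<^bsub>PvB n\<^esub> X = \<one>\<^bsub>PvB n\<^esub>"
    using w pvb_rel_inverse[OF w(1)] by (simp add: PvB_mult PvB_one pvb_class_eq_iff)
  with inv show "\<exists>Y\<in>carrier (PvB n). Y \<otimes>\<^bsub>PvB n\<^esub> X = \<one>\<^bsub>PvB n\<^esub>" using PvB_carrier by blast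
qed

section \<open>The group ring modulo higher terms\<close>

definition rlift :: "('a \<Rightarrow> 'x falg) \<Rightarrow> ('a \<Rightarrow> rat) \<Rightarrow> 'x falg" where
  "rlift \<nu> f = (\<Sum>t\<in>fsupp f. mon (f t) [] * \<nu> t)"

lemma rlift_superset: "finite A \<Longrightarrow> fsupp f \<subseteq> A \<Longrightarrow> rlift \<nu> f = (\<Sum>t\<in>A. mon (f t) [] * \<nu> t)"
  unfolding rlift_def by (rule sum.mono_neutral_left) (auto simp: fsupp_def)

lemma rlift_comb:
  assumes "finite (fsupp u)" "finite (fsupp v)"
  shows "rlift \<nu> (\<lambda>z. c * u z + v z) = mon c [] * rlift \<nu> u + rlift \<nu> v"
proof -
  have fin: "finite (fsupp u \<union> fsupp v)" using assms by simp
  show ?thesis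
    using rlift_superset[OF fin fsupp_comb, of \<nu> c] rlift_superset[OF fin, of u \<nu>] rlift_superset[OF fin, of v \<nu>]
    by (simp add: sum.distrib sum_distrib_left mon_add[symmetric] distrib_right)
qed

lemma rlift_basis [simp]: "rlift \<nu> (basis_vec t) = \<nu> t"
  by (simp add: rlift_def word_Nil)

lemma rlift_zero [simp]: "rlift \<nu> (\<lambda>_. 0) = 0"
  by (simp add: rlift_def)

text \<open>A truncated Magnus expansion: the inverse of 1 + g is the geometric series cut after
  degree m, which is an inverse up to a single word of length m + 1.\<close>

fun lmap :: "nat \<Rightarrow> letter \<Rightarrow> pair falg" where
  "lmap m (i, j, b) = (if b then R i j else (\<Sum>k\<le>m. (- g i j) ^ k))"

definition wmap :: "nat \<Rightarrow> letter list \<Rightarrow> pair falg" where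
  "wmap m w = prod_list (map (lmap m) w)"

lemma wmap_simps: "wmap m [] = 1" "wmap m (x # w) = lmap m x * wmap m w" "wmap m (u @ v) = wmap m u * wmap m v"
  by (simp_all add: wmap_def)

lemma geometric_inverse:
  fixes x :: "'a::ring_1"
  shows "(1 + x) * (\<Sum>k\<le>m. (- x) ^ k) = 1 - (- x) ^ Suc m"
    and "(\<Sum>k\<le>m. (- x) ^ k) * (1 + x) = 1 - (- x) ^ Suc m"
proof -
  have c: "(- x) ^ k * x = x * (- x) ^ k" for k
    using power_commutes[of "- x" k] by simp
  show "(1 + x) * (\<Sum>k\<le>m. (- x) ^ k) = 1 - (- x) ^ Suc m"
    by (induction m) (simp_all add: algebra_simps)
  show "(\<Sum>k\<le>m. (- x) ^ k) * (1 + x) = 1 - (- x) ^ Suc m"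
    by (induction m) (simp_all add: algebra_simps c)
qed

lemma power_lfilt: "p \<in> lfilt 1 \<Longrightarrow> p ^ k \<in> lfilt k"
proof (induction k)
  case (Suc k)
  then show ?case using filt_mult[of p "\<lambda>_. Suc 0" 1 "p ^ k" k] by simp
qed simp

lemma gen_lfilt: "gen x \<in> lfilt (Suc 0)"
  by (simp add: filt_mon)

lemma lmap_lfilt: "lmap m x - 1 \<in> lfilt 1"
proof (cases x)
  case (fields i j b)
  have "(\<Sum>k\<le>m. (- g i j) ^ k) - 1 \<in> lfilt 1"
  proof (induction m)
    case (Suc m)
    have "(- g i j) ^ Suc m \<in> lfilt 1"
      by (rule filt_mono[OF power_lfilt]) (auto simp: gen_lfilt filt_uminus)
    with Suc have "((\<Sum>k\<le>m. (- g i j) ^ k) - 1) + (- g i j) ^ Suc m \<in> lfilt 1" by (intro filt_add)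
    then show ?case by (simp add: algebra_simps)
  qed simp
  then show ?thesis by (simp add: fields gen_lfilt)
qed

lemma wmap_lfilt: "wmap m w - 1 \<in> lfilt 1"
proof (induction w)
  case (Cons x w)
  have "(lmap m x - 1) * wmap m w \<in> lfilt (1 + 0)"
    by (rule filt_mult) (simp_all add: lmap_lfilt del: One_nat_def)
  with Cons have "(lmap m x - 1) * wmap m w + (wmap m w - 1) \<in> lfilt 1" by (intro filt_add) simp_all
  then show ?case by (simp add: wmap_simps algebra_simps)
qed (simp add: wmap_simps)

context yang_baxter
begin

text \<open>The ideal of the relations, enlarged by all words of length at least k. The expansion of
  the group ring makes sense modulo \<open>K (Suc m)\<close>.\<close>

definition K :: "nat \<Rightarrow> pair falg set" where
  "K k = {p. \<exists>u\<in>J 0. p - u \<in> lfilt k}"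

lemma K_J: "u \<in> J 0 \<Longrightarrow> u \<in> K k"
  unfolding K_def by (intro CollectI bexI[of _ u]) simp_all

lemma K_lfilt: "q \<in> lfilt k \<Longrightarrow> q \<in> K k"
  unfolding K_def using relspan.zero by force

lemma K_zero: "0 \<in> K k"
  by (rule K_lfilt) simp

lemma K_add: "p \<in> K k \<Longrightarrow> q \<in> K k \<Longrightarrow> p + q \<in> K k"
proof -
  assume "p \<in> K k" "q \<in> K k"
  then obtain u v where "u \<in> J 0" "v \<in> J 0" "p - u \<in> lfilt k" "q - v \<in> lfilt k" by (auto simp: K_def)
  then have "u + v \<in> J 0" "(p - u) + (q - v) \<in> lfilt k" by (auto intro: relspan_add filt_add)
  moreover have "(p - u) + (q - v) = (p + q) - (u + v)" by simp
  ultimately show ?thesis unfolding K_def by (intro CollectI bexI[of _ "u + v"]) simp_all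
qed

text \<open>With ideal elements u and v approximating p and q, the product p q differs from (p - u)
  (q - v) by an element of the ideal, and lengths add in the latter. As \<open>K 0\<close> is
  everything, each \<open>K k\<close> is a two-sided ideal.\<close>

lemma K_mult: "p \<in> K i \<Longrightarrow> q \<in> K j \<Longrightarrow> p * q \<in> K (i + j)"
proof -
  assume "p \<in> K i" "q \<in> K j"
  then obtain u v where uv: "u \<in> J 0" "v \<in> J 0" "p - u \<in> lfilt i" "q - v \<in> lfilt j" by (auto simp: K_def)
  have "u * q \<in> J 0" by (rule relspan_mult_right[OF uv(1) filt_0]) simp
  moreover have "(p - u) * v \<in> J 0" by (rule relspan_mult_left[OF filt_0 uv(2)]) simp
  ultimately have "u * q + (p - u) * v \<in> J 0" by (rule relspan_add)
  moreover have "p * q - (u * q + (p - u) * v) = (p - u) * (q - v)" by (simp add: algebra_simps)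
  then have "p * q - (u * q + (p - u) * v) \<in> lfilt (i + j)" using filt_mult[OF uv(3,4)] by simp
  ultimately show ?thesis unfolding K_def by blast
qed

lemma K_top: "p \<in> K 0"
  by (rule K_lfilt) simp

lemma K_mult_left: "q \<in> K k \<Longrightarrow> p * q \<in> K k"
  using K_mult[OF K_top, of q k p] by simp

lemma K_mult_right: "p \<in> K k \<Longrightarrow> p * q \<in> K k"
  using K_mult[OF _ K_top, of p k q] by simp

lemma K_uminus: "p \<in> K k \<Longrightarrow> - p \<in> K k"
  using K_mult_left[of p k "-1"] by simp

lemma K_diff: "p \<in> K k \<Longrightarrow> q \<in> K k \<Longrightarrow> p - q \<in> K k"
  using K_add[OF _ K_uminus, of p k q] by simp

lemma K_mono: "p \<in> K k \<Longrightarrow> l \<le> k \<Longrightarrow> p \<in> K l"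
  unfolding K_def using filt_mono by blast

lemma K_trans: "p - q \<in> K k \<Longrightarrow> q - r \<in> K k \<Longrightarrow> p - r \<in> K k"
  using K_add[of "p - q" k "q - r"] by simp

text \<open>The braid relations go to generators of the ideal; cancellation of a letter with its
  inverse leaves the remainder of the geometric series, a word of length m + 1.\<close>

lemma wmap_rel: "pvb_rel n u v \<Longrightarrow> wmap m u - wmap m v \<in> K (Suc m)"
proof (induction rule: pvb_rel.induct)
  case (refl w)
  show ?case by (simp add: K_zero)
next
  case (sym u v)
  from K_uminus[OF sym.IH] show ?case by simp
next
  case (trans u v w)
  from K_trans[OF trans.IH] show ?case .
next
  case (cong u v a b)
  have "wmap m a * ((wmap m u - wmap m v) * wmap m b) \<in> K (Suc m)"
    by (intro K_mult_left K_mult_right cong.IH)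
  then show ?case by (simp add: wmap_simps algebra_simps)
next
  case (cancel x)
  obtain i j b where x: "x = (i, j, b)" by (cases x) blast
  have "(- g i j) ^ Suc m \<in> lfilt (Suc m)" by (rule power_lfilt) (simp add: filt_uminus gen_lfilt)
  then have "- ((- g i j) ^ Suc m) \<in> K (Suc m)" by (intro K_uminus K_lfilt)
  moreover have "wmap m [x, linv x] - wmap m [] = - ((- g i j) ^ Suc m)"
    using geometric_inverse[of "g i j" m] by (cases b) (simp_all add: x wmap_simps)
  ultimately show ?case by simp
next
  case (rel3 i j k)
  have "YB i j k \<in> J 0" by (rule relspan_mono[OF YB_in[OF rel3]]) simp
  then show ?case by (intro K_J) (simp add: wmap_simps YB_def mult.assoc)
next
  case (rel4 i j k l)
  have "comm (g i j) (g k l) \<in> J 0" by (rule relspan_mono[OF comm_disjoint_in[OF rel4]]) simp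
  then show ?case by (intro K_J) (simp add: wmap_simps comm_def algebra_simps)
qed

text \<open>The value depends on the chosen representative, but by \<open>wmap_rel\<close> only
  modulo \<open>K (Suc m)\<close>; multiplicativity and compatibility with evaluation are therefore
  stated as congruences.\<close>

definition cmap :: "nat \<Rightarrow> letter list set \<Rightarrow> pair falg" where
  "cmap m X = wmap m (SOME w. w \<in> X)"

lemma cmap_class:
  assumes "w \<in> lists (pvb_letters n)"
  shows "cmap m (pvb_class n w) - wmap m w \<in> K (Suc m)"
proof -
  have "\<exists>u. u \<in> pvb_class n w" using pvb_class_mem[OF assms] ..
  then have "(SOME u. u \<in> pvb_class n w) \<in> pvb_class n w" by (rule someI_ex)
  then have "pvb_rel n (SOME u. u \<in> pvb_class n w) w" by (simp add: pvb_class_def pvb_rel.sym)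
  then show ?thesis unfolding cmap_def by (rule wmap_rel)
qed

lemma cmap_mult:
  assumes "X \<in> carrier (PvB n)" "Y \<in> carrier (PvB n)"
  shows "cmap m (X \<otimes>\<^bsub>PvB n\<^esub> Y) - cmap m X * cmap m Y \<in> K (Suc m)"
proof -
  obtain u v where u: "u \<in> lists (pvb_letters n)" "X = pvb_class n u"
    and v: "v \<in> lists (pvb_letters n)" "Y = pvb_class n v"
    using assms by (elim PvB_carrierE)
  have "cmap m (X \<otimes>\<^bsub>PvB n\<^esub> Y) - wmap m u * wmap m v \<in> K (Suc m)"
    using cmap_class[of "u @ v" m] u v by (simp add: PvB_mult wmap_simps)
  moreover have "(cmap m X - wmap m u) * cmap m Y + wmap m u * (cmap m Y - wmap m v) \<in> K (Suc m)"
    unfolding u(2) v(2) by (intro K_add K_mult_left K_mult_right cmap_class u v)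
  ultimately have "cmap m (X \<otimes>\<^bsub>PvB n\<^esub> Y) - wmap m u * wmap m v
      - ((cmap m X - wmap m u) * cmap m Y + wmap m u * (cmap m Y - wmap m v)) \<in> K (Suc m)" by (rule K_diff)
  then show ?thesis by (simp add: algebra_simps)
qed

lemma cmap_lfilt: "cmap m X - 1 \<in> K 1"
  unfolding cmap_def by (rule K_lfilt[OF wmap_lfilt])

lemma rlift_grp_ring_comb:
  "u \<in> grp_ring (PvB n) \<Longrightarrow> v \<in> grp_ring (PvB n) \<Longrightarrow>
    rlift \<nu> (\<lambda>z. c * u z + v z) = mon c [] * rlift \<nu> u + rlift \<nu> v"
  by (simp add: rlift_comb grp_ring_def)

lemma rlift_conv:
  assumes "f \<in> grp_ring (PvB n)" "h \<in> grp_ring (PvB n)"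
  shows "rlift (cmap m) (conv (PvB n) f h) - rlift (cmap m) f * rlift (cmap m) h \<in> K (Suc m)"
proof -
  interpret group "PvB n" by (rule group_PvB)
  let ?F = "rlift (cmap m)" and ?c = "conv (PvB n)"
  show ?thesis
    using assms(1)
  proof (induction f rule: grp_ring_induct)
    case (comb c X v)
    note X = grp_ring_basis[OF comb(1)]
    have "?F (?c (basis_vec X) h) - cmap m X * ?F h \<in> K (Suc m)"
      using assms(2)
    proof (induction h rule: grp_ring_induct)
      case (comb d Y w)
      note Y = grp_ring_basis[OF comb(1)]
      have "mon d [] * (cmap m (X \<otimes>\<^bsub>PvB n\<^esub> Y) - cmap m X * cmap m Y) + (?F (?c (basis_vec X) w) - cmap m X * ?F w)
          \<in> K (Suc m)"
        by (intro K_add K_mult_left cmap_mult comb) fact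
      moreover have "cmap m X * (mon d [] * cmap m Y) = mon d [] * (cmap m X * cmap m Y)"
        by (metis mon_Nil_commute mult.assoc)
      moreover have "?F (?c (basis_vec X) (\<lambda>z. d * basis_vec Y z + w z))
          = mon d [] * cmap m (X \<otimes>\<^bsub>PvB n\<^esub> Y) + ?F (?c (basis_vec X) w)"
        "?F (\<lambda>z. d * basis_vec Y z + w z) = mon d [] * cmap m Y + ?F w"
        using comb X Y \<open>X \<in> carrier (PvB n)\<close>
        by (simp_all add: conv_comb_right conv_basis rlift_grp_ring_comb conv_closed grp_ring_basis)
      ultimately show ?case by (simp add: algebra_simps)
    qed (simp add: K_zero)
    then have "mon c [] * (?F (?c (basis_vec X) h) - cmap m X * ?F h) + (?F (?c v h) - ?F v * ?F h) \<in> K (Suc m)"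
      by (intro K_add K_mult_left comb)
    moreover have "?F (?c (\<lambda>z. c * basis_vec X z + v z) h) = mon c [] * ?F (?c (basis_vec X) h) + ?F (?c v h)"
      "?F (\<lambda>z. c * basis_vec X z + v z) = mon c [] * cmap m X + ?F v"
      using comb X assms(2) by (simp_all add: conv_comb_left rlift_grp_ring_comb conv_closed)
    ultimately show ?case by (simp add: algebra_simps)
  qed (simp add: K_zero)
qed

text \<open>Every group element expands to 1 modulo \<open>K 1\<close>, so the expansion of a group
  ring element is congruent to its augmentation.\<close>

lemma rlift_aug_ideal:
  assumes "f \<in> aug_ideal (PvB n)"
  shows "rlift (cmap m) f \<in> K 1"
proof -
  interpret group "PvB n" by (rule group_PvB)
  have "f \<in> grp_ring (PvB n)" using assms by (rule aug_ideal_grp_ring)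
  then have "rlift (cmap m) f - mon (augmentation f) [] \<in> K 1"
  proof (induction f rule: grp_ring_induct)
    case (comb c X v)
    have "mon c [] * (cmap m X - 1) + (rlift (cmap m) v - mon (augmentation v) []) \<in> K 1"
      by (intro K_add K_mult_left cmap_lfilt comb)
    moreover have "rlift (cmap m) (\<lambda>z. c * basis_vec X z + v z) = mon c [] * cmap m X + rlift (cmap m) v"
      "mon (augmentation (\<lambda>z. c * basis_vec X z + v z)) [] = mon c [] + (mon (augmentation v) [] :: pair falg)"
      using comb by (simp_all add: rlift_grp_ring_comb grp_ring_basis augmentation_comb augmentation_basis
          mon_add)
    ultimately show ?case by (simp add: algebra_simps)
  qed (simp add: K_zero augmentation_zero)
  then show ?thesis using assms by (simp add: aug_ideal_def)
qed

text \<open>Each factor contributes one degree by \<open>rlift_aug_ideal\<close>. The expansion is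
  multiplicative only up to \<open>K (Suc m)\<close>, hence the bound on the number of
  factors.\<close>

lemma rlift_gprod:
  assumes "set xs \<subseteq> aug_ideal (PvB n)" "length xs \<le> Suc m"
  shows "rlift (cmap m) (gprod (PvB n) xs) \<in> K (length xs)"
proof -
  interpret group "PvB n" by (rule group_PvB)
  show ?thesis
    using assms
  proof (induction xs)
    case (Cons f xs)
    let ?F = "rlift (cmap m)"
    have f: "f \<in> aug_ideal (PvB n)" and xs: "set xs \<subseteq> grp_ring (PvB n)"
      using Cons.prems aug_ideal_grp_ring by auto
    have "?F (conv (PvB n) f (gprod (PvB n) xs)) - ?F f * ?F (gprod (PvB n) xs) \<in> K (length (f # xs))"
      by (rule K_mono[OF rlift_conv[of f "gprod (PvB n) xs" m]])
        (use f xs Cons.prems aug_ideal_grp_ring gprod_closed in auto)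
    moreover have "?F f * ?F (gprod (PvB n) xs) \<in> K (1 + length xs)"
      by (rule K_mult[OF rlift_aug_ideal[OF f] Cons.IH]) (use Cons.prems in auto)
    then have "?F f * ?F (gprod (PvB n) xs) \<in> K (length (f # xs))" by simp
    ultimately show ?case using K_add by fastforce
  qed (simp add: K_top)
qed

lemma rlift_aug_pow:
  assumes "f \<in> aug_pow (PvB n) (Suc m)"
  shows "rlift (cmap m) f \<in> K (Suc m)"
proof -
  interpret group "PvB n" by (rule group_PvB)
  from assms have "f \<in> qspan {gprod (PvB n) xs | xs. length xs = Suc m \<and> set xs \<subseteq> aug_ideal (PvB n)}"
    by (simp add: aug_pow_def)
  then have "f \<in> grp_ring (PvB n) \<and> rlift (cmap m) f \<in> K (Suc m)"
  proof (induction rule: qspan.induct)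
    case (qspan_add y v c)
    then obtain xs where xs: "y = gprod (PvB n) xs" "length xs = Suc m" "set xs \<subseteq> aug_ideal (PvB n)" by blast
    then have "y \<in> grp_ring (PvB n)" using gprod_closed[of xs] aug_ideal_grp_ring by blast
    moreover have "rlift (cmap m) y \<in> K (Suc m)" using rlift_gprod[of xs m] xs by simp
    ultimately show ?case
      using qspan_add.IH by (simp add: rlift_grp_ring_comb grp_ring_comb K_add K_mult_left)
  qed (simp add: K_zero grp_ring_zero)
  then show ?thesis ..
qed

end

section \<open>Quadraticity\<close>

text \<open>The element R_ij - 1. The value 0 outside \<open>pairs n\<close> keeps the whole range
  inside the augmentation ideal, as evaluation of polynomials in all letters of the type
  demands.\<close>

definition xgen :: "nat \<Rightarrow> pair \<Rightarrow> letter list set \<Rightarrow> rat" where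
  "xgen n l = (if l \<in> pairs n then
      (\<lambda>z. basis_vec (pvb_class n [(fst l, snd l, True)]) z - basis_vec \<one>\<^bsub>PvB n\<^esub> z) else (\<lambda>_. 0))"

lemma basis_minus_one_aug_ideal:
  assumes "X \<in> carrier (PvB n)"
  shows "(\<lambda>z. basis_vec X z - basis_vec \<one>\<^bsub>PvB n\<^esub> z) \<in> aug_ideal (PvB n)"
proof -
  interpret group "PvB n" by (rule group_PvB)
  have "basis_vec X \<in> grp_ring (PvB n)" "basis_vec \<one>\<^bsub>PvB n\<^esub> \<in> grp_ring (PvB n)"
    using assms by (auto intro: grp_ring_basis)
  then show ?thesis
    using augmentation_comb[of "basis_vec \<one>\<^bsub>PvB n\<^esub>" "basis_vec X" "-1"]
      grp_ring_comb[of "basis_vec \<one>\<^bsub>PvB n\<^esub>" "PvB n" "basis_vec X" "-1"]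
    by (simp add: aug_ideal_def augmentation_basis)
qed

lemma letter_class: "l \<in> pairs n \<Longrightarrow> [(fst l, snd l, b)] \<in> lists (pvb_letters n)"
  by (auto simp: pairs_def pvb_letters_def)

lemma xgen_aug_ideal: "range (xgen n) \<subseteq> aug_ideal (PvB n)"
proof -
  interpret group "PvB n" by (rule group_PvB)
  show ?thesis
    using basis_minus_one_aug_ideal PvB_carrier letter_class by (auto simp: xgen_def aug_ideal_zero)
qed

lemma ev_R:
  assumes "(i, j) \<in> pairs n"
  shows "group.ev (PvB n) (xgen n) (R i j) = basis_vec (pvb_class n [(i, j, True)])"
proof -
  interpret group "PvB n" by (rule group_PvB)
  have "xgen n (i, j) \<in> grp_ring (PvB n)" using xgen_aug_ideal aug_ideal_grp_ring by blast
  then have "ev (xgen n) (g i j) = xgen n (i, j)" by (simp add: ev_mon conv_one)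
  then show ?thesis using assms by (simp add: ev_add ev_one xgen_def)
qed

text \<open>Since 1 + g evaluates to the group element R_ij, both products in a Yang-Baxter or
  commutation relation evaluate to the same group element.\<close>

lemma ev_rel:
  assumes "adj n x y"
  shows "group.ev (PvB n) (xgen n) (rel x y) = (\<lambda>_. 0)"
proof -
  interpret group "PvB n" by (rule group_PvB)
  note mult = ev_mult[OF xgen_aug_ideal]
  have letter: "[(i, j, True)] \<in> lists (pvb_letters n)" if "(i, j) \<in> pairs n" for i j
    using letter_class[OF that] by simp
  have YB: "ev (xgen n) (YB i j k) = (\<lambda>_. 0)" if "{i, j, k} \<subseteq> {1..n}" "distinct [i, j, k]" for i j k
  proof -
    have p: "(i, j) \<in> pairs n" "(i, k) \<in> pairs n" "(j, k) \<in> pairs n" using that by (auto simp: pairs_def)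
    note l = p[THEN letter]
    have "ev (xgen n) (R i j * R i k * R j k) = basis_vec (pvb_class n [(i, j, True), (i, k, True), (j, k, True)])"
      using l by (simp add: mult ev_R p conv_basis PvB_carrier PvB_mult)
    moreover have "ev (xgen n) (R j k * R i k * R i j) = basis_vec (pvb_class n [(j, k, True), (i, k, True), (i, j, True)])"
      using l by (simp add: mult ev_R p conv_basis PvB_carrier PvB_mult)
    moreover have "pvb_class n [(i, j, True), (i, k, True), (j, k, True)]
        = pvb_class n [(j, k, True), (i, k, True), (i, j, True)]"
      using l pvb_rel.rel3[OF that] by (subst pvb_class_eq_iff) auto
    ultimately show ?thesis by (simp only: YB_def ev_diff) simp
  qed
  have comm: "ev (xgen n) (comm (g i j) (g k l)) = (\<lambda>_. 0)" if "{i, j, k, l} \<subseteq> {1..n}" "distinct [i, j, k, l]" for i j k l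
  proof -
    have p: "(i, j) \<in> pairs n" "(k, l) \<in> pairs n" using that by (auto simp: pairs_def)
    note l = p[THEN letter]
    have "ev (xgen n) (R i j * R k l) = basis_vec (pvb_class n [(i, j, True), (k, l, True)])"
      using l by (simp add: mult ev_R p conv_basis PvB_carrier PvB_mult)
    moreover have "ev (xgen n) (R k l * R i j) = basis_vec (pvb_class n [(k, l, True), (i, j, True)])"
      using l by (simp add: mult ev_R p conv_basis PvB_carrier PvB_mult)
    moreover have "pvb_class n [(i, j, True), (k, l, True)] = pvb_class n [(k, l, True), (i, j, True)]"
      using l pvb_rel.rel4[OF that] by (subst pvb_class_eq_iff) auto
    moreover have "comm (g i j) (g k l) = R i j * R k l - R k l * R i j" by (simp add: comm_def algebra_simps)
    ultimately show ?thesis by (simp only: ev_diff) simp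
  qed
  have lt: "ev (xgen n) (rel x y) = (\<lambda>_. 0)" if "adj n x y" "mx x < mx y" for x y
    using that
  proof (cases rule: adj_lt_cases)
    case 1
    have "x \<in> pairs n" "y \<in> pairs n" using that(1) by (simp_all add: adj_def)
    then have "{fst x, snd x, fst y, snd y} \<subseteq> {1..n}" "distinct [fst x, snd x, fst y, snd y]"
      using 1 by (cases x; cases y; simp add: pairs_def verts_def)+
    from comm[OF this] 1 show ?thesis by (simp add: rel_disjoint)
  next
    case (2 a b c)
    have neg: "ev (xgen n) (- p) = (\<lambda>z. - ev (xgen n) p z)" for p
      using ev_diff[of "xgen n" 0 p] by simp
    have Y: "ev (xgen n) (YB i j k) = (\<lambda>_. 0)" if "{i, j, k} \<subseteq> {a, b, c}" "distinct [i, j, k]" for i j k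
      by (rule YB) (use that 2(1-4) in auto)
    have "rel x y \<in> {YB a b c, YB a b c + YB a c b, - YB c a b, YB b a c, - (YB c b a + YB b c a), YB b c a}"
      using 2 by (auto simp: rel_def mx_def)
    moreover have "distinct [a, b, c]" using 2 by simp
    ultimately show ?thesis by (elim insertE emptyE) (simp_all only: neg ev_add, simp_all add: Y)
  qed
  show ?thesis
  proof (cases "mx x < mx y")
    case False
    then have "mx y < mx x" using assms by (auto simp: adj_def)
    from lt[OF adj_sym[OF assms] this] show ?thesis
      using rel_antisym[OF assms] ev_diff[of "xgen n" 0 "rel y x"] by simp
  qed (use lt assms in simp)
qed

lemma lfilt_minus_homc: "p \<in> lfilt k \<Longrightarrow> p - homc k p \<in> lfilt (Suc k)"
proof (induction p rule: filt_induct)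
  case (add c w p)
  have "mon c w - homc k (mon c w) \<in> lfilt (Suc k)"
    using add(1) by (auto simp: homc_mon wt_one intro: filt_mon)
  from filt_add[OF this add(2)] show ?case by (simp add: homc_add algebra_simps)
qed simp

text \<open>The whole relation evaluates to 0, so its quadratic part evaluates to minus the tail,
  whose words have length at least 3.\<close>

lemma ev_homc_rel:
  assumes "adj n x y"
  shows "group.ev (PvB n) (xgen n) (homc 2 (rel x y)) \<in> aug_pow (PvB n) 3"
proof -
  interpret group "PvB n" by (rule group_PvB)
  have "rel x y - homc 2 (rel x y) \<in> lfilt (Suc 2)" by (rule lfilt_minus_homc[OF rel_lfilt])
  then have "ev (xgen n) (rel x y - homc 2 (rel x y)) \<in> aug_pow (PvB n) (Suc 2)"
    by (rule ev_lfilt[OF xgen_aug_ideal])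
  then have "ev (xgen n) (rel x y - homc 2 (rel x y)) \<in> aug_pow (PvB n) 3" by (simp add: numeral_3_eq_3 numeral_2_eq_2)
  from aug_pow_diff[OF aug_pow_zero this] show ?thesis by (simp add: ev_diff ev_rel[OF assms])
qed

text \<open>For group elements, uv - 1 = (u - 1) + (v - 1) + (u - 1) (v - 1), so u - 1 depends
  additively on u modulo I^2. Hence the letters span I/I^2, and an inverse letter contributes the
  negative of the letter.\<close>

lemma aug_ideal_generators: "aug_ideal (PvB n) \<subseteq> qspan (xgen n ` pairs n \<union> aug_pow (PvB n) 2)"
proof -
  interpret group "PvB n" by (rule group_PvB)
  let ?S = "qspan (xgen n ` pairs n \<union> aug_pow (PvB n) 2)"
  let ?e = "basis_vec \<one>\<^bsub>PvB n\<^esub> :: letter list set \<Rightarrow> rat"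
  define d where "d w = (\<lambda>z. basis_vec (pvb_class n w) z - ?e z)" for w
  have d: "d w \<in> aug_ideal (PvB n)" if "w \<in> lists (pvb_letters n)" for w
    unfolding d_def by (rule basis_minus_one_aug_ideal[OF PvB_carrier[OF that]])
  have d_mult: "(\<lambda>z. d (u @ v) z - d u z - d v z) \<in> aug_pow (PvB n) 2"
    if "u \<in> lists (pvb_letters n)" "v \<in> lists (pvb_letters n)" for u v
  proof -
    let ?u = "basis_vec (pvb_class n u) :: letter list set \<Rightarrow> rat"
    let ?v = "basis_vec (pvb_class n v) :: letter list set \<Rightarrow> rat"
    have gr: "?u \<in> grp_ring (PvB n)" "?v \<in> grp_ring (PvB n)" "?e \<in> grp_ring (PvB n)"
      "d u \<in> grp_ring (PvB n)" "d v \<in> grp_ring (PvB n)"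
      using that d PvB_carrier by (auto intro: grp_ring_basis aug_ideal_grp_ring)
    have "conv (PvB n) (d u) (d v) \<in> aug_pow (PvB n) 2"
      using aug_pow_gprod[of "[d u, d v]" 2] d that gr by (simp add: conv_one)
    moreover have "conv (PvB n) (d u) (d v) = (\<lambda>z. d (u @ v) z - d u z - d v z)"
    proof -
      have du: "d u = (\<lambda>z. -1 * ?e z + ?u z)" and dv: "d v = (\<lambda>z. -1 * ?e z + ?v z)"
        by (simp_all add: d_def)
      have "conv (PvB n) (d u) (d v) = (\<lambda>z. -1 * d v z + conv (PvB n) ?u (d v) z)"
        by (subst du) (simp only: conv_comb_left gr conv_one)
      also have "conv (PvB n) ?u (d v) = (\<lambda>z. -1 * ?u z + basis_vec (pvb_class n (u @ v)) z)"
        using that by (subst dv) (simp only: conv_comb_right gr conv_one conv_basis PvB_carrier PvB_mult)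
      finally show ?thesis by (simp add: d_def fun_eq_iff)
    qed
    ultimately show ?thesis by simp
  qed
  have sq: "f \<in> ?S" if "f \<in> aug_pow (PvB n) 2" for f
    using that by (intro qspan_base) simp
  have mult: "d (u @ v) \<in> ?S"
    if "u \<in> lists (pvb_letters n)" "v \<in> lists (pvb_letters n)" "d u \<in> ?S" "d v \<in> ?S" for u v
    using qspan_plus[OF qspan_plus[OF sq[OF d_mult[OF that(1,2)]] that(3)] that(4)] by simp
  have d_Nil: "d [] = (\<lambda>_. 0)" by (simp add: d_def PvB_one)
  have pos: "d [(i, j, True)] \<in> ?S" if "(i, j) \<in> pairs n" for i j
  proof -
    have "d [(i, j, True)] = xgen n (i, j)" using that by (simp add: d_def xgen_def)
    then show ?thesis using that by (intro qspan_base) auto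
  qed
  have letter: "d [x] \<in> ?S" if x: "x \<in> pvb_letters n" for x
  proof (cases x)
    case (fields i j b)
    have ij: "(i, j) \<in> pairs n" using x fields by (auto simp: pairs_def pvb_letters_def)
    show ?thesis
    proof (cases b)
      case False
      have l: "[(i, j, c)] \<in> lists (pvb_letters n)" for c using letter_class[OF ij] by simp
      have "pvb_class n ([(i, j, True)] @ [(i, j, False)]) = pvb_class n []"
        using pvb_rel.cancel[of "(i, j, True)" n] l[of True] by (subst pvb_class_eq_iff) auto
      then have "d ([(i, j, True)] @ [(i, j, False)]) = (\<lambda>_. 0)" by (simp add: d_def PvB_one)
      with d_mult[OF l[of True] l[of False]]
      have "(\<lambda>z. - d [(i, j, True)] z - d [(i, j, False)] z) \<in> ?S" by (intro sq) simp
      from qspan_scale[OF qspan_plus[OF this pos[OF ij]], of "-1"] show ?thesis using False fields by simp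
    qed (use pos[OF ij] fields in simp)
  qed
  have word: "d w \<in> ?S" if "w \<in> lists (pvb_letters n)" for w
    using that
  proof (induction w)
    case (Cons x w)
    then have "x \<in> pvb_letters n" "w \<in> lists (pvb_letters n)" by auto
    then show ?case using mult[of "[x]" w] letter Cons.IH by simp
  qed (simp add: d_Nil qspan_zero)
  have "(\<lambda>z. f z - augmentation f * ?e z) \<in> ?S" if "f \<in> grp_ring (PvB n)" for f
    using that
  proof (induction f rule: grp_ring_induct)
    case (comb c X v)
    obtain w where w: "w \<in> lists (pvb_letters n)" "X = pvb_class n w" using comb(1) by (rule PvB_carrierE)
    from qspan_plus[OF qspan_scale[OF word[OF w(1)], of c] comb(3)]
    have "(\<lambda>z. c * (basis_vec X z - ?e z) + (v z - augmentation v * ?e z)) \<in> ?S"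
      unfolding w(2) d_def .
    moreover have "augmentation (\<lambda>z. c * basis_vec X z + v z) = c + augmentation v"
      using comb(1,2) by (simp add: augmentation_comb grp_ring_basis augmentation_basis)
    ultimately show ?case by (simp add: algebra_simps)
  qed (simp add: augmentation_zero qspan_zero)
  then show ?thesis by (auto simp: aug_ideal_def) fastforce
qed

context yang_baxter
begin

text \<open>Expansion undoes evaluation: R_ij - 1 returns to its letter, and products are respected
  modulo \<open>K (Suc m)\<close>. Together with \<open>rlift_aug_pow\<close> this shows that a
  polynomial with value in I^(m+1) comes from the relations up to words longer than m.\<close>

lemma rlift_ev:
  assumes "p \<in> words_in (pairs n) m"
  shows "rlift (cmap m) (group.ev (PvB n) (xgen n) p) - p \<in> K (Suc m)"
proof -
  interpret group "PvB n" by (rule group_PvB)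
  let ?F = "rlift (cmap m)"
  have gr: "xgen n l \<in> grp_ring (PvB n)" for l using xgen_aug_ideal aug_ideal_grp_ring by blast
  have x: "?F (xgen n l) - gen l \<in> K (Suc m)" if l: "l \<in> pairs n" for l
  proof -
    let ?X = "pvb_class n [(fst l, snd l, True)]"
    have c: "?X \<in> carrier (PvB n)" by (rule PvB_carrier[OF letter_class[OF l]])
    have "xgen n l = (\<lambda>z. -1 * basis_vec \<one>\<^bsub>PvB n\<^esub> z + basis_vec ?X z)" using l by (simp add: xgen_def)
    then have "?F (xgen n l) = mon (-1) [] * cmap m \<one>\<^bsub>PvB n\<^esub> + cmap m ?X"
      using c by (simp only: rlift_grp_ring_comb grp_ring_basis one_closed rlift_basis)
    then have "?F (xgen n l) - gen l = (cmap m ?X - wmap m [(fst l, snd l, True)]) - (cmap m (pvb_class n []) - wmap m [])"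
      by (simp add: PvB_one wmap_simps mon_uminus[symmetric] word_Nil)
    then show ?thesis using K_diff[OF cmap_class cmap_class] letter_class[OF l] by simp
  qed
  have w: "?F (gprod (PvB n) (map (xgen n) w)) - word w \<in> K (Suc m)" if "set w \<subseteq> pairs n" for w
    using that
  proof (induction w)
    case Nil
    show ?case using cmap_class[of "[]" m] by (simp add: PvB_one wmap_simps word_Nil)
  next
    case (Cons l w)
    let ?p = "gprod (PvB n) (map (xgen n) w)"
    have p: "?p \<in> grp_ring (PvB n)" using gr by (intro gprod_closed) auto
    have "(?F (conv (PvB n) (xgen n l) ?p) - ?F (xgen n l) * ?F ?p) + (?F (xgen n l) - gen l) * ?F ?p
        + gen l * (?F ?p - word w) \<in> K (Suc m)"
      by (intro K_add rlift_conv gr p K_mult_left K_mult_right x Cons.IH) (use Cons.prems in auto)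
    then show ?case by (simp add: algebra_simps)
  qed
  show ?thesis
  proof (rule falg_induct[of "\<lambda>q. ?F (ev (xgen n) q) - q \<in> K (Suc m)" p])
    fix c u q
    assume u: "coeff p u = c" "c \<noteq> 0" and IH: "?F (ev (xgen n) q) - q \<in> K (Suc m)"
    have "set u \<subseteq> pairs n" using assms u by (auto simp: words_in_def)
    then have "mon c [] * (?F (gprod (PvB n) (map (xgen n) u)) - word u) + (?F (ev (xgen n) q) - q) \<in> K (Suc m)"
      by (intro K_add K_mult_left w IH)
    moreover have "?F (ev (xgen n) (mon c u + q)) = mon c [] * ?F (gprod (PvB n) (map (xgen n) u)) + ?F (ev (xgen n) q)"
      unfolding ev_add ev_mon
      by (intro rlift_grp_ring_comb ev_closed xgen_aug_ideal gprod_closed) (use gr in auto)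
    ultimately show "?F (ev (xgen n) (mon c u + q)) - (mon c u + q) \<in> K (Suc m)" by (simp add: algebra_simps)
  qed (simp add: K_zero)
qed

lemma ev_aug_pow_imp:
  assumes "p \<in> words_in (pairs n) m" "group.ev (PvB n) (xgen n) p \<in> aug_pow (PvB n) (Suc m)"
  shows "p \<in> K (Suc m)"
  using K_diff[OF rlift_aug_pow[OF assms(2)] rlift_ev[OF assms(1)]] by simp

end

theorem theorem5p1:
  fixes n :: nat
  shows "quadratic_group (PvB n)"
proof -
  interpret group "PvB n" by (rule group_PvB)
  show ?thesis
  proof (rule quadratic_groupI[OF xgen_aug_ideal aug_ideal_generators,
        where Q = "{homc 2 (rel x y) | x y. adj n x y}"])
    fix q assume "q \<in> {homc 2 (rel x y) | x y. adj n x y}"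
    then show "q \<in> words_in UNIV 2 \<and> ev (xgen n) q \<in> aug_pow (PvB n) 3"
      using ev_homc_rel by (auto simp: words_in_def dest: homc_length)
  next
    fix m p and P :: "pair falg set"
    assume p: "p \<in> words_in (pairs n) m" "ev (xgen n) p \<in> aug_pow (PvB n) (Suc m)"
      and P: "0 \<in> P" "\<And>p q. p \<in> P \<Longrightarrow> q \<in> P \<Longrightarrow> p + q \<in> P"
        "\<And>a b c q. q \<in> {homc 2 (rel x y) | x y. adj n x y} \<Longrightarrow> length a + 2 + length b = m
          \<Longrightarrow> mon c a * q * word b \<in> P"
    \<comment> \<open>D is the sum of 12 n + 4, for the bound of the locale, and m (4 n + 1), for
      the bound of \<open>homogeneous_relations\<close>.\<close>
    interpret Y: yang_baxter n "12 * n + 4 + m * (4 * n + 1)" by standard simp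
    obtain u where u: "u \<in> Y.J 0" "p - u \<in> lfilt (m + 1)"
      using Y.ev_aug_pow_imp[OF p] unfolding Y.K_def by auto
    show "p \<in> P"
    proof (rule Y.homogeneous_relations[OF _ _ u P(1,2)])
      show "length w = m" if "coeff p w \<noteq> 0" for w using p(1) that by (simp add: words_in_def)
      show "mon c a * homc 2 (rel x y) * word b \<in> P"
        if "adj n x y" "length a + 2 + length b = m" for a b c x y
        by (rule P(3)[OF _ that(2)]) (use that(1) in blast)
    qed simp
  qed
qed

end
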